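(* Let $q,k\in\mathbb N$, $m\in\mathbb N_*=\{1,2,\dots\}$ and $e\in\mathcal E$. If $\mu\in\mathcal S_{q,k,m,e}$, then $\mu$ is absolutely continuous with respect to Lebesgue measure and its density $p_\mu$ belongs to $W^{q,e}$ (for $q=0$: $p_\mu\in L^e$). Moreover there is a constant $C$ (depending only on $q,k,m,d,e$) such that for every $\mu\in\mathcal S_{q,k,m,e}$, $$\|p_\mu\|_{q,(e)}\le C\,\rho_{q,k,m,e}(\mu).$$
   Context: A Young function is a function $e:\mathbb R\to\mathbb R_+$ which is symmetric, strictly convex, nonnegative, with $e(0)=0$. $\mathcal E$ denotes the set of Young functions such that (i) there is $\lambda>0$ with $e(2s)\le\lambda e(s)$ for all $s$; (ii) $s\mapsto e(s)/s$ is nondecreasing on $(0,\infty)$. For measurable $f:\mathbb R^d\to\mathbb R$, $\|f\|_{(e)}=\inf\{c>0:\int e(f(x)/c)\,dx\le 1\}$ and $L^e=\{f:\|f\|_{(e)}<\infty\}$. Set $e^{-1}(a)=\sup\{c:e(c)\le a\}$ and $\beta_e(R)=R/e^{-1}(R)$. For multi-indices $\alpha,\gamma\in\mathbb N^d$, $\partial_\alpha=\partial_{x_1}^{\alpha_1}\cdots\partial_{x_d}^{\alpha_d}$, $|\alpha|=\sum\alpha_i$, $x^\gamma=\prod_i x_i^{\gamma_i}$. Norms: $\|f\|_{k,(e)}=\sum_{|\alpha|\le k}\|\partial_\alpha f\|_{(e)}$, $W^{k,e}=\{f:\|f\|_{k,(e)}<\infty\}$; $\|f\|_{k,l,(e)}=\sum_{|\gamma|\le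 l}\sum_{|\alpha|\le k}\|x^\gamma\partial_\alpha f\|_{(e)}$, $W^{k,l,e}=\{f:\|f\|_{k,l,(e)}<\infty\}$; $\|\phi\|_{k,\infty}=\sum_{|\alpha|\le k}\sup_x|\partial_\alpha\phi(x)|$. $\mathcal M$ is the set of finite signed Borel measures on $\mathbb R^d$, $\mathcal M_a\subset\mathcal M$ those absolutely continuous w.r.t. Lebesgue measure, with density $p_\mu$. For $\mu,\nu\in\mathcal M$, $d_k(\mu,\nu)=\sup\{|\int\phi\,d\mu-\int\phi\,d\nu|:\phi\in C^\infty(\mathbb R^d),\|\phi\|_{k,\infty}\le 1\}$. For $\mu\in\mathcal M$ and a sequence $(\mu_n)_{n\in\mathbb N}\subset\mathcal M_a$, $$\pi_{q,k,m,e}(\mu,(\mu_n)_n)=\sum_{n=0}^\infty 2^{n(q+k)}\beta_e(2^{nd})\,d_k(\mu,\mu_n)+\sum_{n=0}^\infty 2^{-2nm}\|p_{\mu_n}\|_{2m+q,2m,(e)},$$ $\rho_{q,k,m,e}(\mu)=\inf\pi_{q,k,m,e}(\mu,(\mu_n)_n)$ over all sequences in $\mathcal M_a$, and $\mathcal S_{q,k,m,e}=\{\mu\in\mathcal M:\rho_{q,k,m,e}(\mu)<\infty\}$. *)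

theory Defs
  imports "HOL-Analysis.Analysis"
begin

definition strictly_convex :: "(real \<Rightarrow> real) \<Rightarrow> bool" where
  "strictly_convex e \<longleftrightarrow>
     (\<forall>x y t. x \<noteq> y \<and> 0 < t \<and> t < 1 \<longrightarrow> e ((1 - t) * x + t * y) < (1 - t) * e x + t * e y)"

definition young_function :: "(real \<Rightarrow> real) \<Rightarrow> bool" where
  "young_function e \<longleftrightarrow> (\<forall>s. e (- s) = e s) \<and> strictly_convex e \<and> (\<forall>s. 0 \<le> e s) \<and> e 0 = 0"

definition class_E :: "(real \<Rightarrow> real) \<Rightarrow> bool" where
  "class_E e \<longleftrightarrow> young_function e
     \<and> (\<exists>L>0. \<forall>s. e (2 * s) \<le> L * e s)
     \<and> mono_on {0<..} (\<lambda>s. e s / s)"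

definition young_inv :: "(real \<Rightarrow> real) \<Rightarrow> real \<Rightarrow> real" where
  "young_inv e a = Sup {c. e c \<le> a}"

definition beta_e :: "(real \<Rightarrow> real) \<Rightarrow> real \<Rightarrow> real" where
  "beta_e e R = R / young_inv e R"

definition orlicz_norm :: "(real \<Rightarrow> real) \<Rightarrow> (real^'n \<Rightarrow> real) \<Rightarrow> ennreal" where
  "orlicz_norm e f =
     (if f \<in> borel_measurable lborel
      then Inf (ennreal ` {c. c > 0 \<and> (\<integral>\<^sup>+ x. ennreal (e (f x / c)) \<partial>lborel) \<le> 1})
      else top)"

definition pdir :: "'n::finite \<Rightarrow> (real^'n \<Rightarrow> real) \<Rightarrow> (real^'n \<Rightarrow> real)" where
  "pdir i f = (\<lambda>x. frechet_derivative f (at x) (axis i 1))"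

fun dlist :: "'n::finite list \<Rightarrow> (real^'n \<Rightarrow> real) \<Rightarrow> (real^'n \<Rightarrow> real)" where
  "dlist [] f = f"
| "dlist (i # is) f = pdir i (dlist is f)"

definition smooth :: "(real^'n::finite \<Rightarrow> real) \<Rightarrow> bool" where
  "smooth f \<longleftrightarrow> (\<forall>xs x. dlist xs f differentiable (at x))"

text \<open>Multi-indices are functions 'n \<Rightarrow> nat; the order of differentiation is irrelevant for smooth functions.\<close>
definition mi_list :: "('n::finite \<Rightarrow> nat) \<Rightarrow> 'n list" where
  "mi_list \<alpha> = (SOME xs. \<forall>i. count_list xs i = \<alpha> i)"

definition dmi :: "('n::finite \<Rightarrow> nat) \<Rightarrow> (real^'n \<Rightarrow> real) \<Rightarrow> (real^'n \<Rightarrow> real)" where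
  "dmi \<alpha> f = dlist (mi_list \<alpha>) f"

definition mi_abs :: "('n::finite \<Rightarrow> nat) \<Rightarrow> nat" where
  "mi_abs \<alpha> = (\<Sum>i\<in>UNIV. \<alpha> i)"

definition multi_indices :: "nat \<Rightarrow> ('n::finite \<Rightarrow> nat) set" where
  "multi_indices k = {\<alpha>. mi_abs \<alpha> \<le> k}"

definition monom :: "('n::finite \<Rightarrow> nat) \<Rightarrow> real^'n \<Rightarrow> real" where
  "monom \<gamma> x = (\<Prod>i\<in>UNIV. (x $ i) ^ \<gamma> i)"

definition sup_norm_k :: "nat \<Rightarrow> (real^'n::finite \<Rightarrow> real) \<Rightarrow> ennreal" where
  "sup_norm_k k \<phi> = (\<Sum>\<alpha>\<in>multi_indices k. (SUP x. ennreal \<bar>dmi \<alpha> \<phi> x\<bar>))"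

definition locally_integrable :: "(real^'n::finite \<Rightarrow> real) \<Rightarrow> bool" where
  "locally_integrable f \<longleftrightarrow> f \<in> borel_measurable lborel \<and> (\<forall>K. compact K \<longrightarrow> set_integrable lborel K f)"

definition test_function :: "(real^'n::finite \<Rightarrow> real) \<Rightarrow> bool" where
  "test_function \<phi> \<longleftrightarrow> smooth \<phi> \<and> compact (closure {x. \<phi> x \<noteq> 0})"

definition weak_deriv :: "('n::finite \<Rightarrow> nat) \<Rightarrow> (real^'n \<Rightarrow> real) \<Rightarrow> (real^'n \<Rightarrow> real) \<Rightarrow> bool" where
  "weak_deriv \<alpha> f g \<longleftrightarrow> locally_integrable f \<and> locally_integrable g \<and>
     (\<forall>\<phi>. test_function \<phi> \<longrightarrow>
        (LINT x|lborel. f x * dmi \<alpha> \<phi> x) = (-1) ^ mi_abs \<alpha> * (LINT x|lborel. g x * \<phi> x))"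

text \<open>Orlicz norm of x^\<gamma> \<partial>_\<alpha> f (\<infinity> if the weak derivative does not exist);
  the choice of representative g is irrelevant since g is unique a.e.\<close>
definition weighted_deriv_norm ::
  "(real \<Rightarrow> real) \<Rightarrow> ('n::finite \<Rightarrow> nat) \<Rightarrow> ('n \<Rightarrow> nat) \<Rightarrow> (real^'n \<Rightarrow> real) \<Rightarrow> ennreal" where
  "weighted_deriv_norm e \<gamma> \<alpha> f = Inf ((\<lambda>g. orlicz_norm e (\<lambda>x. monom \<gamma> x * g x)) ` {g. weak_deriv \<alpha> f g})"

definition sobolev_weighted_norm :: "nat \<Rightarrow> nat \<Rightarrow> (real \<Rightarrow> real) \<Rightarrow> (real^'n::finite \<Rightarrow> real) \<Rightarrow> ennreal" where
  "sobolev_weighted_norm k l e f =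
     (\<Sum>\<gamma>\<in>multi_indices l. \<Sum>\<alpha>\<in>multi_indices k. weighted_deriv_norm e \<gamma> \<alpha> f)"

definition sobolev_norm :: "nat \<Rightarrow> (real \<Rightarrow> real) \<Rightarrow> (real^'n::finite \<Rightarrow> real) \<Rightarrow> ennreal" where
  "sobolev_norm k e f = (\<Sum>\<alpha>\<in>multi_indices k. weighted_deriv_norm e (\<lambda>_. 0) \<alpha> f)"

definition W_space :: "nat \<Rightarrow> (real \<Rightarrow> real) \<Rightarrow> (real^'n::finite \<Rightarrow> real) set" where
  "W_space k e = {f. sobolev_norm k e f < top}"

section \<open>Finite signed Borel measures, represented as differences M1 - M2 of finite Borel measures\<close>

type_synonym 'n smeasure = "(real^'n) measure \<times> (real^'n) measure"

definition finite_signed_measure :: "'n::finite smeasure \<Rightarrow> bool" where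
  "finite_signed_measure \<mu> \<longleftrightarrow>
     finite_measure (fst \<mu>) \<and> finite_measure (snd \<mu>) \<and>
     sets (fst \<mu>) = sets borel \<and> sets (snd \<mu>) = sets borel"

definition sm_apply :: "'n::finite smeasure \<Rightarrow> (real^'n) set \<Rightarrow> real" where
  "sm_apply \<mu> A = measure (fst \<mu>) A - measure (snd \<mu>) A"

definition sm_integral :: "'n::finite smeasure \<Rightarrow> (real^'n \<Rightarrow> real) \<Rightarrow> real" where
  "sm_integral \<mu> \<phi> = (\<integral>x. \<phi> x \<partial>(fst \<mu>)) - (\<integral>x. \<phi> x \<partial>(snd \<mu>))"

text \<open>Absolute continuity of a signed measure: |\<mu>|(A) = 0 whenever A is Lebesgue-null,
  i.e. \<mu> vanishes on all Borel subsets of Lebesgue-null Borel sets.\<close>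
definition sm_abs_cont :: "'n::finite smeasure \<Rightarrow> bool" where
  "sm_abs_cont \<mu> \<longleftrightarrow>
     (\<forall>A \<in> sets borel. emeasure lborel A = 0 \<longrightarrow> (\<forall>B \<in> sets borel. B \<subseteq> A \<longrightarrow> sm_apply \<mu> B = 0))"

definition is_density :: "'n::finite smeasure \<Rightarrow> (real^'n \<Rightarrow> real) \<Rightarrow> bool" where
  "is_density \<mu> p \<longleftrightarrow> integrable lborel p \<and>
     (\<forall>A \<in> sets borel. sm_apply \<mu> A = (LINT x:A|lborel. p x))"

text \<open>d_k(\<mu>, \<nu>) where \<nu> \<in> M_a has Lebesgue density p.\<close>
definition d_k :: "nat \<Rightarrow> 'n::finite smeasure \<Rightarrow> (real^'n \<Rightarrow> real) \<Rightarrow> ennreal" where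
  "d_k k \<mu> p = (SUP \<phi>\<in>{\<phi>. smooth \<phi> \<and> sup_norm_k k \<phi> \<le> 1}.
                  ennreal \<bar>sm_integral \<mu> \<phi> - (LINT x|lborel. \<phi> x * p x)\<bar>)"

text \<open>\<pi>_{q,k,m,e}(\<mu>, (\<mu>_n)_n) with \<mu>_n given by its density p n.\<close>
definition pi_qkme :: "nat \<Rightarrow> nat \<Rightarrow> nat \<Rightarrow> (real \<Rightarrow> real) \<Rightarrow> 'n::finite smeasure
                        \<Rightarrow> (nat \<Rightarrow> real^'n \<Rightarrow> real) \<Rightarrow> ennreal" where
  "pi_qkme q k m e \<mu> p =
     (\<Sum>n. ennreal (2 ^ (n * (q + k)) * beta_e e (2 ^ (n * CARD('n)))) * d_k k \<mu> (p n))
   + (\<Sum>n. ennreal (1 / 2 ^ (2 * n * m)) * sobolev_weighted_norm (2 * m + q) (2 * m) e (p n))"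

text \<open>\<rho>: infimum over all sequences (\<mu>_n) in M_a, i.e. over all sequences of L^1 densities.\<close>
definition rho_qkme :: "nat \<Rightarrow> nat \<Rightarrow> nat \<Rightarrow> (real \<Rightarrow> real) \<Rightarrow> 'n::finite smeasure \<Rightarrow> ennreal" where
  "rho_qkme q k m e \<mu> = (INF p\<in>{p. \<forall>n. integrable lborel (p n)}. pi_qkme q k m e \<mu> p)"

definition S_qkme :: "nat \<Rightarrow> nat \<Rightarrow> nat \<Rightarrow> (real \<Rightarrow> real) \<Rightarrow> 'n::finite smeasure set" where
  "S_qkme q k m e = {\<mu>. finite_signed_measure \<mu> \<and> rho_qkme q k m e \<mu> < top}"

end

theory Submission
  imports Defs "HOL-Computational_Algebra.Polynomial" "HOL-Real_Asymp.Real_Asymp"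
begin

text \<open>Let \<open>K\<^sub>n\<close> be a compactly supported kernel of integral 1 at scale \<open>2^(-n)\<close>, chosen such that
  \<open>K\<^sub>n\<^sub>+\<^sub>1 - K\<^sub>n\<close> is \<open>2^(-2nm)\<close> times a sum of derivatives of order \<open>2m\<close> of kernels at the same scale, and
  write \<open>\<mu> * (K\<^sub>n\<^sub>+\<^sub>1 - K\<^sub>n) = (\<mu> - \<mu>\<^sub>n) * (K\<^sub>n\<^sub>+\<^sub>1 - K\<^sub>n) + \<mu>\<^sub>n * (K\<^sub>n\<^sub>+\<^sub>1 - K\<^sub>n)\<close>. A derivative of order at
  most \<open>q\<close> of the first term has \<open>L\<^sup>1\<close> norm at most \<open>C 2^(n(q+k)) d\<^sub>k(\<mu>, \<mu>\<^sub>n)\<close> and \<open>L\<^sup>\<infinity>\<close> norm at most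
  \<open>2^(nd)\<close> times that, hence Orlicz norm at most \<open>C 2^(n(q+k)) \<beta>(2^(nd)) d\<^sub>k(\<mu>, \<mu>\<^sub>n)\<close>. In the second term
  the \<open>2m\<close> derivatives are moved to the density of \<open>\<mu>\<^sub>n\<close>, which gives \<open>C 2^(-2nm)\<close> times its Sobolev
  norm. So the derivatives of \<open>\<mu> * K\<^sub>n\<close> up to order \<open>q\<close> converge in the Orlicz norm, and the limits are
  the weak derivatives of a density of \<open>\<mu>\<close>.\<close>

text \<open>At the start \<mu> has no density, and \<open>d_k\<close> gives access to it only
  through smooth test functions. A kernel, or a bounded function convolved with one, must therefore
  play the test function. This explains \<open>2^(n(q+k))\<close>: q derivatives are wanted, k more
  enter the norm of the test function, and each costs \<open>2^n\<close> at scale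
  \<open>2^(-n)\<close>. The factor \<open>beta_e\<close> is the price of the gap
  \<open>R = 2^(nd)\<close> between the height and the mass of a kernel. Differences of kernels are
  used because smoothing \<mu>\<open>_n\<close> by a single kernel gains nothing, while a difference
  that is an exact derivative gains a power of the scale. In several variables such a difference is
  obtained by refining one coordinate at a time. Compact support of the kernels lets them act as
  test functions for weak derivatives that are only locally integrable, and bounds smoothing by an
  average over a cube, where Jensen's inequality applies. Orlicz bounds give only local
  integrability of the limit; its global integrability comes from the finite total mass of
  \<mu>.\<close>

section \<open>Lebesgue measure under reflection and translation\<close>

lemma lborel_distr_reflect: "distr lborel borel (\<lambda>z. x - z) = (lborel :: 'a::euclidean_space measure)"
  by (subst (2) lborel_affine[of "-1" x]) (auto simp: density_1 one_ennreal_def[symmetric])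

lemma integrable_lborel_reflect:
  fixes f :: "'a::euclidean_space \<Rightarrow> real"
  assumes "integrable lborel f"
  shows "integrable lborel (\<lambda>z. f (x - z))"
proof -
  have "integrable (distr lborel borel (\<lambda>z. x - z)) f" using assms by (simp add: lborel_distr_reflect)
  moreover have "f \<in> borel_measurable borel" using borel_measurable_integrable[OF assms] by simp
  ultimately show ?thesis by (subst (asm) integrable_distr_eq) auto
qed

lemma integral_lborel_reflect:
  fixes f :: "'a::euclidean_space \<Rightarrow> real"
  shows "f \<in> borel_measurable borel \<Longrightarrow> (LINT z|lborel. f (x - z)) = (LINT z|lborel. f z)"
  by (subst (2) lborel_distr_reflect[of x, symmetric], subst integral_distr) auto

lemma nn_integral_lborel_translate:
  "f \<in> borel_measurable borel \<Longrightarrow>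
    (\<integral>\<^sup>+z. f (z - x) \<partial>lborel) = (\<integral>\<^sup>+z. f (z :: 'a::euclidean_space) \<partial>lborel)"
  by (subst (2) lborel_distr_plus[of "-x", symmetric], subst nn_integral_distr) auto

lemma integrable_lborel_translate:
  fixes f :: "'a::euclidean_space \<Rightarrow> real"
  assumes "integrable lborel f"
  shows "integrable lborel (\<lambda>z. f (z - x))"
proof -
  have "integrable (distr lborel borel ((+) (- x))) f" using assms by (simp add: lborel_distr_plus)
  moreover have "f \<in> borel_measurable borel" using borel_measurable_integrable[OF assms] by simp
  ultimately show ?thesis by (subst (asm) integrable_distr_eq) auto
qed

lemma integral_lborel_translate:
  fixes f :: "'a::euclidean_space \<Rightarrow> real"
  shows "f \<in> borel_measurable borel \<Longrightarrow> (LINT z|lborel. f (z - x)) = (LINT z|lborel. f z)"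
  by (subst (2) lborel_distr_plus[of "- x", symmetric], subst integral_distr) auto

lemma locally_integrable_reflect:
  assumes g: "locally_integrable g" and K: "compact K"
  shows "set_integrable lborel K (\<lambda>z. \<bar>g (x - z)\<bar>)"
proof -
  have "compact ((\<lambda>z. x - z) ` K)"
    by (intro compact_continuous_image continuous_intros K)
  then have "set_integrable lborel ((\<lambda>z. x - z) ` K) g"
    using g by (simp add: locally_integrable_def)
  then have "integrable lborel (\<lambda>z. indicator ((\<lambda>z. x - z) ` K) z *\<^sub>R g z)"
    by (simp add: set_integrable_def)
  then have "integrable lborel (\<lambda>z. indicator ((\<lambda>z. x - z) ` K) (x - z) *\<^sub>R g (x - z))"
    by (rule integrable_lborel_reflect)
  moreover have "indicator ((\<lambda>z. x - z) ` K) (x - z) = (indicator K z :: real)" for z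
    by (auto simp: indicator_def)
  ultimately have "set_integrable lborel K (\<lambda>z. g (x - z))" by (simp add: set_integrable_def)
  then show ?thesis by (rule set_integrable_abs)
qed

text \<open>Orlicz norms, \<open>weighted_deriv_norm\<close> and \<open>rho_qkme\<close> are infima.
  They are compared through the reals strictly above them, each of which is beaten by an actual
  witness. Positivity of \<open>B\<close> makes the right side infinite when \<open>x\<close>
  is.\<close>

lemma ennreal_le_by_approximation:
  assumes "B > 0" and le: "\<And>c. 0 < c \<Longrightarrow> x < ennreal c \<Longrightarrow> y \<le> ennreal (B * c)"
  shows "y \<le> ennreal B * x"
proof (cases x)
  case top
  then show ?thesis using assms by (simp add: ennreal_mult_top)
next
  case (real r)
  show ?thesis
  proof (rule ennreal_le_epsilon)
    fix d :: real assume "0 < d"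
    have "x < ennreal (r + d / B)"
      using real \<open>0 < d\<close> \<open>B > 0\<close> by (simp add: ennreal_lessI)
    moreover have "0 < r + d / B" using real \<open>0 < d\<close> \<open>B > 0\<close> by (simp add: add_nonneg_pos)
    ultimately have "y \<le> ennreal (B * (r + d / B))" by (intro le)
    also have "B * (r + d / B) = B * r + d" using \<open>B > 0\<close> by (simp add: field_simps)
    also have "ennreal (B * r + d) = ennreal B * x + ennreal d"
      using real \<open>0 < d\<close> \<open>B > 0\<close> by (simp add: ennreal_mult)
    finally show "y \<le> ennreal B * x + ennreal d" .
  qed
qed

subsection \<open>Young functions\<close>

context
  fixes e :: "real \<Rightarrow> real"
  assumes E: "class_E e"
begin

lemma young_even: "e (- s) = e s" and young_nonneg: "0 \<le> e s" and young_0: "e 0 = 0"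
  using E by (auto simp: class_E_def young_function_def)

lemma young_abs: "e \<bar>s\<bar> = e s"
  using young_even by (cases "s \<ge> 0") (auto simp: abs_if)

lemma young_convex: "convex_on UNIV e"
proof (rule convex_onI)
  fix t x y :: real assume "0 < t" "t < 1"
  then show "e ((1 - t) *\<^sub>R x + t *\<^sub>R y) \<le> (1 - t) * e x + t * e y"
    using E by (cases "x = y") (auto simp: class_E_def young_function_def strictly_convex_def less_imp_le simp flip: distrib_right)
qed simp

lemma young_continuous: "continuous_on UNIV e"
  by (rule convex_on_continuous[OF open_UNIV young_convex])

lemma young_borel [measurable]: "e \<in> borel_measurable borel"
  by (rule borel_measurable_continuous_onI[OF young_continuous])

text \<open>Strict convexity at the midpoint of 0 and \<open>s\<close>. Positivity at 1 is what
  permits the divisions by \<open>e 1\<close> below.\<close>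

lemma young_pos: "s \<noteq> 0 \<Longrightarrow> 0 < e s"
proof -
  assume "s \<noteq> 0"
  then have "e ((1 - 1/2) * 0 + 1/2 * s) < (1 - 1/2) * e 0 + 1/2 * e s"
    using E unfolding class_E_def young_function_def strictly_convex_def
    by (elim conjE allE[of _ 0] allE[of _ s] allE[of _ "1/2"]) simp
  with young_nonneg[of "s/2"] young_0 show ?thesis by simp
qed

text \<open>This is the monotonicity of \<open>e s / s\<close> in the form used later: convexity and
  \<open>e 0 = 0\<close> put the graph below the chord through the origin.\<close>

lemma young_below_chord: "\<bar>s\<bar> \<le> y \<Longrightarrow> 0 < y \<Longrightarrow> e s \<le> \<bar>s\<bar> * (e y / y)"
proof -
  assume s: "\<bar>s\<bar> \<le> y" and y: "0 < y"
  define t where "t = \<bar>s\<bar> / y"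
  have "0 \<le> t" "t \<le> 1" using s y by (auto simp: t_def)
  then have "e ((1 - t) *\<^sub>R 0 + t *\<^sub>R y) \<le> (1 - t) * e 0 + t * e y"
    using young_convex by (intro convex_onD) auto
  then show ?thesis using y by (simp add: t_def young_0 young_abs)
qed

lemma young_mono: "\<bar>s\<bar> \<le> \<bar>t\<bar> \<Longrightarrow> e s \<le> e t"
proof (cases "t = 0")
  case False
  assume "\<bar>s\<bar> \<le> \<bar>t\<bar>"
  then have "e s \<le> \<bar>s\<bar> * (e \<bar>t\<bar> / \<bar>t\<bar>)" using False by (intro young_below_chord) auto
  also have "\<dots> \<le> \<bar>t\<bar> * (e \<bar>t\<bar> / \<bar>t\<bar>)"
    using \<open>\<bar>s\<bar> \<le> \<bar>t\<bar>\<close> young_nonneg by (intro mult_right_mono) auto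
  finally show ?thesis using False young_abs by simp
qed simp

text \<open>Growth at least linear: past 1 the chord slopes are at least \<open>e 1\<close>, and the
  added 1 covers the rest. It bounds sublevel sets of \<open>e\<close> and makes functions of finite
  Orlicz norm locally integrable.\<close>

lemma abs_le_young: "\<bar>s\<bar> \<le> 1 + e s / e 1"
proof (cases "\<bar>s\<bar> \<le> 1")
  case True
  then show ?thesis using young_pos[of 1] young_nonneg[of s] by (simp add: add_increasing2)
next
  case False
  then have "e 1 \<le> \<bar>1\<bar> * (e \<bar>s\<bar> / \<bar>s\<bar>)" by (intro young_below_chord) auto
  then have "\<bar>s\<bar> \<le> e s / e 1" using False young_pos[of 1] young_abs by (simp add: field_simps)
  then show ?thesis by simp
qed

text \<open>Linear growth bounds the sublevel set and continuity closes it, so the supremum defining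
  \<open>young_inv\<close> is attained; without a bound it would be an unspecified real.\<close>

lemma young_inv_pos: "0 < R \<Longrightarrow> 0 < young_inv e R"
  and young_young_inv_le: "0 < R \<Longrightarrow> e (young_inv e R) \<le> R"
proof -
  assume R: "0 < R"
  have bdd: "bdd_above {c. e c \<le> R}"
  proof (rule bdd_aboveI)
    fix c assume "c \<in> {c. e c \<le> R}"
    then have "1 + e c / e 1 \<le> 1 + R / e 1" using young_pos[of 1] by (simp add: divide_right_mono)
    then show "c \<le> 1 + R / e 1" using abs_le_young[of c] by linarith
  qed
  have cl: "closed {c. e c \<le> R}"
    by (intro closed_Collect_le young_continuous continuous_intros)
  have "Sup {c. e c \<le> R} \<in> {c. e c \<le> R}"
    by (rule closed_contains_Sup[OF _ bdd cl]) (use young_0 R in \<open>auto intro!: exI[of _ 0]\<close>)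
  then show "e (young_inv e R) \<le> R" by (simp add: young_inv_def)
  \<comment> \<open>On \<open>[0, 1]\<close> the chord bounds \<open>e c\<close> by
    \<open>c * e 1\<close>, so this positive number lies in the sublevel set.\<close>
  define c where "c = min 1 (R / e 1)"
  have c: "0 < c" "c \<le> 1" using R young_pos[of 1] by (auto simp: c_def)
  then have "e c \<le> \<bar>c\<bar> * (e 1 / 1)" by (intro young_below_chord) auto
  also have "\<dots> \<le> R" using c young_pos[of 1] by (auto simp: c_def min_def field_simps)
  finally have "c \<le> Sup {c. e c \<le> R}" by (intro cSup_upper bdd) auto
  with c show "0 < young_inv e R" by (simp add: young_inv_def)
qed

subsection \<open>The Orlicz norm\<close>

lemma orlicz_norm_leI:
  assumes "f \<in> borel_measurable lborel" "0 < c" "(\<integral>\<^sup>+ x. ennreal (e (f x / c)) \<partial>lborel) \<le> 1"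
  shows "orlicz_norm e f \<le> ennreal c"
  using assms unfolding orlicz_norm_def by (auto intro!: Inf_lower)

text \<open>Admissible constants are upward closed by \<open>young_mono\<close>, so every real
  strictly above the infimum is admissible, and attainment never has to be discussed.\<close>

lemma orlicz_norm_lessD:
  assumes "orlicz_norm e f < ennreal c"
  shows "f \<in> borel_measurable lborel" "0 < c" "(\<integral>\<^sup>+ x. ennreal (e (f x / c)) \<partial>lborel) \<le> 1"
proof -
  show f: "f \<in> borel_measurable lborel"
    using assms by (auto simp: orlicz_norm_def split: if_splits)
  obtain d where d: "0 < d" "(\<integral>\<^sup>+ x. ennreal (e (f x / d)) \<partial>lborel) \<le> 1" "ennreal d < ennreal c"
    using assms f by (auto simp: orlicz_norm_def Inf_less_iff)
  then show c: "0 < c" by (simp add: ennreal_less_iff)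
  have "(\<integral>\<^sup>+ x. ennreal (e (f x / c)) \<partial>lborel) \<le> (\<integral>\<^sup>+ x. ennreal (e (f x / d)) \<partial>lborel)"
    using d c by (intro nn_integral_mono ennreal_leI young_mono) (auto simp: abs_divide frac_le ennreal_less_iff)
  with d show "(\<integral>\<^sup>+ x. ennreal (e (f x / c)) \<partial>lborel) \<le> 1" by simp
qed

lemma orlicz_norm_mono:
  assumes [measurable]: "f \<in> borel_measurable lborel" and "AE x in lborel. \<bar>f x\<bar> \<le> \<bar>g x\<bar>"
  shows "orlicz_norm e f \<le> orlicz_norm e g"
proof -
  have "orlicz_norm e f \<le> ennreal 1 * orlicz_norm e g"
  proof (rule ennreal_le_by_approximation)
    fix c assume c: "0 < c" "orlicz_norm e g < ennreal c"
    have "(\<integral>\<^sup>+ x. ennreal (e (f x / c)) \<partial>lborel) \<le> (\<integral>\<^sup>+ x. ennreal (e (g x / c)) \<partial>lborel)"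
      using assms(2)
      by (intro nn_integral_mono_AE, elim AE_mp)
        (use c in \<open>auto intro!: AE_I2 ennreal_leI young_mono divide_right_mono simp: abs_divide\<close>)
    with orlicz_norm_lessD[OF c(2)] c show "orlicz_norm e f \<le> ennreal (1 * c)"
      by (auto intro!: orlicz_norm_leI)
  qed simp
  then show ?thesis by simp
qed

lemma orlicz_norm_cong: "(\<And>x. \<bar>f x\<bar> = \<bar>g x\<bar>) \<Longrightarrow> f \<in> borel_measurable lborel \<Longrightarrow> g \<in> borel_measurable lborel
    \<Longrightarrow> orlicz_norm e f = orlicz_norm e g"
  by (intro antisym orlicz_norm_mono) auto

lemma orlicz_norm_cmult:
  assumes "0 < c" shows "orlicz_norm e (\<lambda>x. c * f x) \<le> ennreal c * orlicz_norm e f"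
proof (rule ennreal_le_by_approximation[OF assms])
  fix d assume "0 < d" "orlicz_norm e f < ennreal d"
  with orlicz_norm_lessD[OF this(2)] assms show "orlicz_norm e (\<lambda>x. c * f x) \<le> ennreal (c * d)"
    by (intro orlicz_norm_leI) auto
qed

lemma orlicz_norm_0: "orlicz_norm e (\<lambda>x. 0) = 0"
proof -
  have "orlicz_norm e (\<lambda>x. 0) \<le> 0 + ennreal c" if "c > 0" for c
    using that by (intro order_trans[OF orlicz_norm_leI[of _ c]]) (auto simp: young_0)
  then have "orlicz_norm e (\<lambda>x. 0) \<le> 0" by (rule ennreal_le_epsilon)
  then show ?thesis by simp
qed

text \<open>The convexity argument for a Luxemburg norm. The slack \<open>d/2\<close> makes both
  constants positive and strictly above the norms, also when a norm is 0.\<close>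

lemma orlicz_norm_add:
  fixes f g :: "real^'n::finite \<Rightarrow> real"
  shows "orlicz_norm e (\<lambda>x. f x + g x) \<le> orlicz_norm e f + orlicz_norm e g"
proof (cases "orlicz_norm e f + orlicz_norm e g = \<infinity>")
  case False
  then obtain a b where a: "orlicz_norm e f = ennreal a" "0 \<le> a" and b: "orlicz_norm e g = ennreal b" "0 \<le> b"
    by (metis ennreal_cases infinity_ennreal_def ennreal_add_eq_top)
  show ?thesis
  proof (rule ennreal_le_epsilon)
    fix d :: real assume "0 < d"
    define s t where "s = a + d/2" and "t = b + d/2"
    have st: "0 < s" "0 < t" using a b \<open>0 < d\<close> by (auto simp: s_def t_def)
    have "orlicz_norm e f < ennreal s" "orlicz_norm e g < ennreal t"
      using a b \<open>0 < d\<close> by (auto simp: s_def t_def ennreal_less_iff)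
    from this[THEN orlicz_norm_lessD(1)] this[THEN orlicz_norm_lessD(3)]
    have [measurable]: "f \<in> borel_measurable lborel" "g \<in> borel_measurable lborel"
      and le: "(\<integral>\<^sup>+ x. ennreal (e (f x / s)) \<partial>lborel) \<le> 1" "(\<integral>\<^sup>+ x. ennreal (e (g x / t)) \<partial>lborel) \<le> 1" by auto
    \<comment> \<open>With this weight \<open>(f + g) / (s + t)\<close> is a convex combination of
      \<open>f / s\<close> and \<open>g / t\<close>.\<close>
    define u where "u = t / (s + t)"
    have u: "0 \<le> u" "u \<le> 1" "1 - u = s / (s + t)" using st by (auto simp: u_def field_simps)
    have "(\<integral>\<^sup>+ x. ennreal (e ((f x + g x) / (s + t))) \<partial>lborel)
      \<le> (\<integral>\<^sup>+ x. ennreal (1 - u) * ennreal (e (f x / s)) + ennreal u * ennreal (e (g x / t)) \<partial>lborel)"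
    proof (rule nn_integral_mono)
      fix x :: "real^'n"
      have "(f x + g x) / (s + t) = (1 - u) *\<^sub>R (f x / s) + u *\<^sub>R (g x / t)"
        unfolding u(3) using st by (simp add: u_def add_divide_distrib)
      then have "e ((f x + g x) / (s + t)) \<le> (1 - u) * e (f x / s) + u * e (g x / t)"
        using convex_onD[OF young_convex u(1,2)] by (metis UNIV_I)
      then show "ennreal (e ((f x + g x) / (s + t))) \<le> ennreal (1 - u) * ennreal (e (f x / s)) + ennreal u * ennreal (e (g x / t))"
        using u(1,2) young_nonneg by (simp add: ennreal_mult[symmetric] ennreal_plus[symmetric] ennreal_leI del: ennreal_plus)
    qed
    also have "\<dots> = ennreal (1 - u) * (\<integral>\<^sup>+ x. ennreal (e (f x / s)) \<partial>lborel) + ennreal u * (\<integral>\<^sup>+ x. ennreal (e (g x / t)) \<partial>lborel)"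
      by (simp add: nn_integral_add nn_integral_cmult)
    also have "\<dots> \<le> ennreal (1 - u) * 1 + ennreal u * 1"
      by (intro add_mono mult_left_mono le) auto
    also have "\<dots> = 1" using u(1,2) by (simp add: ennreal_plus[symmetric] del: ennreal_plus)
    finally have "orlicz_norm e (\<lambda>x. f x + g x) \<le> ennreal (s + t)"
      using st by (intro orlicz_norm_leI) auto
    also have "ennreal (s + t) = orlicz_norm e f + orlicz_norm e g + ennreal d"
      using a b \<open>0 < d\<close> by (simp add: s_def t_def ennreal_plus[symmetric] del: ennreal_plus)
    finally show "orlicz_norm e (\<lambda>x. f x + g x) \<le> orlicz_norm e f + orlicz_norm e g + ennreal d" .
  qed
qed auto

lemma orlicz_norm_sum: "finite I \<Longrightarrow> orlicz_norm e (\<lambda>x. \<Sum>i\<in>I. f i x) \<le> (\<Sum>i\<in>I. orlicz_norm e (f i))"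
proof (induction I rule: finite_induct)
  case (insert i I)
  then show ?case
    using order_trans[OF orlicz_norm_add[of "f i" "\<lambda>x. \<Sum>i\<in>I. f i x"] add_left_mono[OF insert.IH]] by simp
qed (simp add: orlicz_norm_0)

text \<open>\<open>abs_le_young\<close> applied to \<open>f / c\<close> and integrated: the constant
  term gives the volume of \<open>K\<close>, and the other one is at most \<open>1 / e 1\<close>
  because \<open>c\<close> is admissible.\<close>

lemma set_nn_integral_le_orlicz:
  assumes "orlicz_norm e f < ennreal c" and [measurable]: "K \<in> sets borel"
  shows "(\<integral>\<^sup>+x\<in>K. ennreal \<bar>f x\<bar> \<partial>lborel) \<le> ennreal c * (emeasure lborel K + ennreal (1 / e 1))"
proof -
  note D = orlicz_norm_lessD[OF assms(1)]
  have [measurable]: "f \<in> borel_measurable lborel" by (rule D)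
  have "(\<integral>\<^sup>+x\<in>K. ennreal \<bar>f x\<bar> \<partial>lborel)
    \<le> (\<integral>\<^sup>+x. ennreal c * (indicator K x + ennreal (1 / e 1) * ennreal (e (f x / c))) \<partial>lborel)"
  proof (rule nn_integral_mono)
    fix x
    have "\<bar>f x\<bar> = c * \<bar>f x / c\<bar>" using D(2) by (simp add: abs_divide)
    also have "\<dots> \<le> c * (1 + 1 / e 1 * e (f x / c))"
      using abs_le_young[of "f x / c"] D(2) by (intro mult_left_mono) auto
    finally have "ennreal \<bar>f x\<bar> \<le> ennreal (c * (1 + 1 / e 1 * e (f x / c)))" by (rule ennreal_leI)
    also have "\<dots> = ennreal c * (1 + ennreal (1 / e 1) * ennreal (e (f x / c)))"
      using D(2) young_nonneg by (simp add: ennreal_mult add_nonneg_nonneg del: times_divide_eq_left)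
    finally show "ennreal \<bar>f x\<bar> * indicator K x \<le> ennreal c * (indicator K x + ennreal (1 / e 1) * ennreal (e (f x / c)))"
      by (cases "x \<in> K") auto
  qed
  also have "\<dots> = ennreal c * (emeasure lborel K + ennreal (1 / e 1) * (\<integral>\<^sup>+x. ennreal (e (f x / c)) \<partial>lborel))"
    by (simp add: nn_integral_add nn_integral_cmult)
  also have "\<dots> \<le> ennreal c * (emeasure lborel K + ennreal (1 / e 1) * 1)"
    by (intro mult_left_mono add_left_mono D) auto
  finally show ?thesis by simp
qed

text \<open>\<open>e (s) / s\<close> being nondecreasing interpolates between \<open>L\<^sup>1\<close> and \<open>L\<^sup>\<infinity>\<close>.\<close>
lemma orlicz_norm_interpolation:
  assumes [measurable]: "f \<in> borel_measurable lborel"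
    and A: "0 \<le> A" and R: "0 < R" and sup: "\<And>x. \<bar>f x\<bar> \<le> A * R"
    and L1: "(\<integral>\<^sup>+x. ennreal \<bar>f x\<bar> \<partial>lborel) \<le> ennreal A"
  shows "orlicz_norm e f \<le> ennreal (A * beta_e e R)"
proof (cases "A = 0")
  case True
  then have "f = (\<lambda>x. 0)" using sup by auto
  then show ?thesis by (simp add: orlicz_norm_0)
next
  case False
  with A have A: "0 < A" by simp
  define y where "y = young_inv e R"
  \<comment> \<open>Chosen so that \<open>f / c\<close> never exceeds \<open>y\<close>, where the
    chord of \<open>e\<close> has slope at most \<open>R / y\<close>; then \<open>e (f / c)\<close>
    is at most \<open>\<bar>f\<bar> / A\<close>, and \<open>c\<close> is exactly
    \<open>A * beta_e e R\<close>.\<close>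
  define c where "c = A * R / y"
  have y: "0 < y" "e y \<le> R" using R young_inv_pos young_young_inv_le by (auto simp: y_def)
  have c: "0 < c" using A R y by (simp add: c_def)
  have "(\<integral>\<^sup>+ x. ennreal (e (f x / c)) \<partial>lborel) \<le> (\<integral>\<^sup>+ x. ennreal (1 / A) * ennreal \<bar>f x\<bar> \<partial>lborel)"
  proof (rule nn_integral_mono)
    fix x
    have "\<bar>f x / c\<bar> \<le> A * R / c" using c sup by (simp add: abs_divide divide_right_mono)
    also have "\<dots> = y" using A R y by (simp add: c_def)
    finally have "e (f x / c) \<le> \<bar>f x / c\<bar> * (e y / y)" using y by (intro young_below_chord)
    also have "\<dots> \<le> \<bar>f x / c\<bar> * (R / y)" using y by (intro mult_left_mono divide_right_mono) auto
    also have "\<dots> = 1 / A * \<bar>f x\<bar>" using A R y by (simp add: c_def abs_divide abs_mult)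
    finally show "ennreal (e (f x / c)) \<le> ennreal (1 / A) * ennreal \<bar>f x\<bar>"
      using A by (simp add: ennreal_mult[symmetric] ennreal_leI del: times_divide_eq_left)
  qed
  also have "\<dots> = ennreal (1 / A) * (\<integral>\<^sup>+x. ennreal \<bar>f x\<bar> \<partial>lborel)" by (simp add: nn_integral_cmult)
  also have "\<dots> \<le> ennreal (1 / A) * ennreal A" by (intro mult_left_mono L1) auto
  also have "\<dots> = 1" using A by (simp add: ennreal_mult[symmetric])
  finally have "orlicz_norm e f \<le> ennreal c" by (intro orlicz_norm_leI c) auto
  then show ?thesis by (simp add: c_def beta_e_def y_def)
qed

text \<open>Young's inequality for convolution with a kernel dominated by a normalised indicator:
  Jensen for the uniform probability on \<open>K\<close>, then Tonelli and translation invariance of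
  the modular.\<close>

lemma orlicz_norm_box_average:
  fixes g h :: "real^'n::finite \<Rightarrow> real"
  assumes g: "locally_integrable g" and [measurable]: "h \<in> borel_measurable lborel"
    and K: "compact K" "measure lborel K > 0"
    and B: "0 < B" and le: "\<And>x. \<bar>h x\<bar> \<le> B / measure lborel K * (LINT z:K|lborel. \<bar>g (x - z)\<bar>)"
  shows "orlicz_norm e h \<le> ennreal B * orlicz_norm e g"
proof (rule ennreal_le_by_approximation[OF B])
  fix c assume c: "0 < c" "orlicz_norm e g < ennreal c"
  define V where "V = measure lborel K"
  have V: "0 < V" using K by (simp add: V_def)
  have [measurable]: "g \<in> borel_measurable borel" "K \<in> sets borel"
    using g K by (auto simp: locally_integrable_def compact_imp_closed)
  have KV: "emeasure lborel K = ennreal V"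
    using emeasure_compact_finite[OF K(1)] by (simp add: V_def emeasure_eq_ennreal_measure)
  have int: "set_integrable lborel K (\<lambda>z. \<bar>g (x - z)\<bar>)" for x
    using g K(1) by (rule locally_integrable_reflect)
  have jensen: "ennreal (e (h x / (B * c))) \<le> ennreal (1 / V) * (\<integral>\<^sup>+z\<in>K. ennreal (e (g (x - z) / c)) \<partial>lborel)" for x
  proof (cases "(\<integral>\<^sup>+z\<in>K. ennreal (e (g (x - z) / c)) \<partial>lborel) = \<infinity>")
    case True
    then show ?thesis using V by (simp add: ennreal_mult_top)
  next
    case False
    \<comment> \<open>The mean of \<open>\<bar>g (x - z)\<bar> / c\<close> over \<open>K\<close>.
      Jensen is carried out by integrating a supporting line of \<open>e\<close> at this point,
      whose slope is the \<open>s\<close> below.\<close>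
    define a where "a = (LINT z:K|lborel. \<bar>g (x - z)\<bar>) / (c * V)"
    obtain s where s: "\<And>y. e y \<ge> e a + s * (y - a)"
      using convex_le_Inf_differential[OF young_convex, of a] by auto
    have intE: "set_integrable lborel K (\<lambda>z. e (g (x - z) / c))"
      unfolding set_integrable_def
    proof (rule integrableI_bounded)
      have "(\<integral>\<^sup>+z. ennreal (norm (indicator K z *\<^sub>R e (g (x - z) / c))) \<partial>lborel)
         = (\<integral>\<^sup>+z\<in>K. ennreal (e (g (x - z) / c)) \<partial>lborel)"
        by (intro nn_integral_cong) (auto simp: indicator_def young_nonneg)
      then show "(\<integral>\<^sup>+z. ennreal (norm (indicator K z *\<^sub>R e (g (x - z) / c))) \<partial>lborel) < \<infinity>"
        using False by (simp add: less_top)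
    qed measurable
    have const: "set_integrable lborel K (\<lambda>z. e a - s * a)" "(LINT z:K|lborel. e a - s * a) = (e a - s * a) * V"
      using KV by (auto simp: set_integrable_def set_lebesgue_integral_def V_def)
    have "\<bar>h x / (B * c)\<bar> \<le> (B / V * (LINT z:K|lborel. \<bar>g (x - z)\<bar>)) / (B * c)"
      using divide_right_mono[OF le[of x, folded V_def], of "B * c"] c B by (simp add: abs_divide abs_mult)
    also have "\<dots> = a" using B by (simp add: a_def)
    finally have "e (h x / (B * c)) \<le> e a" by (intro young_mono) auto
    also have "e a = 1 / V * (LINT z:K|lborel. (e a - s * a) + s / c * \<bar>g (x - z)\<bar>)"
    proof -
      have "(LINT z:K|lborel. (e a - s * a) + s / c * \<bar>g (x - z)\<bar>) = (e a - s * a) * V + s / c * (LINT z:K|lborel. \<bar>g (x - z)\<bar>)"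
        by (subst set_integral_add) (use const int in auto)
      also have "(LINT z:K|lborel. \<bar>g (x - z)\<bar>) = a * c * V" using c V by (simp add: a_def)
      finally show ?thesis using c V by (simp add: field_simps)
    qed
    also have "\<dots> \<le> 1 / V * (LINT z:K|lborel. e (g (x - z) / c))"
    proof (intro mult_left_mono set_integral_mono)
      fix z
      show "(e a - s * a) + s / c * \<bar>g (x - z)\<bar> \<le> e (g (x - z) / c)"
        using s[of "\<bar>g (x - z) / c\<bar>", unfolded young_abs] c by (simp add: algebra_simps abs_divide)
    qed (use const int intE V in auto)
    finally have "ennreal (e (h x / (B * c))) \<le> ennreal (1 / V * (LINT z:K|lborel. e (g (x - z) / c)))"
      by (rule ennreal_leI)
    also have "\<dots> = ennreal (1 / V) * ennreal (LINT z:K|lborel. e (g (x - z) / c))"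
      using V by (intro ennreal_mult) (auto simp: set_lebesgue_integral_def young_nonneg intro!: integral_nonneg_AE)
    also have "ennreal (LINT z:K|lborel. e (g (x - z) / c)) = (\<integral>\<^sup>+z\<in>K. ennreal (e (g (x - z) / c)) \<partial>lborel)"
      using intE unfolding set_lebesgue_integral_def set_integrable_def
      by (subst nn_integral_eq_integral[symmetric])
         (auto simp: young_nonneg indicator_def intro!: nn_integral_cong)
    finally show ?thesis .
  qed
  have "(\<integral>\<^sup>+x. ennreal (e (h x / (B * c))) \<partial>lborel)
    \<le> (\<integral>\<^sup>+x. ennreal (1 / V) * (\<integral>\<^sup>+z\<in>K. ennreal (e (g (x - z) / c)) \<partial>lborel) \<partial>lborel)"
    by (intro nn_integral_mono jensen)
  also have "\<dots> = ennreal (1 / V) * (\<integral>\<^sup>+x. (\<integral>\<^sup>+z. ennreal (e (g (x - z) / c)) * indicator K z \<partial>lborel) \<partial>lborel)"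
    by (intro nn_integral_cmult) measurable
  also have "(\<integral>\<^sup>+x. (\<integral>\<^sup>+z. ennreal (e (g (x - z) / c)) * indicator K z \<partial>lborel) \<partial>lborel)
     = (\<integral>\<^sup>+z. (\<integral>\<^sup>+x. ennreal (e (g (x - z) / c)) * indicator K z \<partial>lborel) \<partial>lborel)"
    by (intro lborel_pair.Fubini') measurable
  also have "\<dots> = (\<integral>\<^sup>+z. (\<integral>\<^sup>+x. ennreal (e (g x / c)) \<partial>lborel) * indicator K z \<partial>lborel)"
    by (simp add: nn_integral_multc nn_integral_lborel_translate[of "\<lambda>x. ennreal (e (g x / c))"])
  also have "\<dots> \<le> (\<integral>\<^sup>+z. 1 * indicator K z \<partial>lborel)"
    by (intro nn_integral_mono mult_right_mono orlicz_norm_lessD c) auto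
  also have "\<dots> = ennreal V" by (simp add: KV)
  finally have "(\<integral>\<^sup>+x. ennreal (e (h x / (B * c))) \<partial>lborel) \<le> ennreal (1 / V) * ennreal V"
    by (simp add: mult_left_mono)
  then show "orlicz_norm e h \<le> ennreal (B * c)"
    using V B c by (intro orlicz_norm_leI) (auto simp: ennreal_mult[symmetric])
qed

text \<open>Completeness in Riesz-Fischer form. Local \<open>L^1\<close> bounds on the partial sums
  give convergence almost everywhere, and Fatou's lemma transfers the norm bound to the sum.\<close>

lemma orlicz_norm_suminf:
  fixes f :: "nat \<Rightarrow> real^'n::finite \<Rightarrow> real"
  assumes [measurable]: "\<And>n. f n \<in> borel_measurable lborel"
    and fin: "(\<Sum>n. orlicz_norm e (f n)) < top"
  shows "AE x in lborel. summable (\<lambda>n. \<bar>f n x\<bar>)"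
    and "locally_integrable (\<lambda>x. \<Sum>n. \<bar>f n x\<bar>)"
    and "orlicz_norm e (\<lambda>x. \<Sum>n. \<bar>f n x\<bar>) \<le> (\<Sum>n. orlicz_norm e (f n))"
proof -
  define T where "T = (\<Sum>n. orlicz_norm e (f n))"
  define S where "S = (\<lambda>N x. \<Sum>n<N. \<bar>f n x\<bar>)"
  \<comment> \<open>A real \<open>suminf\<close> says nothing where the series diverges, so
    finiteness is first shown for this extended-valued sum.\<close>
  define G where "G = (\<lambda>x. \<Sum>n. ennreal \<bar>f n x\<bar>)"
  have [measurable]: "S N \<in> borel_measurable lborel" "G \<in> borel_measurable lborel" for N
    by (auto simp: S_def G_def)
  have norm_S: "orlicz_norm e (S N) \<le> T" for N
  proof -
    have "orlicz_norm e (S N) \<le> (\<Sum>n<N. orlicz_norm e (\<lambda>x. \<bar>f n x\<bar>))"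
      unfolding S_def by (intro orlicz_norm_sum) simp
    also have "\<dots> = (\<Sum>n<N. orlicz_norm e (f n))"
      by (intro sum.cong refl orlicz_norm_cong) auto
    also have "\<dots> \<le> T" unfolding T_def by (intro sum_le_suminf) auto
    finally show ?thesis .
  qed
  obtain t where t: "T = ennreal t" "0 \<le> t" using fin by (cases T) (auto simp: T_def)
  have G_int: "(\<integral>\<^sup>+x\<in>K. G x \<partial>lborel) < \<infinity>" if "compact K" for K
  proof -
    have [measurable]: "K \<in> sets borel" using that by (simp add: compact_imp_closed)
    \<comment> \<open>\<open>t + 1\<close> is just some real strictly above the norms of all partial
      sums.\<close>
    define b where "b = ennreal (t + 1) * (emeasure lborel K + ennreal (1 / e 1))"
    have "(\<integral>\<^sup>+x\<in>K. G x \<partial>lborel) = (\<Sum>n. (\<integral>\<^sup>+x\<in>K. ennreal \<bar>f n x\<bar> \<partial>lborel))"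
      unfolding G_def by (subst nn_integral_suminf[symmetric]) auto
    also have "\<dots> \<le> b"
    proof (rule suminf_le_const)
      fix N
      have "(\<Sum>n<N. (\<integral>\<^sup>+x\<in>K. ennreal \<bar>f n x\<bar> \<partial>lborel)) = (\<integral>\<^sup>+x\<in>K. ennreal \<bar>S N x\<bar> \<partial>lborel)"
        by (subst nn_integral_sum[symmetric])
          (auto simp: S_def sum_ennreal[symmetric] sum_distrib_right sum_nonneg abs_of_nonneg simp del: sum_ennreal intro!: nn_integral_cong)
      also have "\<dots> \<le> b" unfolding b_def
        by (intro set_nn_integral_le_orlicz le_less_trans[OF norm_S]) (use t in \<open>auto simp: ennreal_less_iff\<close>)
      finally show "(\<Sum>n<N. (\<integral>\<^sup>+x\<in>K. ennreal \<bar>f n x\<bar> \<partial>lborel)) \<le> b" .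
    qed simp
    also have "b < \<infinity>"
      using emeasure_compact_finite[OF that] by (auto simp: b_def ennreal_mult_less_top)
    finally show ?thesis .
  qed
  \<comment> \<open>Finiteness is known on compact sets only; countably many balls cover the
    space.\<close>
  have "AE x in lborel. \<forall>n::nat. x \<in> cball 0 (real n) \<longrightarrow> G x \<noteq> \<infinity>"
    unfolding AE_all_countable
  proof
    fix n :: nat
    have "AE x in lborel. G x * indicator (cball 0 (real n)) x \<noteq> \<infinity>"
      by (rule nn_integral_PInf_AE, measurable) (use G_int[of "cball 0 (real n)"] in auto)
    then show "AE x in lborel. x \<in> cball 0 (real n) \<longrightarrow> G x \<noteq> \<infinity>"
      by eventually_elim auto
  qed
  then show summ: "AE x in lborel. summable (\<lambda>n. \<bar>f n x\<bar>)"
  proof eventually_elim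
    fix x assume x: "\<forall>n::nat. x \<in> cball 0 (real n) \<longrightarrow> G x \<noteq> \<infinity>"
    obtain n :: nat where "norm x \<le> real n" using real_arch_simple by blast
    with x have "G x \<noteq> top" by (auto simp: dist_norm)
    then show "summable (\<lambda>n. \<bar>f n x\<bar>)" unfolding G_def by (intro summable_suminf_not_top) auto
  qed
  show "locally_integrable (\<lambda>x. \<Sum>n. \<bar>f n x\<bar>)"
    unfolding locally_integrable_def
  proof (intro conjI allI impI)
    fix K :: "(real^'n) set" assume K: "compact K"
    have [measurable]: "K \<in> sets borel" using K by (simp add: compact_imp_closed)
    show "set_integrable lborel K (\<lambda>x. \<Sum>n. \<bar>f n x\<bar>)"
      unfolding set_integrable_def
    proof (rule integrableI_bounded)
      have "(\<integral>\<^sup>+x. ennreal (norm (indicator K x *\<^sub>R (\<Sum>n. \<bar>f n x\<bar>))) \<partial>lborel) = (\<integral>\<^sup>+x\<in>K. G x \<partial>lborel)"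
      proof (rule nn_integral_cong_AE)
        show "AE x in lborel. ennreal (norm (indicator K x *\<^sub>R (\<Sum>n. \<bar>f n x\<bar>))) = G x * indicator K x"
          using summ
        proof eventually_elim
          fix x assume "summable (\<lambda>n. \<bar>f n x\<bar>)"
          then show "ennreal (norm (indicator K x *\<^sub>R (\<Sum>n. \<bar>f n x\<bar>))) = G x * indicator K x"
            by (auto simp: G_def suminf_ennreal2 suminf_nonneg indicator_def)
        qed
      qed
      then show "(\<integral>\<^sup>+x. ennreal (norm (indicator K x *\<^sub>R (\<Sum>n. \<bar>f n x\<bar>))) \<partial>lborel) < \<infinity>"
        using G_int[OF K] by simp
    qed measurable
  qed measurable
  have "orlicz_norm e (\<lambda>x. \<Sum>n. \<bar>f n x\<bar>) \<le> ennreal 1 * T"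
  proof (rule ennreal_le_by_approximation)
    fix c assume c: "0 < c" "T < ennreal c"
    have "(\<integral>\<^sup>+x. ennreal (e ((\<Sum>n. \<bar>f n x\<bar>) / c)) \<partial>lborel) = (\<integral>\<^sup>+x. liminf (\<lambda>N. ennreal (e (S N x / c))) \<partial>lborel)"
    proof (rule nn_integral_cong_AE)
      show "AE x in lborel. ennreal (e ((\<Sum>n. \<bar>f n x\<bar>) / c)) = liminf (\<lambda>N. ennreal (e (S N x / c)))"
        using summ
      proof eventually_elim
        fix x assume "summable (\<lambda>n. \<bar>f n x\<bar>)"
        then have "(\<lambda>N. S N x) \<longlonglongrightarrow> (\<Sum>n. \<bar>f n x\<bar>)"
          unfolding S_def by (rule summable_LIMSEQ)
        moreover have "isCont e y" for y
          using young_continuous by (simp add: continuous_on_eq_continuous_at)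
        ultimately have "(\<lambda>N. e (S N x / c)) \<longlonglongrightarrow> e ((\<Sum>n. \<bar>f n x\<bar>) / c)"
          using c by (intro isCont_tendsto_compose[of _ e] tendsto_divide tendsto_const) auto
        then have "(\<lambda>N. ennreal (e (S N x / c))) \<longlonglongrightarrow> ennreal (e ((\<Sum>n. \<bar>f n x\<bar>) / c))"
          by (rule tendsto_ennrealI)
        then show "ennreal (e ((\<Sum>n. \<bar>f n x\<bar>) / c)) = liminf (\<lambda>N. ennreal (e (S N x / c)))"
          by (metis lim_imp_Liminf trivial_limit_sequentially)
      qed
    qed
    also have "\<dots> \<le> liminf (\<lambda>N. \<integral>\<^sup>+x. ennreal (e (S N x / c)) \<partial>lborel)"
      by (intro nn_integral_liminf) measurable
    also have "\<dots> \<le> liminf (\<lambda>N. 1)"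
      by (intro Liminf_mono always_eventually allI orlicz_norm_lessD(3) le_less_trans[OF norm_S c(2)])
    also have "liminf (\<lambda>N. 1 :: ennreal) = 1" by (simp add: Liminf_const)
    finally show "orlicz_norm e (\<lambda>x. \<Sum>n. \<bar>f n x\<bar>) \<le> ennreal (1 * c)"
      using c by (intro orlicz_norm_leI) auto
  qed simp
  then show "orlicz_norm e (\<lambda>x. \<Sum>n. \<bar>f n x\<bar>) \<le> (\<Sum>n. orlicz_norm e (f n))" by (simp add: T_def)
qed

end

declare young_borel [measurable del]

subsection \<open>A smooth dyadic kernel on the line\<close>

text \<open>Asking for some derivative at each level, instead of iterating \<open>deriv\<close>,
  makes the closure rules provable by induction on the order for all functions at once.
  \<open>times_differentiable_chain\<close> recovers an actual sequence of derivatives.\<close>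

primrec times_differentiable :: "nat \<Rightarrow> (real \<Rightarrow> real) \<Rightarrow> bool" where
  "times_differentiable 0 f \<longleftrightarrow> True"
| "times_differentiable (Suc n) f \<longleftrightarrow>
     (\<exists>f'. (\<forall>x. (f has_real_derivative f' x) (at x)) \<and> times_differentiable n f')"

lemma times_differentiable_Suc: "times_differentiable (Suc n) f \<Longrightarrow> times_differentiable n f"
  by (induction n arbitrary: f) auto

lemma times_differentiable_const: "times_differentiable n (\<lambda>x. c)"
proof (induction n arbitrary: c)
  case (Suc n)
  then show ?case by (auto intro!: exI[of _ "\<lambda>x. 0"])
qed simp

lemma times_differentiable_add:
  "times_differentiable n f \<Longrightarrow> times_differentiable n g \<Longrightarrow> times_differentiable n (\<lambda>x. f x + g x)"
proof (induction n arbitrary: f g)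
  case (Suc n)
  then obtain f' g' where "\<And>x. (f has_real_derivative f' x) (at x)" "times_differentiable n f'"
    "\<And>x. (g has_real_derivative g' x) (at x)" "times_differentiable n g'" by auto
  then show ?case using Suc.IH
    by (auto intro!: exI[of _ "\<lambda>x. f' x + g' x"] derivative_intros)
qed simp

lemma times_differentiable_mult:
  "times_differentiable n f \<Longrightarrow> times_differentiable n g \<Longrightarrow> times_differentiable n (\<lambda>x. f x * g x)"
proof (induction n arbitrary: f g)
  case (Suc n)
  then obtain f' g' where *: "\<And>x. (f has_real_derivative f' x) (at x)" "times_differentiable n f'"
    "\<And>x. (g has_real_derivative g' x) (at x)" "times_differentiable n g'" by auto
  have "((\<lambda>x. f x * g x) has_real_derivative (f' x * g x + f x * g' x)) (at x)" for x
    using DERIV_mult'[OF *(1)[of x] *(3)[of x]] by (simp add: algebra_simps)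
  moreover have "times_differentiable n (\<lambda>x. f' x * g x + f x * g' x)"
    using Suc.prems * by (intro times_differentiable_add Suc.IH) (simp_all add: times_differentiable_Suc del: times_differentiable.simps(2))
  ultimately show ?case
    unfolding times_differentiable.simps by (intro exI[of _ "\<lambda>x. f' x * g x + f x * g' x"]) blast
qed simp

lemma times_differentiable_inverse:
  "times_differentiable n f \<Longrightarrow> (\<And>x. f x \<noteq> 0) \<Longrightarrow> times_differentiable n (\<lambda>x. inverse (f x))"
proof (induction n arbitrary: f)
  case (Suc n)
  then obtain f' where *: "\<And>x. (f has_real_derivative f' x) (at x)" "times_differentiable n f'" by auto
  let ?d = "\<lambda>x. - 1 * (f' x * (inverse (f x) * inverse (f x)))"
  have "((\<lambda>x. inverse (f x)) has_real_derivative ?d x) (at x)" for x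
    by (rule derivative_eq_intros * Suc.prems refl)+ (simp add: mult.commute)
  moreover have "times_differentiable n ?d"
    using Suc.prems * by (intro times_differentiable_mult times_differentiable_const Suc.IH)
      (simp_all add: times_differentiable_Suc del: times_differentiable.simps(2))
  ultimately show ?case
    unfolding times_differentiable.simps by (intro exI[of _ ?d]) blast
qed simp

lemma times_differentiable_affine:
  "times_differentiable n f \<Longrightarrow> times_differentiable n (\<lambda>x. f (a * x + b))"
proof (induction n arbitrary: f)
  case (Suc n)
  then obtain f' where *: "\<And>x. (f has_real_derivative f' x) (at x)" "times_differentiable n f'" by auto
  have "((\<lambda>x. f (a * x + b)) has_real_derivative a * f' (a * x + b)) (at x)" for x
    by (rule DERIV_cong, rule DERIV_chain2[OF *(1)]) (auto intro!: derivative_eq_intros)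
  moreover have "times_differentiable n (\<lambda>x. a * f' (a * x + b))"
    by (intro times_differentiable_mult times_differentiable_const Suc.IH *)
  ultimately show ?case
    unfolding times_differentiable.simps by (intro exI[of _ "\<lambda>x. a * f' (a * x + b)"]) blast
qed simp

lemma times_differentiable_power: "times_differentiable n (\<lambda>x. x ^ k)"
proof -
  have "times_differentiable n (\<lambda>x. x)"
    by (cases n) (auto intro!: exI[of _ "\<lambda>x. 1"] times_differentiable_const)
  then show ?thesis
    by (induction k) (auto intro!: times_differentiable_const times_differentiable_mult)
qed

lemma poly_exp_tendsto_0: "((\<lambda>x. poly P (1/x) * exp (- (1/x))) \<longlongrightarrow> 0) (at_right (0::real))"
proof -
  have "((\<lambda>x. \<Sum>i\<le>degree P. coeff P i * ((1/x)^i * exp (- (1/x)))) \<longlongrightarrow> (\<Sum>i\<le>degree P. coeff P i * 0)) (at_right (0::real))"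
  proof (intro tendsto_sum tendsto_mult tendsto_const)
    fix i
    show "((\<lambda>x. (1/x)^i * exp (- (1/x))) \<longlongrightarrow> 0) (at_right (0::real))"
      by real_asymp
  qed
  then show ?thesis by (simp add: poly_altdef sum_distrib_right mult.assoc)
qed

text \<open>The class of these functions is closed under differentiation, so one induction over the
  order, with \<open>P\<close> arbitrary, suffices.\<close>

lemma times_differentiable_poly_exp:
  "times_differentiable n (\<lambda>x. if x > 0 then poly P (1/x) * exp (- (1/x)) else 0)"
proof (induction n arbitrary: P)
  case (Suc n)
  \<comment> \<open>The chain rule for \<open>1/x\<close> contributes \<open>- 1/x^2\<close> to
    \<open>P'\<close> and \<open>+ 1/x^2\<close> to the exponential factor, that is,
    \<open>X^2 (P - P')\<close> evaluated at \<open>1/x\<close>.\<close>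
  define Q where "Q = [:0, 0, 1:] * (P - pderiv P)"
  let ?f = "\<lambda>P x. if x > 0 then poly P (1/x) * exp (- (1/x)) else (0::real)"
  have "(?f P has_real_derivative ?f Q x) (at x)" for x
  proof -
    consider "x > 0" | "x < 0" | "x = 0" by linarith
    then show ?thesis
    proof cases
      case 1
      have "((\<lambda>x. poly P (1/x) * exp (- (1/x))) has_real_derivative
         (poly (pderiv P) (1/x) * (- (1/x^2)) * exp (- (1/x)) + poly P (1/x) * (exp (- (1/x)) * (1/x^2)))) (at x)"
        using 1
        by (auto intro!: derivative_eq_intros DERIV_chain2[OF poly_DERIV] simp: power2_eq_square)
      also have "(poly (pderiv P) (1/x) * (- (1/x^2)) * exp (- (1/x)) + poly P (1/x) * (exp (- (1/x)) * (1/x^2))) = ?f Q x"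
        using 1 by (simp add: Q_def algebra_simps power2_eq_square)
      finally show ?thesis
        by (rule has_field_derivative_transform_within_open[where S="{0<..}"]) (use 1 in auto)
    next
      case 2
      have "((\<lambda>x. 0) has_real_derivative 0) (at x)" by simp
      then have "(?f P has_real_derivative 0) (at x)"
        by (rule has_field_derivative_transform_within_open[where S="{..<0}"]) (use 2 in auto)
      then show ?thesis using 2 by simp
    next
      case 3
      have "((\<lambda>h. ?f P h / h) \<longlongrightarrow> 0) (at 0)"
        unfolding filterlim_at_split
      proof
        have "eventually (\<lambda>h. h < (0::real)) (at_left 0)"
          by (simp add: eventually_at_left_field) (metis lt_ex)
        then have "eventually (\<lambda>h. 0 = ?f P h / h) (at_left 0)"
          by eventually_elim auto
        then show "((\<lambda>h. ?f P h / h) \<longlongrightarrow> 0) (at_left 0)"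
          by (rule Lim_transform_eventually[rotated]) simp
      next
        have "eventually (\<lambda>h. h > (0::real)) (at_right 0)"
          by (simp add: eventually_at_right_less)
        \<comment> \<open>Dividing by \<open>h\<close> multiplies the polynomial by its variable, so
          the difference quotient at 0 is again a polynomial in \<open>1/h\<close> times the
          exponential.\<close>
        then have "eventually (\<lambda>h. poly ([:0,1:] * P) (1/h) * exp (- (1/h)) = ?f P h / h) (at_right 0)"
          by eventually_elim auto
        then show "((\<lambda>h. ?f P h / h) \<longlongrightarrow> 0) (at_right 0)"
          by (rule Lim_transform_eventually[rotated]) (rule poly_exp_tendsto_0)
      qed
      then show ?thesis
        unfolding 3 DERIV_def by (simp cong: if_cong)
    qed
  qed
  with Suc show ?case
    unfolding times_differentiable.simps by (intro exI[of _ "?f Q"]) blast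
qed simp

text \<open>The witnesses for different orders agree because derivatives are unique, so all of them
  are \<open>deriv f\<close>, which again has every order.\<close>

lemma times_differentiable_chain:
  assumes "\<And>n. times_differentiable n f"
  shows "\<exists>F. F 0 = f \<and> (\<forall>j x. (F j has_real_derivative F (Suc j) x) (at x))"
proof -
  have step: "(f has_real_derivative deriv f x) (at x) \<and> times_differentiable n (deriv f)"
    if f: "\<And>n. times_differentiable n f" for f x n
  proof -
    obtain f' where "\<And>x. (f has_real_derivative f' x) (at x)" "times_differentiable n f'"
      using f[of "Suc n"] by auto
    moreover from this have "f' = deriv f" by (intro ext) (metis DERIV_imp_deriv)
    ultimately show ?thesis by simp
  qed
  have *: "times_differentiable n ((deriv ^^ j) f)" for n j
    by (induction j arbitrary: n) (use assms step in auto)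
  show ?thesis
    by (rule exI[of _ "\<lambda>j. (deriv ^^ j) f"]) (use step[OF *] in auto)
qed

lemma smooth_step:
  "\<exists>H::real\<Rightarrow>real. (\<forall>n. times_differentiable n H) \<and> (\<forall>x\<le>-1. H x = 0) \<and> (\<forall>x\<ge>1. H x = 1)"
proof -
  define f where "f = (\<lambda>x::real. if x > 0 then exp (- (1/x)) else 0)"
  have td: "times_differentiable n f" for n
    using times_differentiable_poly_exp[of n 1] by (simp add: f_def cong: if_cong)
  \<comment> \<open>The arguments \<open>x + 1\<close> and \<open>1 - x\<close> add up to 2, so at
    least one of them is positive.\<close>
  have pos: "f (1 * x + 1) + f (-1 * x + 1) \<noteq> 0" for x
    using exp_gt_zero[of "- (1 / (x + 1))"] exp_gt_zero[of "- (1 / (1 - x))"]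
    by (auto simp: f_def simp del: exp_gt_zero)
  have "times_differentiable n (\<lambda>x. f (1 * x + 1) * inverse (f (1 * x + 1) + f (-1 * x + 1)))" for n
    by (intro times_differentiable_mult times_differentiable_inverse times_differentiable_add
        times_differentiable_affine td pos)
  moreover have "f (1 * x + 1) * inverse (f (1 * x + 1) + f (-1 * x + 1)) = 0" if "x \<le> -1" for x
    using that by (simp add: f_def)
  moreover have "f (1 * x + 1) * inverse (f (1 * x + 1) + f (-1 * x + 1)) = 1" if "x \<ge> 1" for x
    using that by (simp add: f_def)
  ultimately show ?thesis
    by (intro exI[of _ "\<lambda>x. f (1 * x + 1) * inverse (f (1 * x + 1) + f (-1 * x + 1))"]) blast
qed

text \<open>Derivatives on an open set depend only on the values there. This is how all derivatives
  of an abstractly obtained chain become explicit outside \<open>[-1, 1]\<close>.\<close>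

lemma derivative_chain_eq_on_open:
  fixes F G :: "nat \<Rightarrow> real \<Rightarrow> real"
  assumes F: "\<And>j x. (F j has_real_derivative F (Suc j) x) (at x)"
    and G: "\<And>j x. x \<in> S \<Longrightarrow> (G j has_real_derivative G (Suc j) x) (at x)"
    and S: "open S" and eq: "\<And>x. x \<in> S \<Longrightarrow> F 0 x = G 0 x" and x: "x \<in> S"
  shows "F j x = G j x"
  using x
proof (induction j arbitrary: x)
  case (Suc j)
  have "(G j has_real_derivative F (Suc j) x) (at x)"
    using F by (rule has_field_derivative_transform_within_open[OF _ S Suc.prems]) (rule Suc.IH)
  with G[OF Suc.prems] show ?case by (metis DERIV_unique)
qed (use eq in simp)

text \<open>Since \<open>x\<^sup>M\<^sup>-\<^sup>1 H(x) / (M-1)!\<close> is a smoothing, with \<open>H\<close> a smooth step, of the fundamental solution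
  of the \<open>M\<close>-th derivative, its \<open>M\<close>-th derivative \<open>K\<close> is a kernel for which the difference of two
  consecutive dyadic dilates is the \<open>M\<close>-th derivative of a compactly supported function. This replaces
  the vanishing moment conditions.\<close>
lemma dyadic_kernel:
  assumes "M \<ge> 1"
  shows "\<exists>K L :: nat \<Rightarrow> real \<Rightarrow> real.
    (\<forall>j x. (K j has_real_derivative K (Suc j) x) (at x)) \<and>
    (\<forall>j x. (L j has_real_derivative L (Suc j) x) (at x)) \<and>
    (\<forall>j x. \<bar>x\<bar> > 1 \<longrightarrow> K j x = 0) \<and> (\<forall>j x. \<bar>x\<bar> > 1 \<longrightarrow> L j x = 0) \<and>
    (\<forall>j x. L (j + M) x = 2 ^ (j + 1) * K j (2 * x) - K j x) \<and>
    has_bochner_integral lborel (K 0) 1"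
proof -
  obtain H :: "real \<Rightarrow> real" where H: "\<And>n. times_differentiable n H" "\<And>x. x \<le> -1 \<Longrightarrow> H x = 0"
    "\<And>x. x \<ge> 1 \<Longrightarrow> H x = 1"
    using smooth_step by auto
  obtain N where N: "M = Suc N" using assms by (cases M) auto
  have "times_differentiable n (\<lambda>x. x ^ N * H x * inverse (fact N))" for n
    by (intro times_differentiable_mult times_differentiable_const times_differentiable_power H)
  from times_differentiable_chain[OF this] obtain F where
    F0: "F 0 = (\<lambda>x. x ^ N * H x * inverse (fact N))" and
    F: "\<And>j x. (F j has_real_derivative F (Suc j) x) (at x)" by blast
  have F_neg: "F j x = 0" if "x < -1" for j x
    using derivative_chain_eq_on_open[of F "{..< -1}" "\<lambda>j x. 0"] F that
    by (auto simp: F0 H)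
  \<comment> \<open>The derivatives of \<open>x^N / N!\<close>, with which \<open>F\<close> agrees
    to the right of 1. They vanish beyond order \<open>N\<close>, hence \<open>K\<close>, which
    starts at order \<open>M = N + 1\<close>, has bounded support.\<close>
  define G where "G = (\<lambda>j (x::real). if j \<le> N then x ^ (N - j) / fact (N - j) else 0)"
  have G: "(G j has_real_derivative G (Suc j) x) (at x)" for j x
  proof -
    consider "Suc j \<le> N" | "j = N" | "j > N" by linarith
    then show ?thesis
    proof cases
      case 1
      then obtain i where i: "N - j = Suc i" "N - Suc j = i"
        by (metis Suc_diff_Suc Suc_le_lessD)
      have "((\<lambda>x. x ^ Suc i / fact (Suc i)) has_real_derivative x ^ i / fact i) (at x)"
        using DERIV_cdivide[OF DERIV_pow[of "Suc i" x UNIV], of "fact (Suc i)"]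
        by (simp add: field_simps del: of_nat_Suc)
      with 1 i show ?thesis by (simp add: G_def)
    qed (auto simp: G_def)
  qed
  have F_pos: "F j x = G j x" if "x > 1" for j x
    using derivative_chain_eq_on_open[of F "{1<..}" G] F G that
    by (auto simp: F0 G_def H field_simps)
  define K where "K = (\<lambda>j. F (j + M))"
  \<comment> \<open>The \<open>j\<close>-th derivative of \<open>2^(-N) F(2x) - F(x)\<close>. As
    \<open>x^N\<close> is homogeneous of degree \<open>N\<close>, this function vanishes for
    \<open>x > 1\<close>; and \<open>2^(-N) * 2^(j+M) = 2^(j+1)\<close> yields the dilation
    identity.\<close>
  define L where "L = (\<lambda>j x. (1/2) ^ N * (2 ^ j * F j (2 * x)) - F j x)"
  have K: "(K j has_real_derivative K (Suc j) x) (at x)" for j x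
    using F[of "j + M"] by (simp add: K_def)
  have L: "(L j has_real_derivative L (Suc j) x) (at x)" for j x
    unfolding L_def
    by (rule derivative_eq_intros DERIV_chain2[OF F] F refl)+ simp
  have Ksupp: "K j x = 0" if "\<bar>x\<bar> > 1" for j x
  proof (cases "x > 1")
    case True then show ?thesis using F_pos by (simp add: K_def G_def N)
  next
    case False then show ?thesis using F_neg that by (simp add: K_def)
  qed
  have L0: "L 0 x = 0" if "\<bar>x\<bar> > 1" for x
  proof (cases "x > 1")
    case True then show ?thesis by (simp add: L_def F0 H power_mult_distrib power_one_over)
  next
    case False then show ?thesis using that by (simp add: L_def F0 H)
  qed
  have "open {x::real. \<bar>x\<bar> > 1}"
    by (intro open_Collect_less continuous_intros)
  then have Lsupp: "L j x = 0" if "\<bar>x\<bar> > 1" for j x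
    using derivative_chain_eq_on_open[of L "{x. \<bar>x\<bar> > 1}" "\<lambda>j x. 0"] L L0 that by simp
  have LK: "L (j + M) x = 2 ^ (j + 1) * K j (2 * x) - K j x" for j x
    by (simp add: L_def K_def N power_add power_one_over)
  have "isCont (K 0) x" for x using K DERIV_isCont by blast
  \<comment> \<open>The integral is \<open>F N 2 - F N (-2) = 1 - 0\<close>. The endpoints are taken
    at distance 2 because \<open>F\<close> is known only strictly outside
    \<open>[-1, 1]\<close>.\<close>
  then have "has_bochner_integral lborel (\<lambda>x. K 0 x * indicator {-2..2} x) (F N 2 - F N (-2))"
    by (intro has_bochner_integral_FTC_Icc_real) (use F in \<open>auto simp: K_def N\<close>)
  moreover have "(\<lambda>x. K 0 x * indicator {-2..2} x) = K 0"
  proof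
    show "K 0 x * indicator {-2..2} x = K 0 x" for x
      using Ksupp[of x 0] by (cases "\<bar>x\<bar> > 1") (auto simp: indicator_def)
  qed
  ultimately have "has_bochner_integral lborel (K 0) 1"
    by (simp add: F_pos F_neg G_def)
  then show ?thesis
    by (intro exI[of _ K] exI[of _ L] conjI allI impI K L Ksupp Lsupp LK)
qed

subsection \<open>Multi-indices\<close>

lemma count_list_mi_list [simp]: "count_list (mi_list \<alpha>) i = \<alpha> i"
proof -
  have rep: "count_list (replicate n a) i = (if a = i then n else 0)" for n a and i :: 'a
    by (induction n) auto
  have "\<exists>xs. \<forall>i. count_list xs i = (if i \<in> S then \<alpha> i else 0)" if "finite S" for S
    using that
  proof (induction S rule: finite_induct)
    case empty
    then show ?case by (intro exI[of _ "[]"]) simp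
  next
    case (insert s S)
    then obtain xs where "\<forall>i. count_list xs i = (if i \<in> S then \<alpha> i else 0)" by blast
    with insert.hyps show ?case
      by (intro exI[of _ "replicate (\<alpha> s) s @ xs"]) (auto simp: rep)
  qed
  from this[of UNIV] have "\<exists>xs. \<forall>i. count_list xs i = \<alpha> i" by simp
  from someI_ex[OF this] show ?thesis unfolding mi_list_def by blast
qed

lemma mi_abs_add: "mi_abs (\<lambda>i. a i + b i) = mi_abs a + mi_abs b"
  by (simp add: mi_abs_def sum.distrib)

lemma mi_abs_Suc: "mi_abs (a(i := Suc (a i))) = Suc (mi_abs a)"
proof -
  have "a(i := Suc (a i)) = (\<lambda>j. a j + (if j = i then 1 else 0))" by auto
  then show ?thesis by (simp only: mi_abs_add) (simp add: mi_abs_def)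
qed

lemma mi_abs_0 [simp]: "mi_abs (\<lambda>_. 0) = 0"
  by (simp add: mi_abs_def)

lemma finite_multi_indices: "finite (multi_indices k)"
proof -
  have "multi_indices k \<subseteq> {f. \<forall>i. f i \<in> {..k}}"
    by (auto simp: multi_indices_def mi_abs_def intro: order_trans[OF member_le_sum[of _ UNIV]])
  moreover have "finite {f :: 'a \<Rightarrow> nat. \<forall>i. f i \<in> {..k}}"
    using finite_PiE[of "UNIV :: 'a set" "\<lambda>_. {..k}"] by (simp add: PiE_UNIV_domain Pi_def)
  ultimately show ?thesis by (rule finite_subset)
qed

subsection \<open>Families of partial derivatives\<close>

text \<open>Indexing the partial derivatives by multi-indices encodes their symmetry, so that the order of
  differentiation never matters for the functions used below.\<close>
definition deriv_family :: "(('n::finite \<Rightarrow> nat) \<Rightarrow> real^'n \<Rightarrow> real) \<Rightarrow> bool" where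
  "deriv_family D \<longleftrightarrow>
     (\<forall>a x. (D a has_derivative (\<lambda>h. \<Sum>i\<in>UNIV. h $ i * D (a(i := Suc (a i))) x)) (at x))"

lemma deriv_familyD:
  "deriv_family D \<Longrightarrow> (D a has_derivative (\<lambda>h. \<Sum>i\<in>UNIV. h $ i * D (a(i := Suc (a i))) x)) (at x)"
  by (simp add: deriv_family_def)

lemma deriv_family_continuous: "deriv_family D \<Longrightarrow> continuous_on S (D a)"
  by (meson continuous_at_imp_continuous_on deriv_familyD has_derivative_continuous)

lemma deriv_family_borel: "deriv_family D \<Longrightarrow> D a \<in> borel_measurable borel"
  by (intro borel_measurable_continuous_onI deriv_family_continuous)

lemma pdir_eqI:
  assumes "\<And>x. (f has_derivative (\<lambda>h. \<Sum>j\<in>UNIV. h $ j * g j x)) (at x)"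
  shows "pdir i f = g i"
proof
  fix x
  have "(\<Sum>j\<in>UNIV. axis i 1 $ j * g j x) = (\<Sum>j\<in>UNIV. if j = i then g j x else 0)"
    by (intro sum.cong) (auto simp: axis_def)
  then show "pdir i f x = g i x"
    unfolding pdir_def frechet_derivative_at[OF assms, symmetric] by simp
qed

lemma pdir_deriv_family: "deriv_family D \<Longrightarrow> pdir i (D a) = D (a(i := Suc (a i)))"
  by (rule pdir_eqI[of _ "\<lambda>i. D (a(i := Suc (a i)))"]) (rule deriv_familyD)

text \<open>The bridge to \<open>dlist\<close>: a list of directions matters only through its
  counts, so the arbitrary order chosen in \<open>mi_list\<close> disappears.\<close>

lemma dlist_deriv_family: "deriv_family D \<Longrightarrow> dlist xs (D a) = D (\<lambda>i. a i + count_list xs i)"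
proof (induction xs)
  case (Cons i xs)
  then show ?case
    by (simp add: pdir_deriv_family) (intro arg_cong[of _ _ D], auto)
qed simp

lemma dmi_deriv_family: "deriv_family D \<Longrightarrow> dmi \<alpha> (D a) = D (\<lambda>i. a i + \<alpha> i)"
  by (simp add: dmi_def dlist_deriv_family)

lemma smooth_deriv_family: "deriv_family D \<Longrightarrow> smooth (D a)"
  unfolding smooth_def differentiable_def
  by (auto simp: dlist_deriv_family intro!: exI deriv_familyD)

lemma deriv_family_cmult:
  assumes "deriv_family D" shows "deriv_family (\<lambda>a x. c * D a x)"
  unfolding deriv_family_def
proof (intro allI)
  fix a x
  have "((\<lambda>x. c * D a x) has_derivative (\<lambda>h. c * (\<Sum>i\<in>UNIV. h $ i * D (a(i := Suc (a i))) x))) (at x)"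
    by (intro has_derivative_mult_right deriv_familyD assms)
  then show "((\<lambda>x. c * D a x) has_derivative (\<lambda>h. \<Sum>i\<in>UNIV. h $ i * (c * D (a(i := Suc (a i))) x))) (at x)"
    by (simp add: sum_distrib_left mult.left_commute)
qed

text \<open>The function of \<open>y\<close> through which a kernel is paired with a measure; each
  derivative in \<open>y\<close> costs a sign.\<close>

lemma deriv_family_reflect:
  assumes "deriv_family D" shows "deriv_family (\<lambda>a y. (-1) ^ mi_abs a * D a (x - y))"
  unfolding deriv_family_def
proof (intro allI)
  fix a y
  have "((\<lambda>y. D a (x - y)) has_derivative (\<lambda>h. \<Sum>i\<in>UNIV. (- h) $ i * D (a(i := Suc (a i))) (x - y))) (at y)"
    by (rule has_derivative_compose[of "\<lambda>y. x - y" "\<lambda>h. - h", OF _ deriv_familyD[OF assms]])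
      (auto intro!: derivative_eq_intros)
  then have "((\<lambda>y. (-1) ^ mi_abs a * D a (x - y)) has_derivative
     (\<lambda>h. (-1) ^ mi_abs a * (\<Sum>i\<in>UNIV. (- h) $ i * D (a(i := Suc (a i))) (x - y)))) (at y)"
    by (rule has_derivative_mult_right)
  then show "((\<lambda>y. (-1) ^ mi_abs a * D a (x - y)) has_derivative
     (\<lambda>h. \<Sum>i\<in>UNIV. h $ i * ((-1) ^ mi_abs (a(i := Suc (a i))) * D (a(i := Suc (a i))) (x - y)))) (at y)"
    by (simp add: mi_abs_Suc sum_distrib_left algebra_simps sum_negf)
qed

lemma deriv_family_shift:
  assumes "deriv_family D" shows "deriv_family (\<lambda>a. D (\<lambda>i. a i + b i))"
  unfolding deriv_family_def
proof (intro allI)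
  fix a x
  have "(\<lambda>j. a j + b j)(i := Suc (a i + b i)) = (\<lambda>j. (a(i := Suc (a i))) j + b j)" for i by auto
  then show "(D (\<lambda>i. a i + b i) has_derivative (\<lambda>h. \<Sum>i\<in>UNIV. h $ i * D (\<lambda>j. (a(i := Suc (a i))) j + b j) x)) (at x)"
    using deriv_familyD[OF assms, of "\<lambda>i. a i + b i" x] by simp
qed

lemma abs_sum_components_le:
  fixes h :: "real^'n::finite"
  assumes "\<And>i. \<bar>c i\<bar> \<le> B"
  shows "\<bar>\<Sum>i\<in>UNIV. h $ i * c i\<bar> \<le> real CARD('n) * B * norm h"
proof -
  have "\<bar>\<Sum>i\<in>UNIV. h $ i * c i\<bar> \<le> (\<Sum>i\<in>UNIV. \<bar>h $ i * c i\<bar>)" by (rule sum_abs)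
  also have "\<dots> \<le> (\<Sum>i\<in>(UNIV::'n set). norm h * B)"
    unfolding abs_mult by (intro sum_mono mult_mono component_le_norm_cart assms) auto
  finally show ?thesis by (simp add: mult_ac)
qed

definition compact_support :: "(('n::finite \<Rightarrow> nat) \<Rightarrow> real^'n \<Rightarrow> real) \<Rightarrow> bool" where
  "compact_support D \<longleftrightarrow> (\<exists>r. \<forall>a x. norm x > r \<longrightarrow> D a x = 0)"

lemma compact_support_bounded:
  assumes "deriv_family D" "compact_support D"
  shows "\<exists>B\<ge>0. \<forall>x. \<bar>D a x\<bar> \<le> B"
proof -
  obtain r where r: "\<And>x. norm x > r \<Longrightarrow> D a x = 0" using assms(2) by (auto simp: compact_support_def)
  have "compact (D a ` cball 0 r)"
    by (intro compact_continuous_image deriv_family_continuous assms) simp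
  then obtain B where "\<forall>x\<in>cball 0 r. \<bar>D a x\<bar> \<le> B"
    by (auto dest!: compact_imp_bounded simp: bounded_iff simp del: mem_cball_0)
  then have "\<bar>D a x\<bar> \<le> max 0 B" for x
    using r[of x] by (cases "norm x \<le> r") (auto simp: max.coboundedI2)
  then show ?thesis by (intro exI[of _ "max 0 B"]) auto
qed

lemma compact_support_bounded_first:
  assumes "deriv_family (D :: ('n::finite \<Rightarrow> nat) \<Rightarrow> _)" "compact_support D"
  shows "\<exists>B\<ge>0. \<forall>i x. \<bar>D (a(i := Suc (a i))) x\<bar> \<le> B"
proof -
  have "\<forall>i. \<exists>B\<ge>0. \<forall>x. \<bar>D (a(i := Suc (a i))) x\<bar> \<le> B"
    using compact_support_bounded[OF assms] by blast
  then obtain B where B: "\<And>i. B i \<ge> 0" "\<And>i x. \<bar>D (a(i := Suc (a i))) x\<bar> \<le> B i" by metis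
  have "\<bar>D (a(i := Suc (a i))) x\<bar> \<le> (\<Sum>i\<in>UNIV. B i)" for i x
    using member_le_sum[of i UNIV B] B(1) B(2)[of i x] by force
  then show ?thesis using B by (intro exI[of _ "\<Sum>i\<in>UNIV. B i"]) (auto simp: sum_nonneg)
qed

lemma deriv_family_lipschitz:
  assumes D: "deriv_family D" "compact_support D"
  shows "\<exists>B\<ge>0. \<forall>x y. \<bar>D a x - D a y\<bar> \<le> B * norm (x - y)"
proof -
  obtain B where B: "B \<ge> 0" "\<And>i x. \<bar>D (a(i := Suc (a i))) x\<bar> \<le> B"
    using compact_support_bounded_first[OF D] by blast
  have "norm (D a x - D a y) \<le> real CARD('a) * B * norm (x - y)" for x y
  proof (rule differentiable_bound[OF convex_UNIV])
    show "(D a has_derivative (\<lambda>h. \<Sum>i\<in>UNIV. h $ i * D (a(i := Suc (a i))) x)) (at x within UNIV)" for x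
      using deriv_familyD[OF D(1)] .
    show "onorm (\<lambda>h. \<Sum>i\<in>UNIV. h $ i * D (a(i := Suc (a i))) x) \<le> real CARD('a) * B" for x
      using B abs_sum_components_le[OF B(2)] by (intro onorm_bound) auto
  qed auto
  then show ?thesis using B by (intro exI[of _ "real CARD('a) * B"]) auto
qed

text \<open>The bound is uniform in \<open>x\<close>, so it can be integrated against any finite
  mass; this is what allows differentiation under the integral in
  \<open>deriv_family_conv\<close>.\<close>

lemma deriv_family_taylor:
  assumes D: "deriv_family D" "compact_support D"
  shows "\<exists>B\<ge>0. \<forall>x h. \<bar>D a (x + h) - D a x - (\<Sum>i\<in>UNIV. h $ i * D (a(i := Suc (a i))) x)\<bar> \<le> B * (norm h)\<^sup>2"
proof -
  have "\<forall>i. \<exists>B\<ge>0. \<forall>x y. \<bar>D (a(i := Suc (a i))) x - D (a(i := Suc (a i))) y\<bar> \<le> B * norm (x - y)"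
    using deriv_family_lipschitz[OF D] by blast
  then obtain B' where B': "\<And>i. B' i \<ge> 0"
    "\<And>i x y. \<bar>D (a(i := Suc (a i))) x - D (a(i := Suc (a i))) y\<bar> \<le> B' i * norm (x - y)" by metis
  define B where "B = (\<Sum>i\<in>UNIV. B' i)"
  have B0: "B \<ge> 0" using B' by (simp add: B_def sum_nonneg)
  have B: "\<bar>D (a(i := Suc (a i))) x - D (a(i := Suc (a i))) y\<bar> \<le> B * norm (x - y)" for i x y
    by (rule order_trans[OF B'(2)]) (auto simp: B_def B' intro!: mult_right_mono member_le_sum)
  have "\<bar>D a (x + h) - D a x - (\<Sum>i\<in>UNIV. h $ i * D (a(i := Suc (a i))) x)\<bar> \<le> real CARD('a) * B * (norm h)\<^sup>2" for x h
  proof -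
    \<comment> \<open>The linear part is subtracted with coefficients frozen at \<open>x\<close>.
      The derivative of \<open>g\<close> is then a difference of first derivatives of
      \<open>D a\<close>, which the Lipschitz bound makes of order \<open>norm h\<close> on the ball
      around \<open>x\<close>.\<close>
    define g where "g = (\<lambda>y. D a y - (\<Sum>i\<in>UNIV. y $ i * D (a(i := Suc (a i))) x))"
    let ?g' = "\<lambda>y h. \<Sum>i\<in>UNIV. h $ i * (D (a(i := Suc (a i))) y - D (a(i := Suc (a i))) x)"
    have "norm (g (x + h) - g x) \<le> (real CARD('a) * (B * norm h)) * norm (x + h - x)"
    proof (rule differentiable_bound[OF convex_cball[of x "norm h"]])
      fix y assume y: "y \<in> cball x (norm h)"
      have "(g has_derivative (\<lambda>h. (\<Sum>i\<in>UNIV. h $ i * D (a(i := Suc (a i))) y) - (\<Sum>i\<in>UNIV. h $ i * D (a(i := Suc (a i))) x))) (at y)"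
        unfolding g_def
        by (intro has_derivative_diff deriv_familyD D(1) has_derivative_sum has_derivative_mult_left
            bounded_linear_imp_has_derivative bounded_linear_vec_nth)
      moreover have "(\<lambda>h. (\<Sum>i\<in>UNIV. h $ i * D (a(i := Suc (a i))) y) - (\<Sum>i\<in>UNIV. h $ i * D (a(i := Suc (a i))) x)) = ?g' y"
        by (simp only: right_diff_distrib sum_subtractf)
      ultimately have "(g has_derivative ?g' y) (at y)" by (simp only:)
      then show "(g has_derivative ?g' y) (at y within cball x (norm h))"
        by (rule has_derivative_at_withinI)
      have "\<bar>D (a(i := Suc (a i))) y - D (a(i := Suc (a i))) x\<bar> \<le> B * norm h" for i
        by (rule order_trans[OF B mult_left_mono[OF _ B0]]) (use y in \<open>simp add: dist_norm norm_minus_commute\<close>)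
      from abs_sum_components_le[OF this]
      show "onorm (?g' y) \<le> real CARD('a) * (B * norm h)"
        using B0 by (intro onorm_bound) auto
    qed (auto simp: dist_norm)
    then show ?thesis
      by (simp add: g_def power2_eq_square algebra_simps sum.distrib)
  qed
  then show ?thesis using B0 by (intro exI[of _ "real CARD('a) * B"]) auto
qed

subsection \<open>Convolutions\<close>

text \<open>One definition serves two convolutions: with a finite measure (\<open>w\<close>
  constantly 1) and with a Lebesgue density (\<open>M\<close> is \<open>lborel\<close> and
  \<open>w\<close> the density).\<close>

definition conv :: "(real^'n::finite) measure \<Rightarrow> (real^'n \<Rightarrow> real) \<Rightarrow> (('n \<Rightarrow> nat) \<Rightarrow> real^'n \<Rightarrow> real)
    \<Rightarrow> ('n \<Rightarrow> nat) \<Rightarrow> real^'n \<Rightarrow> real" where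
  "conv M w D a x = (\<integral>y. w y * D a (x - y) \<partial>M)"

lemma integrable_mult_bounded:
  fixes w f :: "'a \<Rightarrow> real"
  assumes "integrable M w" "f \<in> borel_measurable M" "\<And>x. \<bar>f x\<bar> \<le> B"
  shows "integrable M (\<lambda>x. w x * f x)"
proof (rule Bochner_Integration.integrable_bound[of M "\<lambda>x. B * w x"])
  show "AE x in M. norm (w x * f x) \<le> norm (B * w x)"
  proof (rule AE_I2)
    fix x
    have "\<bar>f x\<bar> \<le> \<bar>B\<bar>" using assms(3)[of x] by linarith
    then show "norm (w x * f x) \<le> norm (B * w x)"
      by (simp add: abs_mult mult.commute mult_right_mono)
  qed
qed (use assms in auto)

lemma integrable_conv_integrand:
  assumes D: "deriv_family D" "compact_support D" and M: "sets M = sets borel" "integrable M w"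
  shows "integrable M (\<lambda>y. w y * D a (x - y))"
proof -
  have [measurable_cong]: "sets M = sets borel" by fact
  have [measurable]: "D a \<in> borel_measurable borel" by (rule deriv_family_borel[OF D(1)])
  obtain B where "\<And>x. \<bar>D a x\<bar> \<le> B" using compact_support_bounded[OF D] by blast
  then show ?thesis using M(2) by (intro integrable_mult_bounded[of _ _ _ B]) auto
qed

text \<open>Linearity turns the increment of the convolution minus its candidate differential into
  the convolution of \<open>w\<close> with the Taylor remainder, which is at most a constant times
  \<open>norm h\<close> squared.\<close>

lemma deriv_family_conv:
  assumes D: "deriv_family D" "compact_support D" and M: "sets M = sets borel" "integrable M w"
  shows "deriv_family (conv M w D)"
  unfolding deriv_family_def
proof (intro allI)
  fix a x
  note int = integrable_conv_integrand[OF D M]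
  let ?D' = "\<lambda>h. \<Sum>i\<in>UNIV. h $ i * conv M w D (a(i := Suc (a i))) x"
  obtain B where B: "B \<ge> 0"
    "\<And>x h. \<bar>D a (x + h) - D a x - (\<Sum>i\<in>UNIV. h $ i * D (a(i := Suc (a i))) x)\<bar> \<le> B * (norm h)\<^sup>2"
    using deriv_family_taylor[OF D] by blast
  define I where "I = (\<integral>y. \<bar>w y\<bar> \<partial>M)"
  have bl: "bounded_linear ?D'"
    by (intro bounded_linear_sum bounded_linear_mult_const bounded_linear_vec_nth)
  have rem: "\<bar>conv M w D a (x + h) - conv M w D a x - ?D' h\<bar> \<le> B * I * (norm h)\<^sup>2" for h
  proof -
    let ?r = "\<lambda>y. D a (x - y + h) - D a (x - y) - (\<Sum>i\<in>UNIV. h $ i * D (a(i := Suc (a i))) (x - y))"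
    have r_eq: "w y * D a (x + h - y) - w y * D a (x - y) - (\<Sum>i\<in>UNIV. h $ i * (w y * D (a(i := Suc (a i))) (x - y))) = w y * ?r y" for y
      by (simp add: right_diff_distrib sum_distrib_left mult.left_commute diff_add_eq)
    have "?D' h = (\<integral>y. (\<Sum>i\<in>UNIV. h $ i * (w y * D (a(i := Suc (a i))) (x - y))) \<partial>M)"
      unfolding conv_def by (subst Bochner_Integration.integral_sum) (use int in auto)
    then have "conv M w D a (x + h) - conv M w D a x - ?D' h =
       (\<integral>y. w y * D a (x + h - y) - w y * D a (x - y) - (\<Sum>i\<in>UNIV. h $ i * (w y * D (a(i := Suc (a i))) (x - y))) \<partial>M)"
      unfolding conv_def using int by (simp add: Bochner_Integration.integral_diff)
    also have "\<dots> = (\<integral>y. w y * ?r y \<partial>M)" by (simp add: r_eq)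
    finally have eq: "conv M w D a (x + h) - conv M w D a x - ?D' h = (\<integral>y. w y * ?r y \<partial>M)" .
    have "\<bar>\<integral>y. w y * ?r y \<partial>M\<bar> \<le> (\<integral>y. B * (norm h)\<^sup>2 * \<bar>w y\<bar> \<partial>M)"
    proof (rule integral_abs_bound_integral)
      have "integrable M (\<lambda>y. w y * D a (x + h - y) - w y * D a (x - y) - (\<Sum>i\<in>UNIV. h $ i * (w y * D (a(i := Suc (a i))) (x - y))))"
        using int by (intro Bochner_Integration.integrable_diff Bochner_Integration.integrable_sum integrable_mult_right)
      then show "integrable M (\<lambda>y. w y * ?r y)" by (simp add: r_eq)
      show "\<bar>w y * ?r y\<bar> \<le> B * (norm h)\<^sup>2 * \<bar>w y\<bar>" for y
        unfolding abs_mult using mult_left_mono[OF B(2)[of "x - y" h], of "\<bar>w y\<bar>"] by (simp add: mult.commute)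
    qed (use M in simp)
    also have "\<dots> = B * I * (norm h)\<^sup>2" by (simp add: I_def)
    finally show ?thesis unfolding eq by simp
  qed
  show "(conv M w D a has_derivative ?D') (at x)"
    unfolding has_derivative_at
  proof (intro conjI bl)
    show "(\<lambda>h. norm (conv M w D a (x + h) - conv M w D a x - ?D' h) / norm h) \<midarrow>0\<rightarrow> 0"
    proof (rule Lim_null_comparison)
      show "((\<lambda>h. B * I * norm h) \<longlongrightarrow> 0) (at 0)"
        by (auto intro!: tendsto_eq_intros)
      show "\<forall>\<^sub>F h in at 0. norm (norm (conv M w D a (x + h) - conv M w D a x - ?D' h) / norm h) \<le> B * I * norm h"
      proof (rule always_eventually, intro allI)
        fix h
        show "norm (norm (conv M w D a (x + h) - conv M w D a x - ?D' h) / norm h) \<le> B * I * norm h"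
          using rem[of h] by (cases "h = 0") (auto simp: divide_le_eq power2_eq_square mult.assoc)
      qed
    qed
  qed
qed

subsection \<open>Integration by parts\<close>

lemma pdir_line:
  assumes "f differentiable at (x + t *\<^sub>R axis i 1)"
  shows "((\<lambda>t. f (x + t *\<^sub>R axis i 1)) has_real_derivative pdir i f (x + t *\<^sub>R axis i 1)) (at t)"
proof -
  let ?D = "frechet_derivative f (at (x + t *\<^sub>R axis i 1))"
  have D: "(f has_derivative ?D) (at (x + t *\<^sub>R axis i 1))"
    using assms by (simp add: frechet_derivative_works)
  have "((\<lambda>t. x + t *\<^sub>R axis i 1) has_derivative (\<lambda>s. s *\<^sub>R axis i 1)) (at t)"
    by (auto intro!: derivative_eq_intros)
  from has_derivative_compose[OF this D]
  have "((\<lambda>t. f (x + t *\<^sub>R axis i 1)) has_derivative (\<lambda>s. ?D (s *\<^sub>R axis i 1))) (at t)" .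
  moreover have "?D (s *\<^sub>R axis i 1) = pdir i f (x + t *\<^sub>R axis i 1) * s" for s
    using linear_frechet_derivative[OF assms] by (simp add: linear_scale pdir_def mult.commute)
  ultimately show ?thesis by (simp add: has_field_derivative_def)
qed

lemma pdir_vanishes:
  assumes "closed K" "\<And>x. x \<notin> K \<Longrightarrow> f x = 0" "x \<notin> K"
  shows "pdir i f x = 0"
proof -
  have "((\<lambda>_. 0) has_derivative (\<lambda>_. 0)) (at x)" by simp
  then have "(f has_derivative (\<lambda>_. 0)) (at x)"
    by (rule has_derivative_transform_within_open[of _ _ _ _ "-K"]) (use assms in auto)
  from frechet_derivative_at[OF this] show ?thesis by (simp add: pdir_def fun_eq_iff)
qed

lemma continuous_compact_support_integrable:
  fixes f :: "'a::euclidean_space \<Rightarrow> real"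
  assumes "continuous_on UNIV f" "compact K" "\<And>x. x \<notin> K \<Longrightarrow> f x = 0"
  shows "integrable lborel f" "\<exists>B\<ge>0. \<forall>x. \<bar>f x\<bar> \<le> B"
proof -
  have "integrable lborel (\<lambda>x. indicator K x *\<^sub>R f x)"
    using assms by (intro borel_integrable_compact) (auto intro: continuous_on_subset)
  moreover have "(\<lambda>x. indicator K x *\<^sub>R f x) = f"
    using assms(3) by (auto simp: indicator_def fun_eq_iff)
  ultimately show "integrable lborel f" by simp
  have "compact (f ` K)" using assms by (intro compact_continuous_image) (auto intro: continuous_on_subset)
  then obtain B where B: "\<forall>x\<in>K. \<bar>f x\<bar> \<le> B"
    by (auto dest!: compact_imp_bounded simp: bounded_iff)
  have "\<bar>f x\<bar> \<le> max 0 B" for x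
    using B assms(3)[of x] by (cases "x \<in> K") (auto simp: max.coboundedI2)
  then show "\<exists>B\<ge>0. \<forall>x. \<bar>f x\<bar> \<le> B" by (intro exI[of _ "max 0 B"]) auto
qed

text \<open>Translation invariance makes the integral of every difference quotient zero. The mean
  value theorem dominates the quotients, so the limit can be taken under the integral.\<close>

lemma integral_pdir_eq_0:
  fixes F :: "real^'n::finite \<Rightarrow> real"
  assumes diff: "\<And>x. F differentiable at x" and cont: "continuous_on UNIV (pdir i F)"
    and K: "compact K" "\<And>x. x \<notin> K \<Longrightarrow> F x = 0"
  shows "(LINT x|lborel. pdir i F x) = 0"
proof -
  have contF: "continuous_on UNIV F"
    by (intro continuous_at_imp_continuous_on ballI differentiable_imp_continuous_within diff)
  have intF: "integrable lborel F"
    by (rule continuous_compact_support_integrable[OF contF K])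
  have [measurable]: "F \<in> borel_measurable borel" "pdir i F \<in> borel_measurable borel"
    by (auto intro!: borel_measurable_continuous_onI contF cont)
  have van: "\<And>x. x \<notin> K \<Longrightarrow> pdir i F x = 0"
    using K compact_imp_closed by (intro pdir_vanishes) auto
  obtain B where B: "B \<ge> 0" "\<And>x. \<bar>pdir i F x\<bar> \<le> B"
    using continuous_compact_support_integrable(2)[OF cont K(1) van] by blast
  obtain r where r: "\<And>x. x \<in> K \<Longrightarrow> norm x \<le> r"
    using compact_imp_bounded[OF K(1)] by (auto simp: bounded_iff)
  define t where "t = (\<lambda>n. inverse (real (Suc n)))"
  have t: "0 < t n" "t n \<le> 1" for n by (auto simp: t_def field_simps)
  define q where "q = (\<lambda>n x. (F (x + t n *\<^sub>R axis i 1) - F x) / t n)"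
  have int_q: "(LINT x|lborel. q n x) = 0" for n
  proof -
    have tr: "integrable lborel (\<lambda>x. F (x + t n *\<^sub>R axis i 1)) \<and> (LINT x|lborel. F (x + t n *\<^sub>R axis i 1)) = (LINT x|lborel. F x)"
    proof
      have *: "distr lborel borel ((+) (t n *\<^sub>R axis i 1)) = (lborel :: (real^'n) measure)"
        by (rule lborel_distr_plus)
      have "integrable (distr lborel borel ((+) (t n *\<^sub>R axis i 1))) F" using intF unfolding * .
      then show "integrable lborel (\<lambda>x. F (x + t n *\<^sub>R axis i 1))"
        by (subst (asm) integrable_distr_eq) (auto simp: add.commute)
      have "(LINT x|distr lborel borel ((+) (t n *\<^sub>R axis i 1)). F x) = (LINT x|lborel. F (t n *\<^sub>R axis i 1 + x))"
        by (rule integral_distr) auto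
      then show "(LINT x|lborel. F (x + t n *\<^sub>R axis i 1)) = (LINT x|lborel. F x)"
        unfolding * by (simp add: add.commute)
    qed
    then have "(LINT x|lborel. F (x + t n *\<^sub>R axis i 1) - F x) = 0"
      using intF by simp
    then show ?thesis by (simp add: q_def)
  qed
  have "(\<lambda>n. LINT x|lborel. q n x) \<longlonglongrightarrow> (LINT x|lborel. pdir i F x)"
  proof (rule integral_dominated_convergence[where w="\<lambda>x. B * indicator (cball 0 (r + 1)) x"])
    \<comment> \<open>The ball is larger by 1 than one containing \<open>K\<close>, since the shifts
      \<open>t n\<close> are at most 1.\<close>
    show "integrable lborel (\<lambda>x::real^'n. B * indicator (cball 0 (r + 1)) x)"
      using emeasure_compact_finite[of "cball 0 (r + 1) :: (real^'n) set"]
      by (intro integrable_mult_right integrable_real_indicator) auto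
    show "AE x in lborel. (\<lambda>n. q n x) \<longlonglongrightarrow> pdir i F x"
    proof (rule AE_I2)
      fix x
      have "((\<lambda>s. F (x + s *\<^sub>R axis i 1)) has_real_derivative pdir i F (x + 0 *\<^sub>R axis i 1)) (at 0)"
        by (rule pdir_line) (rule diff)
      then have lim: "((\<lambda>h. (F (x + h *\<^sub>R axis i 1) - F x) / h) \<longlongrightarrow> pdir i F x) (at 0)"
        by (simp add: DERIV_def)
      have "filterlim t (at 0) sequentially"
        unfolding filterlim_at using LIMSEQ_inverse_real_of_nat t by (auto simp: t_def)
      from filterlim_compose[OF lim this] show "(\<lambda>n. q n x) \<longlonglongrightarrow> pdir i F x"
        by (simp add: q_def)
    qed
    show "AE x in lborel. norm (q n x) \<le> B * indicator (cball 0 (r + 1)) x" for n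
    proof (rule AE_I2)
      fix x
      show "norm (q n x) \<le> B * indicator (cball 0 (r + 1)) x"
      proof (cases "norm x \<le> r + 1")
        case True
        obtain z where "F (x + t n *\<^sub>R axis i 1) - F (x + 0 *\<^sub>R axis i 1) = (t n - 0) * pdir i F (x + z *\<^sub>R axis i 1)"
          using MVT2[of 0 "t n" "\<lambda>s. F (x + s *\<^sub>R axis i 1)" "\<lambda>s. pdir i F (x + s *\<^sub>R axis i 1)"]
            t[of n] pdir_line diff by blast
        then have "q n x = pdir i F (x + z *\<^sub>R axis i 1)" using t[of n] by (simp add: q_def)
        with B True show ?thesis by simp
      next
        case False
        have "norm x \<le> norm (x + t n *\<^sub>R axis i 1) + norm (t n *\<^sub>R axis i (1::real))"
          by (metis add_diff_cancel_right' norm_triangle_ineq4)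
        then have "norm (x + t n *\<^sub>R axis i 1) > r" using False t[of n] by (simp add: norm_axis_1)
        then have "F (x + t n *\<^sub>R axis i 1) = 0" "F x = 0"
          using r[of x] r[of "x + t n *\<^sub>R axis i 1"] K(2) False by force+
        then show ?thesis using B by (simp add: q_def)
      qed
    qed
  qed (auto simp: q_def)
  then show ?thesis using int_q by (simp add: LIMSEQ_const_iff)
qed

lemma pdir_mult:
  assumes "f differentiable at x" "g differentiable at x"
  shows "pdir i (\<lambda>x. f x * g x) x = f x * pdir i g x + pdir i f x * g x"
proof -
  have "((\<lambda>x. f x * g x) has_derivative (\<lambda>h. f x * frechet_derivative g (at x) h + frechet_derivative f (at x) h * g x)) (at x)"
    using assms by (intro has_derivative_mult) (simp_all add: frechet_derivative_works)
  from frechet_derivative_at[OF this, symmetric] show ?thesis by (simp add: pdir_def)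
qed

lemma integration_by_parts_pdir:
  fixes f g :: "real^'n::finite \<Rightarrow> real"
  assumes f: "\<And>x. f differentiable at x" "continuous_on UNIV (pdir i f)"
    and g: "\<And>x. g differentiable at x" "continuous_on UNIV (pdir i g)"
    and K: "compact K" "\<And>x. x \<notin> K \<Longrightarrow> g x = 0"
  shows "(LINT x|lborel. f x * pdir i g x) = - (LINT x|lborel. pdir i f x * g x)"
proof -
  have cont: "continuous_on UNIV f" "continuous_on UNIV g"
    using f g by (auto intro!: continuous_at_imp_continuous_on differentiable_imp_continuous_within)
  have van: "\<And>x. x \<notin> K \<Longrightarrow> pdir i g x = 0"
    using K compact_imp_closed by (intro pdir_vanishes) auto
  have int: "integrable lborel (\<lambda>x. f x * pdir i g x)" "integrable lborel (\<lambda>x. pdir i f x * g x)"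
    by (rule continuous_compact_support_integrable[OF _ K(1)]; use cont f g K van in \<open>auto intro!: continuous_intros\<close>)+
  have eq: "pdir i (\<lambda>x. f x * g x) = (\<lambda>x. f x * pdir i g x + pdir i f x * g x)"
    using pdir_mult f g by blast
  have "(LINT x|lborel. pdir i (\<lambda>x. f x * g x) x) = 0"
  proof (rule integral_pdir_eq_0[OF _ _ K(1)])
    show "(\<lambda>x. f x * g x) differentiable at x" for x using f g by simp
    show "continuous_on UNIV (pdir i (\<lambda>x. f x * g x))"
      unfolding eq by (intro continuous_intros cont f g)
  qed (simp add: K)
  then show ?thesis using int by (simp add: eq)
qed

lemma dlist_vanishes:
  assumes "closed K" "\<And>x. x \<notin> K \<Longrightarrow> \<phi> x = 0" "x \<notin> K"
  shows "dlist xs \<phi> x = 0"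
  using assms(3)
proof (induction xs arbitrary: x)
  case (Cons i xs)
  then show ?case using pdir_vanishes[OF assms(1)] by simp
qed (use assms in simp)

lemma smooth_dlist_continuous: "smooth \<phi> \<Longrightarrow> continuous_on UNIV (dlist xs \<phi>)"
  by (auto simp: smooth_def intro!: continuous_at_imp_continuous_on differentiable_imp_continuous_within)

lemma outside_support: "x \<notin> closure {x. \<phi> x \<noteq> 0} \<Longrightarrow> \<phi> x = (0::real)"
  using closure_subset[of "{x. \<phi> x \<noteq> 0}"] by auto

text \<open>Induction along the list of directions: each partial derivative taken off \<phi> raises
  one index of the family, so the function on the left is again a member of
  \<open>U\<close>.\<close>

lemma deriv_family_integration_by_parts:
  assumes U: "deriv_family U" and \<phi>: "test_function \<phi>"
  shows "(LINT x|lborel. U a x * dmi \<alpha> \<phi> x) = (-1) ^ mi_abs \<alpha> * (LINT x|lborel. U (\<lambda>i. a i + \<alpha> i) x * \<phi> x)"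
proof -
  have \<phi>': "smooth \<phi>" "compact (closure {x. \<phi> x \<noteq> 0})" using \<phi> by (auto simp: test_function_def)
  have "(LINT x|lborel. U a x * dlist xs \<phi> x) = (-1) ^ length xs * (LINT x|lborel. U (\<lambda>i. a i + count_list xs i) x * \<phi> x)" for xs
  proof (induction xs arbitrary: a)
    case (Cons i xs)
    have "(LINT x|lborel. U a x * dlist (i # xs) \<phi> x) = - (LINT x|lborel. pdir i (U a) x * dlist xs \<phi> x)"
      unfolding dlist.simps
    proof (rule integration_by_parts_pdir[OF _ _ _ _ \<phi>'(2)])
      show "U a differentiable at x" for x using deriv_familyD[OF U] by (auto simp: differentiable_def)
      show "continuous_on UNIV (pdir i (U a))"
        unfolding pdir_deriv_family[OF U] by (rule deriv_family_continuous[OF U])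
      show "dlist xs \<phi> differentiable at x" for x using \<phi>' by (simp add: smooth_def)
      show "continuous_on UNIV (pdir i (dlist xs \<phi>))"
        using smooth_dlist_continuous[OF \<phi>'(1), of "i # xs"] by simp
      show "x \<notin> closure {x. \<phi> x \<noteq> 0} \<Longrightarrow> dlist xs \<phi> x = 0" for x
        using outside_support by (intro dlist_vanishes[of "closure {x. \<phi> x \<noteq> 0}"]) auto
    qed
    also have "\<dots> = - ((-1) ^ length xs * (LINT x|lborel. U (\<lambda>j. (a(i := Suc (a i))) j + count_list xs j) x * \<phi> x))"
      unfolding pdir_deriv_family[OF U] Cons.IH ..
    also have "(\<lambda>j. (a(i := Suc (a i))) j + count_list xs j) = (\<lambda>j. a j + count_list (i # xs) j)"
      by auto
    finally show ?case by simp
  qed simp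
  moreover have "length (mi_list \<alpha>) = mi_abs \<alpha>"
    using sum_count_set[of "mi_list \<alpha>" UNIV] by (simp add: mi_abs_def)
  ultimately show ?thesis by (simp add: dmi_def)
qed

subsection \<open>Tensor products and dyadic scales\<close>

definition tensor :: "('n::finite \<Rightarrow> nat \<Rightarrow> real \<Rightarrow> real) \<Rightarrow> ('n \<Rightarrow> nat) \<Rightarrow> real^'n \<Rightarrow> real" where
  "tensor F a x = (\<Prod>i\<in>UNIV. F i (a i) (x $ i))"

text \<open>The sizes of the derivatives of a bump \<open>2^n f(2^n x)\<close>. The bound stops at
  order \<open>J\<close> so that one constant \<open>A\<close> can serve all the orders and all
  scales.\<close>

definition dyadic_chain :: "nat \<Rightarrow> nat \<Rightarrow> real \<Rightarrow> (nat \<Rightarrow> real \<Rightarrow> real) \<Rightarrow> bool" where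
  "dyadic_chain n J A f \<longleftrightarrow>
     (\<forall>j x. (f j has_real_derivative f (Suc j) x) (at x)) \<and>
     (\<forall>j x. \<bar>x\<bar> > 1 / 2 ^ n \<longrightarrow> f j x = 0) \<and>
     (\<forall>j\<le>J. \<forall>x. \<bar>f j x\<bar> \<le> A * 2 ^ (n * (1 + j)))"

text \<open>A cube, since it is the support of a tensor product. Its volume
  \<open>2^d 2^(-nd)\<close> cancels the height \<open>2^(nd)\<close> of a kernel at the same scale,
  which is the source of every factor \<open>2 ^ CARD('n)\<close> below.\<close>

definition dyadic_box :: "nat \<Rightarrow> (real^'n::finite) set" where
  "dyadic_box n = cbox (\<chi> i. - (1 / 2 ^ n)) (\<chi> i. 1 / 2 ^ n)"

definition dyadic_family :: "nat \<Rightarrow> nat \<Rightarrow> real \<Rightarrow> (('n::finite \<Rightarrow> nat) \<Rightarrow> real^'n \<Rightarrow> real) \<Rightarrow> bool" where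
  "dyadic_family n J A D \<longleftrightarrow> deriv_family D \<and>
     (\<forall>a x. x \<notin> dyadic_box n \<longrightarrow> D a x = 0) \<and>
     (\<forall>a x. mi_abs a \<le> J \<longrightarrow> \<bar>D a x\<bar> \<le> A * 2 ^ (n * (CARD('n) + mi_abs a)))"

lemma mem_dyadic_box: "x \<in> dyadic_box n \<longleftrightarrow> (\<forall>i. \<bar>x $ i\<bar> \<le> 1 / 2 ^ n)"
  by (simp add: dyadic_box_def mem_box_cart abs_le_iff) (metis minus_le_iff)

lemma compact_dyadic_box: "compact (dyadic_box n)"
  by (simp add: dyadic_box_def)

lemma measure_dyadic_box: "measure lborel (dyadic_box n :: (real^'n::finite) set) = 2 ^ CARD('n) / 2 ^ (n * CARD('n))"
proof -
  have "(0 :: real^'n) \<in> dyadic_box n" by (simp add: mem_dyadic_box)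
  then have "measure lborel (dyadic_box n :: (real^'n) set) = (\<Prod>i\<in>(UNIV::'n set). 2 / 2 ^ n)"
    unfolding dyadic_box_def by (subst content_cbox_cart) auto
  then show ?thesis by (simp add: power_divide power_mult)
qed

lemma tensor_deriv_family:
  assumes "\<And>i j x. (F i j has_real_derivative F i (Suc j) x) (at x)"
  shows "deriv_family (tensor F)"
  unfolding deriv_family_def
proof (intro allI)
  fix a and x :: "real^'a"
  have "((\<lambda>x. F i (a i) (x $ i)) has_derivative (\<lambda>h. F i (Suc (a i)) (x $ i) * h $ i)) (at x)" for i
    by (rule has_derivative_compose[of "\<lambda>x. x $ i" "\<lambda>h. h $ i"])
      (use assms[of i "a i" "x $ i"] in \<open>auto simp: has_field_derivative_def
         intro!: bounded_linear_imp_has_derivative bounded_linear_vec_nth\<close>)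
  then have "((\<lambda>x. \<Prod>i\<in>UNIV. F i (a i) (x $ i)) has_derivative
     (\<lambda>h. \<Sum>i\<in>UNIV. F i (Suc (a i)) (x $ i) * h $ i * (\<Prod>j\<in>UNIV - {i}. F j (a j) (x $ j)))) (at x)"
    by (intro has_derivative_prod)
  moreover have "tensor F (a(i := Suc (a i))) x = F i (Suc (a i)) (x $ i) * (\<Prod>j\<in>UNIV - {i}. F j (a j) (x $ j))" for i
    unfolding tensor_def by (subst prod.remove[of UNIV i]) (auto intro!: prod.cong)
  ultimately show "(tensor F a has_derivative (\<lambda>h. \<Sum>i\<in>UNIV. h $ i * tensor F (a(i := Suc (a i))) x)) (at x)"
    by (simp add: tensor_def[abs_def] mult_ac)
qed

lemma tensor_dyadic_family:
  fixes F :: "'n::finite \<Rightarrow> nat \<Rightarrow> real \<Rightarrow> real"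
  assumes F: "\<And>i. dyadic_chain n J A (F i)" and A: "0 \<le> A"
  shows "dyadic_family n J (A ^ CARD('n)) (tensor F)"
  unfolding dyadic_family_def
proof (intro conjI allI impI)
  show "deriv_family (tensor F)"
    using F by (intro tensor_deriv_family) (simp add: dyadic_chain_def)
  show "tensor F a x = 0" if "x \<notin> dyadic_box n" for a x
    using that F by (auto simp: mem_dyadic_box not_le tensor_def dyadic_chain_def)
  show "\<bar>tensor F a x\<bar> \<le> A ^ CARD('n) * 2 ^ (n * (CARD('n) + mi_abs a))" if "mi_abs a \<le> J" for a x
  proof -
    have "a i \<le> J" for i
      using that member_le_sum[of i UNIV a] by (simp add: mi_abs_def)
    then have "\<bar>tensor F a x\<bar> \<le> (\<Prod>i\<in>UNIV. A * 2 ^ (n * (1 + a i)))"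
      unfolding tensor_def abs_prod using F by (intro prod_mono) (simp add: dyadic_chain_def)
    also have "\<dots> = A ^ CARD('n) * 2 ^ (n * (CARD('n) + mi_abs a))"
      by (simp add: prod.distrib mi_abs_def power_sum[symmetric] sum.distrib sum_distrib_left[symmetric] sum_Suc add.commute del: mult_Suc_right)
    finally show ?thesis .
  qed
qed

text \<open>Fubini in coordinates. Lebesgue measure is the image of a product measure indexed by
  basis vectors, so the coordinates are matched with these vectors.\<close>

lemma integral_tensor:
  fixes f :: "'n::finite \<Rightarrow> real \<Rightarrow> real"
  assumes "\<And>i. integrable lborel (f i)"
  shows "(LINT x|lborel. (\<Prod>i\<in>UNIV. f i (x $ i))) = (\<Prod>i\<in>UNIV. LINT t|lborel. f i t)"
proof -
  interpret product_sigma_finite "\<lambda>_. lborel :: real measure" ..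
  have [measurable]: "f i \<in> borel_measurable borel" for i
    using borel_measurable_integrable[OF assms[of i]] by simp
  \<comment> \<open>The inverse of \<open>i\<close> to \<open>axis i 1\<close>, which turns a
    product over coordinates into one over \<open>Basis\<close>.\<close>
  define ix :: "real^'n \<Rightarrow> 'n" where "ix b = (THE i. b = axis i 1)" for b
  have ix: "ix (axis i 1) = i" for i by (auto simp: ix_def axis_eq_axis)
  have B: "(Basis :: (real^'n) set) = (\<lambda>i. axis i 1) ` UNIV" by (auto simp: Basis_vec_def)
  have inj: "inj (\<lambda>i::'n. axis i (1::real))" by (auto simp: inj_on_def axis_eq_axis)
  have "(\<Sum>b\<in>Basis. g b *\<^sub>R b) $ i = g (axis i 1)" for g :: "real^'n \<Rightarrow> real" and i
  proof -
    have "(\<Sum>b\<in>Basis. g b *\<^sub>R b) $ i = (\<Sum>j\<in>UNIV. (g (axis j 1) *\<^sub>R axis j 1) $ i)"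
      unfolding B by (subst sum.reindex[OF inj]) (simp add: sum_component)
    also have "\<dots> = (\<Sum>j\<in>UNIV. if j = i then g (axis i 1) else 0)"
      by (rule sum.cong[OF refl]) (simp add: axis_def)
    finally show ?thesis by simp
  qed
  then have eq: "(\<Prod>i\<in>UNIV. f i ((\<Sum>b\<in>Basis. g b *\<^sub>R b) $ i)) = (\<Prod>b\<in>Basis. f (ix b) (g b))" for g
    unfolding B by (subst prod.reindex[OF inj]) (simp add: ix)
  have "(LINT x|lborel. (\<Prod>i\<in>UNIV. f i (x $ i))) =
    (LINT x|distr (\<Pi>\<^sub>M b\<in>(Basis :: (real^'n) set). lborel) borel (\<lambda>g. \<Sum>b\<in>Basis. g b *\<^sub>R b). (\<Prod>i\<in>UNIV. f i (x $ i)))"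
    by (simp only: lborel_eq[symmetric])
  also have "\<dots> = (LINT g|(\<Pi>\<^sub>M b\<in>(Basis :: (real^'n) set). lborel). (\<Prod>i\<in>UNIV. f i ((\<Sum>b\<in>Basis. g b *\<^sub>R b) $ i)))"
    by (rule integral_distr) measurable
  also have "\<dots> = (\<Prod>b\<in>(Basis :: (real^'n) set). LINT t|lborel. f (ix b) t)"
    unfolding eq by (rule product_integral_prod) (auto simp: assms)
  also have "\<dots> = (\<Prod>i\<in>UNIV. LINT t|lborel. f i t)"
    unfolding B by (subst prod.reindex[OF inj]) (simp add: ix)
  finally show ?thesis .
qed

text \<open>For the derivative chain of \<open>f\<close>, this is the chain of the rescaling
  \<open>2^n f(2^n x)\<close>, which preserves the integral.\<close>

definition dilate :: "nat \<Rightarrow> (nat \<Rightarrow> real \<Rightarrow> real) \<Rightarrow> nat \<Rightarrow> real \<Rightarrow> real" where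
  "dilate n f j x = 2 ^ (n * (1 + j)) * f j (2 ^ n * x)"

lemma dilate_dyadic_chain:
  assumes "dyadic_chain 0 J A f" shows "dyadic_chain n J A (dilate n f)"
  unfolding dyadic_chain_def
proof (intro conjI allI impI)
  fix j x
  have "(dilate n f j has_real_derivative 2 ^ (n * (1 + j)) * (f (Suc j) (2 ^ n * x) * 2 ^ n)) (at x)"
    unfolding dilate_def[abs_def] using assms
    by (intro DERIV_cmult DERIV_chain2[of "f j"]) (auto simp: dyadic_chain_def intro!: derivative_eq_intros)
  then show "(dilate n f j has_real_derivative dilate n f (Suc j) x) (at x)"
    by (simp add: dilate_def power_add mult_ac)
next
  fix j x assume "1 / 2 ^ n < \<bar>x :: real\<bar>"
  then show "dilate n f j x = 0"
    using assms by (simp add: dilate_def dyadic_chain_def abs_mult field_simps)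
next
  fix j x assume "j \<le> J"
  then show "\<bar>dilate n f j x\<bar> \<le> A * 2 ^ (n * (1 + j))"
    using assms by (simp add: dilate_def dyadic_chain_def abs_mult mult.commute)
qed

text \<open>A difference of consecutive kernels mixes two scales and is to be estimated at the
  coarser one. The support only shrinks, and up to order \<open>J\<close> the bounds lose at most
  \<open>2 ^ (1 + J)\<close>.\<close>

lemma dyadic_chain_coarser:
  assumes "dyadic_chain (Suc n) J A f" "0 \<le> A" shows "dyadic_chain n J (2 ^ (1 + J) * A) f"
  unfolding dyadic_chain_def
proof (intro conjI allI impI)
  fix j x assume "1 / 2 ^ n < \<bar>x :: real\<bar>"
  then have "1 / 2 ^ Suc n < \<bar>x\<bar>" by (rule le_less_trans[rotated]) (simp add: frac_le)
  then show "f j x = 0" using assms by (simp add: dyadic_chain_def)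
next
  fix j x assume "j \<le> J"
  then have "\<bar>f j x\<bar> \<le> A * 2 ^ (Suc n * (1 + j))" using assms by (auto simp: dyadic_chain_def)
  also have "\<dots> = 2 ^ (1 + j) * A * 2 ^ (n * (1 + j))" by (simp add: power_add[symmetric] add.commute mult.commute)
  also have "\<dots> \<le> 2 ^ (1 + J) * A * 2 ^ (n * (1 + j))"
    using assms \<open>j \<le> J\<close> by (intro mult_right_mono power_increasing) auto
  finally show "\<bar>f j x\<bar> \<le> 2 ^ (1 + J) * A * 2 ^ (n * (1 + j))" .
qed (use assms in \<open>simp add: dyadic_chain_def\<close>)

lemma dyadic_chain_mono:
  assumes "dyadic_chain n J A f" "A \<le> A'" shows "dyadic_chain n J A' f"
proof -
  have "A * 2 ^ (n * (1 + j)) \<le> A' * 2 ^ (n * (1 + j))" for j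
    using assms by (intro mult_right_mono) auto
  with assms(1) show ?thesis unfolding dyadic_chain_def by (meson order_trans)
qed

lemma dyadic_chain_diff:
  assumes "dyadic_chain n J A f" "dyadic_chain n J A g"
  shows "dyadic_chain n J (2 * A) (\<lambda>j x. f j x - g j x)"
  unfolding dyadic_chain_def
proof (intro conjI allI impI)
  fix j x
  show "((\<lambda>x. f j x - g j x) has_real_derivative f (Suc j) x - g (Suc j) x) (at x)"
    using assms by (intro DERIV_diff) (auto simp: dyadic_chain_def)
next
  fix j x assume "j \<le> J"
  then have "\<bar>f j x\<bar> \<le> A * 2 ^ (n * (1 + j))" "\<bar>g j x\<bar> \<le> A * 2 ^ (n * (1 + j))"
    using assms by (auto simp: dyadic_chain_def)
  then show "\<bar>f j x - g j x\<bar> \<le> 2 * A * 2 ^ (n * (1 + j))" by linarith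
qed (use assms in \<open>simp add: dyadic_chain_def\<close>)

lemma dyadic_chain_exists_bound:
  assumes f: "\<And>j x. (f j has_real_derivative f (Suc j) x) (at x)" "\<And>j x. \<bar>x\<bar> > 1 \<Longrightarrow> f j x = 0"
  shows "\<exists>A>0. dyadic_chain 0 J A f"
proof -
  have "\<exists>B>0. \<forall>x. \<bar>f j x\<bar> \<le> B" for j
  proof -
    have "continuous_on {-1..1} (f j)"
      using f(1) by (intro DERIV_continuous_on[of _ _ "f (Suc j)"]) (rule DERIV_subset, auto)
    then have "compact (f j ` {-1..1})" by (intro compact_continuous_image) auto
    then obtain B where "\<forall>x\<in>{-1..1}. \<bar>f j x\<bar> \<le> B"
      by (auto dest!: compact_imp_bounded simp: bounded_iff)
    then have "\<bar>f j x\<bar> \<le> max 1 B" for x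
      using f(2)[of x j] by (cases "\<bar>x\<bar> \<le> 1") (auto simp: max.coboundedI2 abs_le_iff)
    then show ?thesis by (intro exI[of _ "max 1 B"]) auto
  qed
  then obtain B where B: "\<And>j. B j > 0" "\<And>j x. \<bar>f j x\<bar> \<le> B j" by metis
  have "\<bar>f j x\<bar> \<le> (\<Sum>j\<le>J. B j)" if "j \<le> J" for j x
    using B(2)[of j x] member_le_sum[of j "{..J}" B] that B(1) by (force intro: less_imp_le)
  moreover have "(\<Sum>j\<le>J. B j) > 0" using B by (intro sum_pos) auto
  ultimately show ?thesis using f by (intro exI[of _ "\<Sum>j\<le>J. B j"]) (simp add: dyadic_chain_def)
qed

text \<open>The kernels are tensor powers. Passing to the finer scale in one coordinate after
  another writes their difference as \<open>CARD('n)\<close> tensors, each with a one-dimensional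
  dyadic difference in a single slot. That slot is an \<open>M\<close>-th derivative, so
  \<open>\<gamma> t\<close> is \<open>M\<close> in one direction and 0 in the others.\<close>

lemma dyadic_kernel_families:
  assumes "M \<ge> 1"
  shows "\<exists>A>0. \<exists>(K :: nat \<Rightarrow> ('n::finite \<Rightarrow> nat) \<Rightarrow> real^'n \<Rightarrow> real) \<Delta> \<Lambda> \<gamma>.
    (\<forall>n. dyadic_family n J A (K n)) \<and>
    (\<forall>n. (LINT x|lborel. K n (\<lambda>_. 0) x) = 1) \<and>
    (\<forall>n a x. K (Suc n) a x - K n a x = (\<Sum>t<CARD('n). \<Delta> n t a x)) \<and>
    (\<forall>n t. dyadic_family n J A (\<Delta> n t) \<and> dyadic_family n J A (\<Lambda> n t)) \<and>
    (\<forall>n t a x. \<Delta> n t a x = 1 / 2 ^ (n * M) * \<Lambda> n t (\<lambda>i. a i + \<gamma> t i) x) \<and>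
    (\<forall>t. mi_abs (\<gamma> t) = M)"
proof -
  obtain K L :: "nat \<Rightarrow> real \<Rightarrow> real" where
    K: "\<And>j x. (K j has_real_derivative K (Suc j) x) (at x)" "\<And>j x. \<bar>x\<bar> > 1 \<Longrightarrow> K j x = 0" and
    L: "\<And>j x. (L j has_real_derivative L (Suc j) x) (at x)" "\<And>j x. \<bar>x\<bar> > 1 \<Longrightarrow> L j x = 0" and
    LK: "\<And>j x. L (j + M) x = 2 ^ (j + 1) * K j (2 * x) - K j x" and
    Kint: "has_bochner_integral lborel (K 0) 1"
    using dyadic_kernel[OF assms] by metis
  obtain A1 where A1: "A1 > 0" "dyadic_chain 0 J A1 K" using dyadic_chain_exists_bound[of K] K by blast
  obtain A2 where A2: "A2 > 0" "dyadic_chain 0 J A2 L" using dyadic_chain_exists_bound[of L] L by blast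
  \<comment> \<open>Dominates the constants of all four kinds of factors: the kernel at its own
    scale, the finer kernel read at the coarser scale, their difference, and
    \<open>L\<close>.\<close>
  define A where "A = 2 * (2 ^ (1 + J) * A1) + A2"
  have "A1 \<le> 2 ^ (1 + J) * A1" using A1(1) one_le_power[of "2::real" "1 + J"] by simp
  then have A: "A > 0" "A1 \<le> A" "2 ^ (1 + J) * A1 \<le> A" "2 * (2 ^ (1 + J) * A1) \<le> A" "A2 \<le> A"
    using A1(1) A2(1) unfolding A_def by linarith+
  have k: "dyadic_chain n J A (dilate n K)" for n
    using dilate_dyadic_chain[OF A1(2)] A(2) by (rule dyadic_chain_mono)
  have k': "dyadic_chain n J (2 ^ (1 + J) * A1) (dilate (Suc n) K)" for n
    using dilate_dyadic_chain[OF A1(2)] A1(1) by (intro dyadic_chain_coarser) auto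
  have dk: "dyadic_chain n J A (\<lambda>j x. dilate (Suc n) K j x - dilate n K j x)" for n
    using dyadic_chain_diff[OF k' dyadic_chain_mono[OF dilate_dyadic_chain[OF A1(2)]]]
      \<open>A1 \<le> 2 ^ (1 + J) * A1\<close> A(4) dyadic_chain_mono by blast
  have l: "dyadic_chain n J A (dilate n L)" for n
    using dilate_dyadic_chain[OF A2(2)] A(5) by (rule dyadic_chain_mono)
  \<comment> \<open>The identity \<open>LK\<close> at \<open>2^n x\<close>: raising the order by
    \<open>M\<close> brings in the factor \<open>2^(nM)\<close>, which has to be divided out
    again.\<close>
  have dl: "dilate (Suc n) K j x - dilate n K j x = 1 / 2 ^ (n * M) * dilate n L (j + M) x" for n j x
    unfolding dilate_def LK by (simp add: power_add power_mult algebra_simps)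
  obtain \<sigma> :: "nat \<Rightarrow> 'n" where \<sigma>: "bij_betw \<sigma> {..<CARD('n)} UNIV"
    using ex_bij_betw_nat_finite[of "UNIV :: 'n set"] by (auto simp: atLeast0LessThan)
  \<comment> \<open>The mixed tensor in which the first \<open>t\<close> coordinates, in the
    enumeration \<sigma>, are already at the finer scale.\<close>
  define P where "P n t = tensor (\<lambda>i. if i \<in> \<sigma> ` {..<t} then dilate (Suc n) K else dilate n K)" for n t
  define \<Delta> where "\<Delta> n t = tensor (\<lambda>i. if i = \<sigma> t then (\<lambda>j x. dilate (Suc n) K j x - dilate n K j x)
      else if i \<in> \<sigma> ` {..<t} then dilate (Suc n) K else dilate n K)" for n t
  define \<Lambda> where "\<Lambda> n t = tensor (\<lambda>i. if i = \<sigma> t then dilate n L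
      else if i \<in> \<sigma> ` {..<t} then dilate (Suc n) K else dilate n K)" for n t
  define \<gamma> where "\<gamma> t i = (if i = \<sigma> t then M else 0)" for t i
  have split: "tensor F a x = F (\<sigma> t) (a (\<sigma> t)) (x $ \<sigma> t) * (\<Prod>i\<in>UNIV - {\<sigma> t}. F i (a i) (x $ i))" for F a x t
    unfolding tensor_def by (rule prod.remove) auto
  have tele: "P n (Suc t) a x - P n t a x = \<Delta> n t a x" if "t < CARD('n)" for n t a x
  proof -
    \<comment> \<open>Injectivity ensures that coordinate \<open>\<sigma> t\<close> has not been
      refined before step \<open>t\<close>.\<close>
    have "inj_on \<sigma> {..<CARD('n)}" using \<sigma> by (simp add: bij_betw_def)
    then have "\<sigma> t \<notin> \<sigma> ` {..<t}" using that by (subst inj_on_image_mem_iff[of _ "{..<CARD('n)}"]) auto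
    then show ?thesis
      unfolding P_def \<Delta>_def split[of _ _ _ t] by (simp add: lessThan_Suc left_diff_distrib cong: prod.cong_simp)
  qed
  have P0: "P n 0 = tensor (\<lambda>_. dilate n K)" for n by (simp add: P_def)
  have "P n CARD('n) = tensor (\<lambda>_. dilate (Suc n) K)" for n
    using bij_betw_imp_surj_on[OF \<sigma>] by (simp add: P_def)
  then have sum: "tensor (\<lambda>_. dilate (Suc n) K) a x - tensor (\<lambda>_. dilate n K) a x = (\<Sum>t<CARD('n). \<Delta> n t a x)" for n a x
    using sum_lessThan_telescope[of "\<lambda>t. P n t a x" "CARD('n)"] by (simp add: P0 tele)
  have \<Delta>\<Lambda>: "\<Delta> n t a x = 1 / 2 ^ (n * M) * \<Lambda> n t (\<lambda>i. a i + \<gamma> t i) x" for n t a x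
    unfolding \<Delta>_def \<Lambda>_def split[of _ _ _ t]
    by (simp add: dl \<gamma>_def cong: prod.cong_simp)
  have int: "(LINT x|lborel. tensor (\<lambda>_ :: 'n. dilate n K) (\<lambda>_. 0) x) = 1" for n
  proof -
    have "has_bochner_integral lborel (\<lambda>t. K 0 (0 + 2 ^ n * t)) (1 /\<^sub>R \<bar>2 ^ n\<bar>)"
      using Kint by (subst lborel_has_bochner_integral_real_affine_iff[symmetric]) auto
    then have "has_bochner_integral lborel (\<lambda>t. 2 ^ n * K 0 (0 + 2 ^ n * t)) (2 ^ n * (1 /\<^sub>R \<bar>2 ^ n\<bar>))"
      by (intro has_bochner_integral_mult_right) auto
    then have "has_bochner_integral lborel (dilate n K 0) 1"
      by (simp add: dilate_def[abs_def])
    then show ?thesis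
      unfolding tensor_def by (subst integral_tensor) (auto simp: has_bochner_integral_iff)
  qed
  have fam: "dyadic_family n J (A ^ CARD('n)) (\<Delta> n t)" "dyadic_family n J (A ^ CARD('n)) (\<Lambda> n t)"
    "dyadic_family n J (A ^ CARD('n)) (tensor (\<lambda>_ :: 'n. dilate n K))" for n t
    unfolding \<Delta>_def \<Lambda>_def using A k dyadic_chain_mono[OF k' A(3)] dk l
    by (auto intro!: tensor_dyadic_family)
  have "mi_abs (\<gamma> t) = M" for t by (simp add: mi_abs_def \<gamma>_def)
  then show ?thesis
    using A fam sum int \<Delta>\<Lambda>
    by (intro exI[of _ "A ^ CARD('n)"] conjI exI[of _ "\<lambda>n. tensor (\<lambda>_. dilate n K)"] exI[of _ \<Delta>] exI[of _ \<Lambda>] exI[of _ \<gamma>])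
      auto
qed

subsection \<open>Estimates at one scale\<close>

text \<open>Up to the absolute value this is the expression under the supremum in
  \<open>d_k\<close>; kernels will be inserted for \<phi>.\<close>

definition defect :: "'n::finite smeasure \<Rightarrow> (real^'n \<Rightarrow> real) \<Rightarrow> (real^'n \<Rightarrow> real) \<Rightarrow> real" where
  "defect \<mu> p \<phi> = sm_integral \<mu> \<phi> - (LINT x|lborel. \<phi> x * p x)"

text \<open>Homogeneity: \<open>sup_norm_k\<close> is a sum of \<open>N\<close> suprema, each at
  most \<open>b\<close>, so after division by \<open>N * b\<close> the function competes in the
  supremum defining \<open>d_k\<close>.\<close>

lemma defect_deriv_family_le:
  fixes \<Phi> :: "('n::finite \<Rightarrow> nat) \<Rightarrow> real^'n \<Rightarrow> real" and b :: real
  assumes \<Phi>: "deriv_family \<Phi>" and b: "0 < b" "\<And>a y. mi_abs a \<le> k \<Longrightarrow> \<bar>\<Phi> a y\<bar> \<le> b"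
  shows "ennreal \<bar>defect \<mu> p (\<Phi> (\<lambda>_. 0))\<bar> \<le> ennreal (real (card (multi_indices k :: ('n \<Rightarrow> nat) set)) * b) * d_k k \<mu> p"
proof -
  define N where "N = real (card (multi_indices k :: ('n \<Rightarrow> nat) set))"
  have "(\<lambda>_. 0) \<in> (multi_indices k :: ('n \<Rightarrow> nat) set)" by (simp add: multi_indices_def)
  then have N: "N > 0" unfolding N_def using finite_multi_indices by (metis card_gt_0_iff empty_iff of_nat_0_less_iff)
  define c where "c = 1 / (N * b)"
  have c: "c > 0" using N b by (simp add: c_def)
  define \<phi> where "\<phi> y = c * \<Phi> (\<lambda>_. 0) y" for y
  have fam: "deriv_family (\<lambda>a y. c * \<Phi> a y)" by (rule deriv_family_cmult[OF \<Phi>])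
  have "sup_norm_k k \<phi> \<le> (\<Sum>\<alpha>\<in>(multi_indices k :: ('n \<Rightarrow> nat) set). ennreal (c * b))"
    unfolding sup_norm_k_def
  proof (intro sum_mono SUP_least)
    fix \<alpha> :: "'n \<Rightarrow> nat" and y assume "\<alpha> \<in> multi_indices k"
    then have "\<bar>c * \<Phi> \<alpha> y\<bar> \<le> c * b"
      using b c by (simp add: abs_mult multi_indices_def)
    then show "ennreal \<bar>dmi \<alpha> \<phi> y\<bar> \<le> ennreal (c * b)"
      using dmi_deriv_family[OF fam, of \<alpha> "\<lambda>_. 0"] by (simp add: \<phi>_def[abs_def] ennreal_leI)
  qed
  also have "\<dots> = ennreal (N * (c * b))"
    using N b c by (subst ennreal_mult) (auto simp: N_def ennreal_of_nat_eq_real_of_nat)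
  also have "N * (c * b) = 1" using N b by (simp add: c_def)
  finally have "sup_norm_k k \<phi> \<le> 1" by simp
  moreover have "smooth \<phi>" using smooth_deriv_family[OF fam] by (simp add: \<phi>_def[abs_def])
  ultimately have "ennreal \<bar>defect \<mu> p \<phi>\<bar> \<le> d_k k \<mu> p"
    unfolding d_k_def defect_def by (intro SUP_upper) simp
  moreover have "defect \<mu> p \<phi> = c * defect \<mu> p (\<Phi> (\<lambda>_. 0))"
    by (simp add: defect_def sm_integral_def \<phi>_def[abs_def] mult.assoc right_diff_distrib)
  ultimately have "ennreal (N * b) * ennreal (c * \<bar>defect \<mu> p (\<Phi> (\<lambda>_. 0))\<bar>) \<le> ennreal (N * b) * d_k k \<mu> p"
    using c by (intro mult_left_mono) (auto simp: abs_mult)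
  moreover have "ennreal (N * b) * ennreal (c * \<bar>defect \<mu> p (\<Phi> (\<lambda>_. 0))\<bar>) = ennreal \<bar>defect \<mu> p (\<Phi> (\<lambda>_. 0))\<bar>"
    using N b c by (subst ennreal_mult[symmetric]) (auto simp: c_def)
  ultimately show ?thesis by (simp add: N_def)
qed

lemma dyadic_family_compact_support: "dyadic_family n J A D \<Longrightarrow> compact_support D"
proof -
  assume D: "dyadic_family n J A D"
  obtain r where "\<And>x. x \<in> dyadic_box n \<Longrightarrow> norm (x :: real^'a) \<le> r"
    using compact_imp_bounded[OF compact_dyadic_box[of n]] by (auto simp: bounded_iff)
  then have "D a x = 0" if "norm x > r" for a x
    using D that unfolding dyadic_family_def by (metis linorder_not_le)
  then show ?thesis by (auto simp: compact_support_def)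
qed

lemma dyadic_familyD: "dyadic_family n J A D \<Longrightarrow> deriv_family D"
  by (simp add: dyadic_family_def)

lemma dyadic_family_bound:
  fixes D :: "('n::finite \<Rightarrow> nat) \<Rightarrow> real^'n \<Rightarrow> real"
  shows "dyadic_family n J A D \<Longrightarrow> mi_abs a \<le> J \<Longrightarrow> \<bar>D a x\<bar> \<le> A * 2 ^ (n * (CARD('n) + mi_abs a))"
  by (simp add: dyadic_family_def)

text \<open>Height times volume of the box: the factor \<open>2^(nd)\<close> cancels, and only the
  cost of the derivatives remains.\<close>

lemma dyadic_family_integral_abs_le:
  fixes D :: "('n::finite \<Rightarrow> nat) \<Rightarrow> real^'n \<Rightarrow> real"
  assumes D: "dyadic_family n J A D" and a: "mi_abs a \<le> s" "s \<le> J" and A: "0 \<le> A"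
  shows "integrable lborel (D a)" "(LINT x|lborel. \<bar>D a x\<bar>) \<le> A * 2 ^ CARD('n) * 2 ^ (n * s)"
proof -
  have le: "\<bar>D a x\<bar> \<le> A * 2 ^ (n * (CARD('n) + s)) * indicator (dyadic_box n) x" for x
  proof (cases "x \<in> dyadic_box n")
    case True
    have "\<bar>D a x\<bar> \<le> A * 2 ^ (n * (CARD('n) + mi_abs a))" using D a by (auto simp: dyadic_family_def)
    also have "\<dots> \<le> A * 2 ^ (n * (CARD('n) + s))" using a A by (intro mult_left_mono power_increasing) auto
    finally show ?thesis using True by simp
  next
    case False then show ?thesis using D by (simp add: dyadic_family_def)
  qed
  have fin: "emeasure lborel (dyadic_box n :: (real^'n) set) < \<infinity>"
    by (rule emeasure_compact_finite[OF compact_dyadic_box])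
  have meas: "dyadic_box n \<in> sets lborel"
    by (simp add: dyadic_box_def)
  have int: "integrable lborel (\<lambda>x :: real^'n. A * 2 ^ (n * (CARD('n) + s)) * indicator (dyadic_box n) x)"
    by (intro integrable_mult_right integrable_real_indicator meas fin)
  show "integrable lborel (D a)"
    by (rule Bochner_Integration.integrable_bound[OF int])
      (use le deriv_family_borel[OF dyadic_familyD[OF D]] in \<open>auto intro!: AE_I2 order_trans[OF le]\<close>)
  have "(LINT x|lborel. \<bar>D a x\<bar>) \<le> (LINT x :: real^'n|lborel. A * 2 ^ (n * (CARD('n) + s)) * indicator (dyadic_box n) x)"
    by (rule integral_mono'[OF int le]) (use A in auto)
  also have "\<dots> = A * 2 ^ (n * (CARD('n) + s)) * measure lborel (dyadic_box n :: (real^'n) set)"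
    using meas by simp
  also have "\<dots> = A * 2 ^ CARD('n) * 2 ^ (n * s)"
    unfolding measure_dyadic_box by (simp add: power_add add_mult_distrib2)
  finally show "(LINT x|lborel. \<bar>D a x\<bar>) \<le> A * 2 ^ CARD('n) * 2 ^ (n * s)" .
qed

lemma abs_conv_le:
  assumes D: "deriv_family D" and M: "sets M = sets borel" "integrable M w" and B: "\<And>x. \<bar>D a x\<bar> \<le> B"
  shows "\<bar>conv M w D a x\<bar> \<le> B * (\<integral>y. \<bar>w y\<bar> \<partial>M)"
proof -
  have "\<bar>conv M w D a x\<bar> \<le> (\<integral>y. \<bar>w y * D a (x - y)\<bar> \<partial>M)"
    unfolding conv_def by (rule integral_abs_bound)
  also have "\<dots> \<le> (\<integral>y. B * \<bar>w y\<bar> \<partial>M)"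
  proof (rule integral_mono')
    show "\<bar>w y * D a (x - y)\<bar> \<le> B * \<bar>w y\<bar>" for y
      using mult_right_mono[OF B, of "\<bar>w y\<bar>"] by (simp add: abs_mult mult.commute)
    show "0 \<le> B * \<bar>w y\<bar>" for y
      using order_trans[OF abs_ge_zero B] by simp
  qed (use M in simp)
  finally show ?thesis by simp
qed

text \<open>The adjoint of a convolution. Stating it for sigma-finite \<open>M\<close> covers both
  parts of \<mu> and the density of \<mu>\<open>_n\<close> alike.\<close>

lemma integral_conv_swap:
  fixes T g w :: "real^'n::finite \<Rightarrow> real"
  assumes M: "sets M = sets borel" "sigma_finite_measure M" and w: "integrable M w"
    and g: "integrable lborel g" and T: "T \<in> borel_measurable borel" "\<And>x. \<bar>T x\<bar> \<le> B"
  shows "(\<integral>y. w y * (LINT x|lborel. g x * T (x - y)) \<partial>M) = (LINT x|lborel. g x * (\<integral>y. w y * T (x - y) \<partial>M))"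
proof -
  have [measurable_cong]: "sets M = sets borel" by fact
  interpret M: sigma_finite_measure M by fact
  interpret P: pair_sigma_finite "lborel :: (real^'n) measure" M by unfold_locales
  have [measurable]: "T \<in> borel_measurable borel" "g \<in> borel_measurable borel" "w \<in> borel_measurable borel"
    using T borel_measurable_integrable[OF g] borel_measurable_integrable[OF w]
    by (auto cong: measurable_cong_sets)
  have B: "0 \<le> B" using T(2)[of 0] by linarith
  have intw: "integrable M (\<lambda>y. w y * T (x - y))" for x
    using w T(2) by (intro integrable_mult_bounded) auto
  have "integrable (lborel \<Otimes>\<^sub>M M) (\<lambda>z. g (fst z) * (w (snd z) * T (fst z - snd z)))"
  proof (rule P.Fubini_integrable)
    have "integrable lborel (\<lambda>x. g x * (\<integral>y. \<bar>w y * T (x - y)\<bar> \<partial>M))"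
    proof (rule integrable_mult_bounded[OF g])
      fix x
      have "(\<integral>y. \<bar>w y * T (x - y)\<bar> \<partial>M) \<le> (\<integral>y. \<bar>w y\<bar> * B \<partial>M)"
        using w T(2) B by (intro integral_mono') (auto simp: abs_mult intro!: mult_left_mono)
      moreover have "0 \<le> (\<integral>y. \<bar>w y * T (x - y)\<bar> \<partial>M)" by simp
      ultimately show "\<bar>\<integral>y. \<bar>w y * T (x - y)\<bar> \<partial>M\<bar> \<le> (\<integral>y. \<bar>w y\<bar> * B \<partial>M)" by simp
    qed measurable
    from integrable_abs[OF this]
    show "integrable lborel (\<lambda>x. \<integral>y. norm (g (fst (x, y)) * (w (snd (x, y)) * T (fst (x, y) - snd (x, y)))) \<partial>M)"
      by (simp add: abs_mult)
  qed (use intw in \<open>auto\<close>)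
  then have "integrable (lborel \<Otimes>\<^sub>M M) (\<lambda>(x, y). g x * (w y * T (x - y)))"
    by (simp add: split_def)
  from P.Fubini_integral[OF this]
  have "(\<integral>y. (LINT x|lborel. g x * (w y * T (x - y))) \<partial>M) = (LINT x|lborel. (\<integral>y. g x * (w y * T (x - y)) \<partial>M))" .
  moreover have "(LINT x|lborel. g x * (w y * T (x - y))) = w y * (LINT x|lborel. g x * T (x - y))" for y
    by (subst mult.left_commute) (rule integral_mult_right_zero)
  ultimately show ?thesis by simp
qed

text \<open>Needed for the duality argument below: the sign of a function becomes integrable, and
  can be convolved with a kernel, only after a cut-off.\<close>

lemma nn_integral_le_on_balls:
  fixes f :: "'a::euclidean_space \<Rightarrow> ennreal"
  assumes [measurable]: "f \<in> borel_measurable lborel"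
    and le: "\<And>r::nat. (\<integral>\<^sup>+x\<in>cball 0 (real r). f x \<partial>lborel) \<le> C"
  shows "(\<integral>\<^sup>+x. f x \<partial>lborel) \<le> C"
proof -
  have [measurable]: "cball 0 r \<in> sets (borel :: 'a measure)" for r :: real by simp
  have "(\<integral>\<^sup>+x. f x \<partial>lborel) = (\<integral>\<^sup>+x. liminf (\<lambda>r::nat. f x * indicator (cball 0 (real r)) x) \<partial>lborel)"
  proof (rule nn_integral_cong)
    fix x :: 'a
    obtain r0 :: nat where "norm x \<le> real r0" using real_arch_simple by blast
    then have "eventually (\<lambda>r::nat. f x * indicator (cball 0 (real r)) x = f x) sequentially"
      unfolding eventually_sequentially by (intro exI[of _ r0]) (auto simp: indicator_def)
    then have "(\<lambda>r::nat. f x * indicator (cball 0 (real r)) x) \<longlonglongrightarrow> f x"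
      by (rule tendsto_eventually)
    then show "f x = liminf (\<lambda>r::nat. f x * indicator (cball 0 (real r)) x)"
      by (metis lim_imp_Liminf trivial_limit_sequentially)
  qed
  also have "\<dots> \<le> liminf (\<lambda>r::nat. (\<integral>\<^sup>+x\<in>cball 0 (real r). f x \<partial>lborel))"
    by (intro nn_integral_liminf) measurable
  also have "\<dots> \<le> liminf (\<lambda>r::nat. C)"
    by (intro Liminf_mono always_eventually allI le)
  finally show ?thesis by (simp add: Liminf_const)
qed

lemma finite_signed_measureD:
  assumes "finite_signed_measure \<mu>"
  shows "sets (fst \<mu>) = sets borel" "sets (snd \<mu>) = sets borel"
    "finite_measure (fst \<mu>)" "finite_measure (snd \<mu>)"
    "integrable (fst \<mu>) (\<lambda>_. 1 :: real)" "integrable (snd \<mu>) (\<lambda>_. 1 :: real)"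
    "sigma_finite_measure (fst \<mu>)" "sigma_finite_measure (snd \<mu>)"
  using assms by (auto simp: finite_signed_measure_def finite_measure.integrable_const finite_measure_def)

text \<open>The \<open>L\<^sup>\<infinity>\<close> bound is the definition of \<open>d\<^sub>k\<close>, the \<open>L\<^sup>1\<close> bound follows by duality:
  \<open>\<integral> g (\<nu> * D) = \<integral> (g * D\<^sup>~) d\<nu>\<close>, and the derivatives of \<open>g * D\<^sup>~\<close> fall on \<open>D\<close>.\<close>
lemma orlicz_norm_defect_le:
  fixes D :: "('n::finite \<Rightarrow> nat) \<Rightarrow> real^'n \<Rightarrow> real"
  assumes E: "class_E e" and \<mu>: "finite_signed_measure \<mu>" and p: "integrable lborel p"
    and D: "dyadic_family n J A D" and A: "0 < A" and \<alpha>: "mi_abs \<alpha> \<le> q" and J: "q + k \<le> J"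
  shows "orlicz_norm e (\<lambda>x. defect \<mu> p (\<lambda>y. D \<alpha> (x - y)))
    \<le> ennreal (real (card (multi_indices k :: ('n \<Rightarrow> nat) set)) * A * 2 ^ CARD('n)) *
       (ennreal (2 ^ (n * (q + k)) * beta_e e (2 ^ (n * CARD('n)))) * d_k k \<mu> p)"
proof -
  define N where "N = real (card (multi_indices k :: ('n \<Rightarrow> nat) set))"
  have "(\<lambda>_. 0) \<in> (multi_indices k :: ('n \<Rightarrow> nat) set)" by (simp add: multi_indices_def)
  then have N: "N > 0" unfolding N_def using finite_multi_indices by (metis card_gt_0_iff empty_iff of_nat_0_less_iff)
  define R :: real where "R = 2 ^ (n * CARD('n))"
  have R: "R > 0" by (simp add: R_def)
  have \<beta>: "beta_e e R > 0" using young_inv_pos[OF E R] R by (simp add: beta_e_def)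
  show ?thesis
  proof (cases "d_k k \<mu> p")
    case top
    \<comment> \<open>The prefactor is positive, so the bound is infinite; with a zero prefactor the
      product with \<open>top\<close> would be 0.\<close>
    have "ennreal (N * A * 2 ^ CARD('n)) * (ennreal (2 ^ (n * (q + k)) * beta_e e R) * top) = top"
      using N A \<beta> by (simp add: ennreal_mult_top ennreal_mult_eq_top_iff)
    then show ?thesis unfolding top N_def R_def by simp
  next
    case (real \<delta>)
    note \<mu>D = finite_signed_measureD[OF \<mu>]
    note Dd = dyadic_familyD[OF D] and Dc = dyadic_family_compact_support[OF D]
    define h where "h x = defect \<mu> p (\<lambda>y. D \<alpha> (x - y))" for x
    \<comment> \<open>The target for the \<open>L^1\<close> norm. The sup bound may exceed it by the
      factor \<open>R\<close>, as the interpolation lemma expects.\<close>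
    define A' where "A' = N * A * 2 ^ CARD('n) * 2 ^ (n * (q + k)) * \<delta>"
    have A': "0 \<le> A'" using N A real by (simp add: A'_def)
    have h_conv: "h x = conv (fst \<mu>) (\<lambda>_. 1) D \<alpha> x - conv (snd \<mu>) (\<lambda>_. 1) D \<alpha> x - conv lborel p D \<alpha> x" for x
      by (simp add: h_def defect_def sm_integral_def conv_def mult.commute)
    have [measurable]: "conv (fst \<mu>) (\<lambda>_. 1) D \<alpha> \<in> borel_measurable borel" "conv (snd \<mu>) (\<lambda>_. 1) D \<alpha> \<in> borel_measurable borel"
      "conv lborel p D \<alpha> \<in> borel_measurable borel"
      by (rule deriv_family_borel[OF deriv_family_conv[OF Dd Dc]]; use \<mu>D p in simp)+
    have hm [measurable]: "h \<in> borel_measurable borel" unfolding h_conv by measurable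
    have sup: "\<bar>h x\<bar> \<le> A' * R" for x
    proof -
      \<comment> \<open>The reflected kernel as a test function of \<open>y\<close>. It already
        carries \<open>\<alpha>\<close>, so up to \<open>q + k\<close> derivatives fall on
        \<open>D\<close>.\<close>
      define \<Phi> where "\<Phi> a y = (-1) ^ mi_abs a * D (\<lambda>i. a i + \<alpha> i) (x - y)" for a y
      have "deriv_family \<Phi>" unfolding \<Phi>_def
        by (rule deriv_family_reflect[OF deriv_family_shift[OF Dd]])
      moreover have "\<bar>\<Phi> a y\<bar> \<le> A * (R * 2 ^ (n * (q + k)))" if "mi_abs a \<le> k" for a y
      proof -
        have "\<bar>D (\<lambda>i. a i + \<alpha> i) (x - y)\<bar> \<le> A * 2 ^ (n * (CARD('n) + (mi_abs a + mi_abs \<alpha>)))"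
          using dyadic_family_bound[OF D, of "\<lambda>i. a i + \<alpha> i" "x - y"] that \<alpha> J by (simp add: mi_abs_add)
        also have "\<dots> \<le> A * 2 ^ (n * (CARD('n) + (q + k)))"
          using that \<alpha> A by (intro mult_left_mono power_increasing) auto
        finally show ?thesis by (simp add: \<Phi>_def abs_mult R_def power_add add_mult_distrib2 mult.assoc)
      qed
      ultimately have "ennreal \<bar>defect \<mu> p (\<Phi> (\<lambda>_. 0))\<bar> \<le> ennreal (N * (A * (R * 2 ^ (n * (q + k))))) * d_k k \<mu> p"
        unfolding N_def using A R by (intro defect_deriv_family_le) auto
      then have "ennreal \<bar>h x\<bar> \<le> ennreal (N * (A * (R * 2 ^ (n * (q + k)))) * \<delta>)"
        using real N A R by (simp add: \<Phi>_def[abs_def] h_def ennreal_mult)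
      then have "\<bar>h x\<bar> \<le> 1 * (N * (A * (R * 2 ^ (n * (q + k)))) * \<delta>)"
        using real N A R by (subst (asm) ennreal_le_iff) auto
      \<comment> \<open>A factor \<open>2 ^ CARD('n)\<close> is given away, so that the same
        \<open>A'\<close> serves the sup and the \<open>L^1\<close> bound.\<close>
      also have "\<dots> \<le> 2 ^ CARD('n) * (N * (A * (R * 2 ^ (n * (q + k)))) * \<delta>)"
        using real N A R by (intro mult_right_mono) auto
      finally show ?thesis by (simp add: A'_def mult_ac)
    qed
    have L1: "(\<integral>\<^sup>+x. ennreal \<bar>h x\<bar> \<partial>lborel) \<le> ennreal A'"
    proof (rule nn_integral_le_on_balls)
      fix r :: nat
      \<comment> \<open>The dual function: its pairing with \<open>h\<close> is the integral of
        \<open>\<bar>h\<bar>\<close> over the ball.\<close>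
      define g where "g x = sgn (h x) * indicator (cball 0 (real r)) x" for x
      have [measurable]: "cball 0 (real r) \<in> sets (borel :: (real^'n) measure)" by simp
      have ball: "integrable lborel (\<lambda>x::real^'n. indicator (cball 0 (real r)) x :: real)"
        using emeasure_compact_finite[of "cball 0 (real r) :: (real^'n) set"]
        by (intro integrable_real_indicator) auto
      have g: "integrable lborel g"
      proof (rule Bochner_Integration.integrable_bound[OF ball])
        show "AE x in lborel. norm (g x) \<le> norm (indicator (cball 0 (real r)) x :: real)"
          by (intro AE_I2) (simp add: g_def abs_mult abs_sgn_eq)
      qed (unfold g_def, measurable)
      have g1: "\<bar>g x\<bar> \<le> 1" for x by (auto simp: g_def abs_mult indicator_def abs_sgn_eq)
      \<comment> \<open>The kernel reflected at the origin, \<open>D \<alpha> (- z)\<close> at order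
        0; the sign makes its derivatives a \<open>deriv_family\<close> again.\<close>
      define D' where "D' a z = (-1) ^ mi_abs a * D (\<lambda>i. a i + \<alpha> i) (0 - z)" for a z
      have D': "deriv_family D'" unfolding D'_def
        by (rule deriv_family_reflect[OF deriv_family_shift[OF Dd]])
      have D'c: "compact_support D'"
        using Dc unfolding compact_support_def D'_def
        by (elim exE) (rule_tac x=r in exI, simp)
      define \<Phi> where "\<Phi> = conv lborel g D'"
      have \<Phi>: "deriv_family \<Phi>" unfolding \<Phi>_def by (rule deriv_family_conv[OF D' D'c _ g]) simp
      have "\<bar>\<Phi> a y\<bar> \<le> A * 2 ^ CARD('n) * 2 ^ (n * (q + k))" if "mi_abs a \<le> k" for a y
      proof -
        have le: "mi_abs (\<lambda>i. a i + \<alpha> i) \<le> q + k" using that \<alpha> by (simp add: mi_abs_add)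
        note I = dyadic_family_integral_abs_le[OF D le J, OF less_imp_le[OF A]]
        have "\<bar>\<Phi> a y\<bar> \<le> (LINT x|lborel. \<bar>g x * D' a (y - x)\<bar>)"
          unfolding \<Phi>_def conv_def by (rule integral_abs_bound)
        also have "\<dots> \<le> (LINT x|lborel. \<bar>D (\<lambda>i. a i + \<alpha> i) (x - y)\<bar>)"
        proof (rule integral_mono')
          show "integrable lborel (\<lambda>x. \<bar>D (\<lambda>i. a i + \<alpha> i) (x - y)\<bar>)"
            by (intro integrable_abs integrable_lborel_translate I(1))
          show "\<bar>g x * D' a (y - x)\<bar> \<le> \<bar>D (\<lambda>i. a i + \<alpha> i) (x - y)\<bar>" for x
            using mult_right_mono[OF g1, of "\<bar>D (\<lambda>i. a i + \<alpha> i) (x - y)\<bar>" x] by (simp add: D'_def abs_mult)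
        qed simp
        also have "\<dots> = (LINT x|lborel. \<bar>D (\<lambda>i. a i + \<alpha> i) x\<bar>)"
          using deriv_family_borel[OF Dd] by (intro integral_lborel_translate) measurable
        also note I(2)
        finally show ?thesis .
      qed
      then have "ennreal \<bar>defect \<mu> p (\<Phi> (\<lambda>_. 0))\<bar> \<le> ennreal (N * (A * 2 ^ CARD('n) * 2 ^ (n * (q + k)))) * d_k k \<mu> p"
        unfolding N_def by (intro defect_deriv_family_le[OF \<Phi>]) (use A in auto)
      also have "\<dots> = ennreal A'"
        using real N A by (simp add: A'_def ennreal_mult[symmetric] mult_ac)
      finally have le: "ennreal \<bar>defect \<mu> p (\<Phi> (\<lambda>_. 0))\<bar> \<le> ennreal A'" .
      have \<Phi>0: "\<Phi> (\<lambda>_. 0) y = (LINT x|lborel. g x * D \<alpha> (x - y))" for y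
        by (simp add: \<Phi>_def conv_def D'_def)
      obtain B where B: "\<And>x. \<bar>D \<alpha> x\<bar> \<le> B" using compact_support_bounded[OF Dd Dc] by blast
      have swap: "(\<integral>y. w y * \<Phi> (\<lambda>_. 0) y \<partial>M) = (LINT x|lborel. g x * conv M w D \<alpha> x)"
        if "sets M = sets borel" "sigma_finite_measure M" "integrable M w" for M w
        unfolding \<Phi>0 conv_def using that g B by (intro integral_conv_swap deriv_family_borel Dd)
      have gint: "integrable lborel (\<lambda>x. g x * conv M w D \<alpha> x)"
        if "sets M = sets borel" "integrable M w" for M w
        using g deriv_family_borel[OF deriv_family_conv[OF Dd Dc that]] abs_conv_le[OF Dd that B]
        by (intro integrable_mult_bounded) auto
      have "defect \<mu> p (\<Phi> (\<lambda>_. 0)) = (LINT x|lborel. g x * h x)"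
        unfolding defect_def sm_integral_def h_conv right_diff_distrib
        using swap[OF \<mu>D(1,7,5)] swap[OF \<mu>D(2,8,6)] swap[OF _ sigma_finite_lborel p]
          gint[OF \<mu>D(1,5)] gint[OF \<mu>D(2,6)] gint[OF _ p]
        by (simp add: mult.commute)
      also have "(\<lambda>x. g x * h x) = (\<lambda>x. \<bar>h x\<bar> * indicator (cball 0 (real r)) x)"
        by (auto simp: g_def abs_sgn mult.commute)
      finally have eq: "defect \<mu> p (\<Phi> (\<lambda>_. 0)) = (LINT x|lborel. \<bar>h x\<bar> * indicator (cball 0 (real r)) x)" .
      have "(\<integral>\<^sup>+x\<in>cball 0 (real r). ennreal \<bar>h x\<bar> \<partial>lborel) = (\<integral>\<^sup>+x. ennreal (\<bar>h x\<bar> * indicator (cball 0 (real r)) x) \<partial>lborel)"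
        by (simp add: nn_integral_set_ennreal)
      also have "\<dots> = ennreal (LINT x|lborel. \<bar>h x\<bar> * indicator (cball 0 (real r)) x)"
      proof (rule nn_integral_eq_integral)
        have "integrable lborel (\<lambda>x. indicator (cball 0 (real r)) x * \<bar>h x\<bar>)"
          using ball sup by (intro integrable_mult_bounded) auto
        then show "integrable lborel (\<lambda>x. \<bar>h x\<bar> * indicator (cball 0 (real r)) x)"
          by (simp add: mult.commute)
      qed simp
      also have "\<dots> \<le> ennreal \<bar>defect \<mu> p (\<Phi> (\<lambda>_. 0))\<bar>" unfolding eq by (intro ennreal_leI) simp
      also note le
      finally show "(\<integral>\<^sup>+x\<in>cball 0 (real r). ennreal \<bar>h x\<bar> \<partial>lborel) \<le> ennreal A'" .
    qed simp
    have "orlicz_norm e h \<le> ennreal (A' * beta_e e R)"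
      by (rule orlicz_norm_interpolation[OF E _ A' R sup L1]) simp
    also have "A' * beta_e e R = N * A * 2 ^ CARD('n) * (2 ^ (n * (q + k)) * beta_e e R * \<delta>)"
      by (simp add: A'_def mult_ac)
    also have "ennreal \<dots> = ennreal (N * A * 2 ^ CARD('n)) * (ennreal (2 ^ (n * (q + k)) * beta_e e R) * ennreal \<delta>)"
      using N A \<beta> real by (simp add: ennreal_mult)
    finally show ?thesis unfolding h_def[abs_def] real N_def R_def .
  qed
qed

text \<open>The kernel centred at \<open>x\<close> is a test function, so the definition of the weak
  derivative moves \<open>\<alpha>\<close> from \<open>L\<close> to \<open>p\<close>. What remains
  is an undifferentiated kernel of height \<open>A * 2^(nd)\<close> on the box, that is, at most
  \<open>A * 2 ^ CARD('n)\<close> times a box average of \<open>\<bar>g\<bar>\<close>.\<close>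

lemma orlicz_norm_conv_weak_deriv_le:
  fixes L :: "('n::finite \<Rightarrow> nat) \<Rightarrow> real^'n \<Rightarrow> real"
  assumes E: "class_E e" and p: "integrable lborel p" and g: "weak_deriv \<alpha> p g"
    and L: "dyadic_family n J A L" and A: "0 < A"
  shows "orlicz_norm e (\<lambda>x. LINT y|lborel. L \<alpha> (x - y) * p y) \<le> ennreal (A * 2 ^ CARD('n)) * orlicz_norm e g"
proof -
  note Ld = dyadic_familyD[OF L] and Lc = dyadic_family_compact_support[OF L]
  have [measurable]: "conv lborel p L \<alpha> \<in> borel_measurable borel"
    by (rule deriv_family_borel[OF deriv_family_conv[OF Ld Lc]]) (use p in auto)
  have g': "locally_integrable g" and [measurable]: "g \<in> borel_measurable borel"
    using g by (auto simp: weak_deriv_def locally_integrable_def)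
  have [measurable]: "L a \<in> borel_measurable borel" for a by (rule deriv_family_borel[OF Ld])
  have meas: "0 < measure lborel (dyadic_box n :: (real^'n) set)" by (simp add: measure_dyadic_box)
  have conv: "(LINT y|lborel. L \<alpha> (x - y) * p y) = conv lborel p L \<alpha> x" for x
    by (simp add: conv_def mult.commute)
  have le: "\<bar>conv lborel p L \<alpha> x\<bar> \<le> A * 2 ^ CARD('n) / measure lborel (dyadic_box n :: (real^'n) set) * (LINT z:dyadic_box n|lborel. \<bar>g (x - z)\<bar>)" for x
  proof -
    define \<Phi> where "\<Phi> a y = (-1) ^ mi_abs a * L a (x - y)" for a y
    have \<Phi>: "deriv_family \<Phi>" unfolding \<Phi>_def by (rule deriv_family_reflect[OF Ld])
    have "{y. \<Phi> (\<lambda>_. 0) y \<noteq> 0} \<subseteq> (\<lambda>z. x - z) ` dyadic_box n"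
    proof
      fix y assume "y \<in> {y. \<Phi> (\<lambda>_. 0) y \<noteq> 0}"
      then have "x - y \<in> dyadic_box n" using L by (auto simp: \<Phi>_def dyadic_family_def)
      then show "y \<in> (\<lambda>z. x - z) ` dyadic_box n" by (intro image_eqI[of _ _ "x - y"]) auto
    qed
    moreover have "compact ((\<lambda>z. x - z) ` (dyadic_box n :: (real^'n) set))"
      by (intro compact_continuous_image continuous_intros compact_dyadic_box)
    ultimately have "compact (closure {y. \<Phi> (\<lambda>_. 0) y \<noteq> 0})"
      by (meson bounded_subset compact_closure compact_imp_bounded)
    then have "test_function (\<Phi> (\<lambda>_. 0))"
      using smooth_deriv_family[OF \<Phi>] by (simp add: test_function_def)
    with g have "(LINT y|lborel. p y * dmi \<alpha> (\<Phi> (\<lambda>_. 0)) y) = (-1) ^ mi_abs \<alpha> * (LINT y|lborel. g y * \<Phi> (\<lambda>_. 0) y)"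
      by (simp add: weak_deriv_def)
    moreover have "(\<lambda>y. p y * dmi \<alpha> (\<Phi> (\<lambda>_. 0)) y) = (\<lambda>y. (-1) ^ mi_abs \<alpha> * (p y * L \<alpha> (x - y)))"
      by (simp add: dmi_deriv_family[OF \<Phi>] \<Phi>_def mult.left_commute)
    moreover have "\<Phi> (\<lambda>_. 0) = (\<lambda>y. L (\<lambda>_. 0) (x - y))" by (simp add: \<Phi>_def fun_eq_iff)
    \<comment> \<open>One sign stems from the reflection of \<open>L\<close>, the other from the
      weak derivative; they cancel.\<close>
    ultimately have "(-1) ^ mi_abs \<alpha> * conv lborel p L \<alpha> x = (-1) ^ mi_abs \<alpha> * (LINT y|lborel. g y * L (\<lambda>_. 0) (x - y))"
      by (simp only: conv_def integral_mult_right_zero)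
    then have "conv lborel p L \<alpha> x = (LINT y|lborel. g y * L (\<lambda>_. 0) (x - y))" by simp
    also have "\<dots> = (LINT z|lborel. g (x - z) * L (\<lambda>_. 0) z)"
      by (subst integral_lborel_reflect[of _ x, symmetric]) auto
    finally have "\<bar>conv lborel p L \<alpha> x\<bar> \<le> (LINT z|lborel. \<bar>g (x - z) * L (\<lambda>_. 0) z\<bar>)"
      by (simp add: integral_abs_bound)
    also have "\<dots> \<le> (LINT z|lborel. A * 2 ^ (n * CARD('n)) * (indicator (dyadic_box n) z *\<^sub>R \<bar>g (x - z)\<bar>))"
    proof (rule integral_mono')
      show "integrable lborel (\<lambda>z. A * 2 ^ (n * CARD('n)) * (indicator (dyadic_box n) z *\<^sub>R \<bar>g (x - z)\<bar>))"
        using locally_integrable_reflect[OF g' compact_dyadic_box[of n], of x]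
        by (intro integrable_mult_right) (simp add: set_integrable_def)
      show "\<bar>g (x - z) * L (\<lambda>_. 0) z\<bar> \<le> A * 2 ^ (n * CARD('n)) * (indicator (dyadic_box n) z *\<^sub>R \<bar>g (x - z)\<bar>)" for z
      proof (cases "z \<in> dyadic_box n")
        case True
        have "\<bar>L (\<lambda>_. 0) z\<bar> \<le> A * 2 ^ (n * CARD('n))"
          using dyadic_family_bound[OF L, of "\<lambda>_. 0" z] by simp
        from mult_right_mono[OF this, of "\<bar>g (x - z)\<bar>"] True show ?thesis by (simp add: abs_mult mult.commute)
      next
        case False then show ?thesis using L by (simp add: dyadic_family_def)
      qed
    qed (use A in simp)
    also have "\<dots> = A * 2 ^ (n * CARD('n)) * (LINT z:dyadic_box n|lborel. \<bar>g (x - z)\<bar>)"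
      by (simp add: set_lebesgue_integral_def)
    also have "A * 2 ^ (n * CARD('n)) = A * 2 ^ CARD('n) / measure lborel (dyadic_box n :: (real^'n) set)"
      by (simp add: measure_dyadic_box)
    finally show ?thesis .
  qed
  show ?thesis unfolding conv
    by (rule orlicz_norm_box_average[OF E g' _ compact_dyadic_box meas _ le]) (use A in auto)
qed

text \<open>For the zero exponent the monomial is 1, so the weighted norm is an infimum of plain
  Orlicz norms. It is \<open>top\<close> when no weak derivative exists, and then there is nothing
  to prove.\<close>

lemma weighted_deriv_norm_0_geI:
  assumes "0 < B" "\<And>g. weak_deriv \<alpha> f g \<Longrightarrow> y \<le> ennreal B * orlicz_norm e g"
  shows "y \<le> ennreal B * weighted_deriv_norm e (\<lambda>_. 0) \<alpha> f"
proof (rule ennreal_le_by_approximation[OF assms(1)])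
  fix c assume c: "0 < c" "weighted_deriv_norm e (\<lambda>_. 0) \<alpha> f < ennreal c"
  then obtain g where g: "weak_deriv \<alpha> f g" "orlicz_norm e g < ennreal c"
    by (auto simp: weighted_deriv_norm_def Inf_less_iff monom_def)
  then have "y \<le> ennreal B * ennreal c"
    using assms(2) by (meson less_imp_le mult_left_mono order_trans zero_le)
  then show "y \<le> ennreal (B * c)" using c assms(1) by (simp add: ennreal_mult)
qed

lemma weighted_deriv_norm_le_sobolev:
  assumes "mi_abs \<alpha> \<le> k"
  shows "weighted_deriv_norm e (\<lambda>_. 0) \<alpha> f \<le> sobolev_weighted_norm k l e f"
proof -
  have "weighted_deriv_norm e (\<lambda>_. 0) \<alpha> f \<le> (\<Sum>\<alpha>\<in>multi_indices k. weighted_deriv_norm e (\<lambda>_. 0) \<alpha> f)"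
    by (rule member_le_sum) (use assms finite_multi_indices in \<open>auto simp: multi_indices_def\<close>)
  also have "\<dots> \<le> sobolev_weighted_norm k l e f"
    unfolding sobolev_weighted_norm_def
    by (rule member_le_sum[of "\<lambda>_. 0" _ "\<lambda>\<gamma>. \<Sum>\<alpha>\<in>multi_indices k. weighted_deriv_norm e \<gamma> \<alpha> f"])
      (use finite_multi_indices in \<open>auto simp: multi_indices_def\<close>)
  finally show ?thesis .
qed

subsection \<open>Mollification of a signed measure\<close>

definition smconv :: "'n::finite smeasure \<Rightarrow> (('n \<Rightarrow> nat) \<Rightarrow> real^'n \<Rightarrow> real) \<Rightarrow> ('n \<Rightarrow> nat) \<Rightarrow> real^'n \<Rightarrow> real" where
  "smconv \<mu> D a x = sm_integral \<mu> (\<lambda>y. D a (x - y))"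

lemma deriv_family_diff:
  assumes "deriv_family D" "deriv_family D'"
  shows "deriv_family (\<lambda>a x. D a x - D' a x)"
  unfolding deriv_family_def
proof (intro allI)
  fix a x
  show "((\<lambda>x. D a x - D' a x) has_derivative (\<lambda>h. \<Sum>i\<in>UNIV. h $ i * (D (a(i := Suc (a i))) x - D' (a(i := Suc (a i))) x))) (at x)"
    using has_derivative_diff[OF deriv_familyD[OF assms(1), of a x] deriv_familyD[OF assms(2), of a x]]
    by (simp only: right_diff_distrib sum_subtractf)
qed

lemma smconv_conv: "smconv \<mu> D a x = conv (fst \<mu>) (\<lambda>_. 1) D a x - conv (snd \<mu>) (\<lambda>_. 1) D a x"
  by (simp add: smconv_def sm_integral_def conv_def)

lemma deriv_family_smconv:
  assumes \<mu>: "finite_signed_measure \<mu>" and D: "dyadic_family n J A D"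
  shows "deriv_family (smconv \<mu> D)"
proof -
  note D' = dyadic_familyD[OF D] dyadic_family_compact_support[OF D]
  have "deriv_family (\<lambda>a x. conv (fst \<mu>) (\<lambda>_. 1) D a x - conv (snd \<mu>) (\<lambda>_. 1) D a x)"
    by (rule deriv_family_diff; rule deriv_family_conv[OF D']; use finite_signed_measureD[OF \<mu>] in simp)
  then show ?thesis by (simp add: smconv_conv[abs_def])
qed

text \<open>Splits \<mu> into its defect from \<open>p\<close> and \<open>p\<close> itself. With
  \<open>c\<close> and \<open>\<gamma>\<close> as parameters it covers the differences, where
  \<open>c\<close> is the gain and \<open>\<gamma>\<close> has order \<open>2m\<close>, as well as
  the initial kernel, where \<open>D = L\<close>, \<open>c = 1\<close> and \<open>\<gamma>\<close>
  is zero.\<close>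

lemma orlicz_norm_smconv_le:
  fixes D L :: "('n::finite \<Rightarrow> nat) \<Rightarrow> real^'n \<Rightarrow> real"
  assumes E: "class_E e" and \<mu>: "finite_signed_measure \<mu>" and p: "integrable lborel p"
    and D: "dyadic_family n J A D" and L: "dyadic_family n J A L" and A: "0 < A"
    and DL: "\<And>a x. D a x = c * L (\<lambda>i. a i + \<gamma> i) x" and c: "0 < c"
    and \<alpha>: "mi_abs \<alpha> \<le> q" and \<gamma>: "mi_abs \<gamma> \<le> s" and J: "q + k \<le> J"
    and B: "B = real (card (multi_indices k :: ('n \<Rightarrow> nat) set)) * A * 2 ^ CARD('n)"
  shows "orlicz_norm e (smconv \<mu> D \<alpha>) \<le> ennreal B *
      (ennreal (2 ^ (n * (q + k)) * beta_e e (2 ^ (n * CARD('n)))) * d_k k \<mu> p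
       + ennreal c * sobolev_weighted_norm (s + q) l e p)"
proof -
  let ?\<alpha>' = "\<lambda>i. \<alpha> i + \<gamma> i"
  have "(\<lambda>_. 0) \<in> (multi_indices k :: ('n \<Rightarrow> nat) set)" by (simp add: multi_indices_def)
  then have "card (multi_indices k :: ('n \<Rightarrow> nat) set) \<noteq> 0"
    using finite_multi_indices by (metis card_eq_0_iff empty_iff)
  \<comment> \<open>There is at least one multi-index, so the constant of the defect estimate also
    covers that of the weak derivative estimate.\<close>
  then have B': "A * 2 ^ CARD('n) \<le> B" unfolding B using A by (simp add: mult_ac)
  have "smconv \<mu> D \<alpha> = (\<lambda>x. defect \<mu> p (\<lambda>y. D \<alpha> (x - y)) + c * (LINT y|lborel. L ?\<alpha>' (x - y) * p y))"
    by (simp add: fun_eq_iff smconv_def defect_def DL mult.assoc)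
  then have "orlicz_norm e (smconv \<mu> D \<alpha>) \<le> orlicz_norm e (\<lambda>x. defect \<mu> p (\<lambda>y. D \<alpha> (x - y)))
      + orlicz_norm e (\<lambda>x. c * (LINT y|lborel. L ?\<alpha>' (x - y) * p y))"
    by (simp only: orlicz_norm_add[OF E])
  also have "\<dots> \<le> ennreal B * (ennreal (2 ^ (n * (q + k)) * beta_e e (2 ^ (n * CARD('n)))) * d_k k \<mu> p)
      + ennreal c * (ennreal B * sobolev_weighted_norm (s + q) l e p)"
  proof (rule add_mono)
    show "orlicz_norm e (\<lambda>x. defect \<mu> p (\<lambda>y. D \<alpha> (x - y)))
      \<le> ennreal B * (ennreal (2 ^ (n * (q + k)) * beta_e e (2 ^ (n * CARD('n)))) * d_k k \<mu> p)"
      unfolding B by (rule orlicz_norm_defect_le[OF E \<mu> p D A \<alpha> J])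
    have "orlicz_norm e (\<lambda>x. LINT y|lborel. L ?\<alpha>' (x - y) * p y)
        \<le> ennreal (A * 2 ^ CARD('n)) * weighted_deriv_norm e (\<lambda>_. 0) ?\<alpha>' p"
      using A by (intro weighted_deriv_norm_0_geI orlicz_norm_conv_weak_deriv_le[OF E p _ L A]) auto
    also have "\<dots> \<le> ennreal B * sobolev_weighted_norm (s + q) l e p"
      using B' \<alpha> \<gamma> by (intro mult_mono ennreal_leI weighted_deriv_norm_le_sobolev) (auto simp: mi_abs_add)
    finally show "orlicz_norm e (\<lambda>x. c * (LINT y|lborel. L ?\<alpha>' (x - y) * p y))
        \<le> ennreal c * (ennreal B * sobolev_weighted_norm (s + q) l e p)"
      by (intro order_trans[OF orlicz_norm_cmult[OF E c]] mult_left_mono) auto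
  qed
  finally show ?thesis by (simp add: distrib_left mult.left_commute)
qed

section \<open>The telescoping series of mollifications and its limit\<close>

definition telescoped :: "(nat \<Rightarrow> 'a \<Rightarrow> real) \<Rightarrow> nat \<Rightarrow> 'a \<Rightarrow> real" where
  "telescoped U n x = (case n of 0 \<Rightarrow> U 0 x | Suc n \<Rightarrow> U (Suc n) x - U n x)"

lemma sum_telescoped: "(\<Sum>n<Suc N. telescoped U n x) = U N x"
  by (induction N) (auto simp: telescoped_def)

text \<open>The constants do not depend on the approximating sequence, so the bound by
  \<open>pi_qkme\<close> passes to the infimum. In \<open>1 + CARD('n)\<close>, the 1 pays for the
  initial term and \<open>CARD('n)\<close> for the one-coordinate differences at each scale.\<close>

lemma suminf_orlicz_telescoped_le:
  fixes K :: "nat \<Rightarrow> ('n::finite \<Rightarrow> nat) \<Rightarrow> real^'n \<Rightarrow> real"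
  assumes E: "class_E e" and \<mu>: "finite_signed_measure \<mu>" and A: "0 < A"
    and K: "\<And>n. dyadic_family n J A (K n)"
    and \<Delta>: "\<And>n t. dyadic_family n J A (\<Delta> n t)" and \<Lambda>: "\<And>n t. dyadic_family n J A (\<Lambda> n t)"
    and sum: "\<And>n a x. K (Suc n) a x - K n a x = (\<Sum>t<CARD('n). \<Delta> n t a x)"
    and \<Delta>\<Lambda>: "\<And>n t a x. \<Delta> n t a x = 1 / 2 ^ (n * (2 * m)) * \<Lambda> n t (\<lambda>i. a i + \<gamma> t i) x"
    and \<gamma>: "\<And>t. mi_abs (\<gamma> t) = 2 * m" and \<alpha>: "mi_abs \<alpha> \<le> q" and J: "q + k \<le> J"
    and B: "B = real (card (multi_indices k :: ('n \<Rightarrow> nat) set)) * A * 2 ^ CARD('n)"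
  shows "(\<Sum>n. orlicz_norm e (telescoped (\<lambda>n. smconv \<mu> (K n) \<alpha>) n)) \<le> ennreal (B * (1 + real CARD('n))) * rho_qkme q k m e \<mu>"
proof (rule ennreal_le_by_approximation)
  have "(\<lambda>_. 0) \<in> (multi_indices k :: ('n \<Rightarrow> nat) set)" by (simp add: multi_indices_def)
  then have "card (multi_indices k :: ('n \<Rightarrow> nat) set) > 0"
    using finite_multi_indices by (metis card_gt_0_iff empty_iff)
  then have B': "B > 0" unfolding B using A by simp
  then show pos: "B * (1 + real CARD('n)) > 0" by (simp add: add_pos_nonneg)
  fix c assume c: "0 < c" "rho_qkme q k m e \<mu> < ennreal c"
  then obtain p where p: "\<And>n. integrable lborel (p n)" "pi_qkme q k m e \<mu> p < ennreal c"
    by (auto simp: rho_qkme_def INF_less_iff)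
  define a where "a n = ennreal (2 ^ (n * (q + k)) * beta_e e (2 ^ (n * CARD('n)))) * d_k k \<mu> (p n)" for n
  define b where "b n = ennreal (1 / 2 ^ (n * (2 * m))) * sobolev_weighted_norm (2 * m + q) (2 * m) e (p n)" for n
  have pi: "pi_qkme q k m e \<mu> p = (\<Sum>n. a n + b n)"
    unfolding pi_qkme_def a_def b_def mult.commute[of 2] mult.assoc by (intro suminf_add) auto
  \<comment> \<open>The kernel at scale 0 is no difference and gains nothing; \<open>c = 1\<close>
    is the value of \<open>1 / 2 ^ (n * (2 * m))\<close> at \<open>n = 0\<close>.\<close>
  have first: "orlicz_norm e (telescoped (\<lambda>n. smconv \<mu> (K n) \<alpha>) 0) \<le> ennreal B * (a 0 + b 0)"
    using orlicz_norm_smconv_le[OF E \<mu> p(1)[of 0] K[of 0] K[of 0] A, of 1 "\<lambda>_. 0" \<alpha> q "2 * m" k B "2 * m"] \<alpha> J B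
    by (simp add: telescoped_def[abs_def] a_def b_def)
  \<comment> \<open>Index shift: the term \<open>Suc n\<close> leads from scale \<open>n\<close> to
    scale \<open>n + 1\<close> and is charged to \<open>p n\<close>, not to
    \<open>p (Suc n)\<close>.\<close>
  have Suc: "orlicz_norm e (telescoped (\<lambda>n. smconv \<mu> (K n) \<alpha>) (Suc n)) \<le> ennreal (B * real CARD('n)) * (a n + b n)" for n
  proof -
    note \<mu>D = finite_signed_measureD[OF \<mu>]
    have int: "integrable (fst \<mu>) (\<lambda>y. F \<alpha> (x - y))" "integrable (snd \<mu>) (\<lambda>y. F \<alpha> (x - y))"
      if "dyadic_family i J A F" for F x i
      using integrable_conv_integrand[OF dyadic_familyD[OF that] dyadic_family_compact_support[OF that] \<mu>D(1,5), of \<alpha> x]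
        integrable_conv_integrand[OF dyadic_familyD[OF that] dyadic_family_compact_support[OF that] \<mu>D(2,6), of \<alpha> x]
      by auto
    have "telescoped (\<lambda>n. smconv \<mu> (K n) \<alpha>) (Suc n) x = (\<Sum>t<CARD('n). smconv \<mu> (\<Delta> n t) \<alpha> x)" for x
    proof -
      have "telescoped (\<lambda>n. smconv \<mu> (K n) \<alpha>) (Suc n) x = sm_integral \<mu> (\<lambda>y. K (Suc n) \<alpha> (x - y) - K n \<alpha> (x - y))"
        by (simp add: telescoped_def smconv_def sm_integral_def int[OF K])
      also have "\<dots> = (\<Sum>t<CARD('n). smconv \<mu> (\<Delta> n t) \<alpha> x)"
        unfolding sum by (simp add: smconv_def sm_integral_def int[OF \<Delta>] sum_subtractf)
      finally show ?thesis .
    qed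
    then have "orlicz_norm e (telescoped (\<lambda>n. smconv \<mu> (K n) \<alpha>) (Suc n)) = orlicz_norm e (\<lambda>x. \<Sum>t<CARD('n). smconv \<mu> (\<Delta> n t) \<alpha> x)"
      by presburger
    also have "\<dots> \<le> (\<Sum>t<CARD('n). orlicz_norm e (smconv \<mu> (\<Delta> n t) \<alpha>))"
      by (rule orlicz_norm_sum[OF E]) simp
    also have "\<dots> \<le> (\<Sum>t<CARD('n). ennreal B * (a n + b n))"
    proof (rule sum_mono)
      fix t
      show "orlicz_norm e (smconv \<mu> (\<Delta> n t) \<alpha>) \<le> ennreal B * (a n + b n)"
        unfolding a_def b_def
        using orlicz_norm_smconv_le[OF E \<mu> p(1)[of n] \<Delta>[of n t] \<Lambda>[of n t] A \<Delta>\<Lambda> _ \<alpha> _ J B, of "2 * m" "2 * m"] \<gamma>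
        by (simp add: add.commute)
    qed
    also have "\<dots> = ennreal (B * real CARD('n)) * (a n + b n)"
      using B' by (simp add: ennreal_mult ennreal_of_nat_eq_real_of_nat mult_ac)
    finally show ?thesis .
  qed
  have "(\<lambda>n. orlicz_norm e (telescoped (\<lambda>n. smconv \<mu> (K n) \<alpha>) n)) sums
    ((\<Sum>n. orlicz_norm e (telescoped (\<lambda>n. smconv \<mu> (K n) \<alpha>) (Suc n))) + orlicz_norm e (telescoped (\<lambda>n. smconv \<mu> (K n) \<alpha>) 0))"
    by (rule sums_Suc) (rule summable_sums, simp)
  then have "(\<Sum>n. orlicz_norm e (telescoped (\<lambda>n. smconv \<mu> (K n) \<alpha>) n)) =
    (\<Sum>n. orlicz_norm e (telescoped (\<lambda>n. smconv \<mu> (K n) \<alpha>) (Suc n))) + orlicz_norm e (telescoped (\<lambda>n. smconv \<mu> (K n) \<alpha>) 0)"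
    by (rule sums_unique[symmetric])
  also have "\<dots> \<le> (\<Sum>n. ennreal (B * real CARD('n)) * (a n + b n)) + ennreal B * (a 0 + b 0)"
    by (intro add_mono first suminf_le Suc) auto
  also have "(\<Sum>n. ennreal (B * real CARD('n)) * (a n + b n)) = ennreal (B * real CARD('n)) * pi_qkme q k m e \<mu> p"
    by (simp add: pi)
  \<comment> \<open>The summand at 0 is used a second time here, bounded by the whole
    series.\<close>
  also have "ennreal B * (a 0 + b 0) \<le> ennreal B * pi_qkme q k m e \<mu> p"
    unfolding pi using sum_le_suminf[of "\<lambda>n. a n + b n" "{0}"] by (intro mult_left_mono) auto
  also have "ennreal (B * real CARD('n)) * pi_qkme q k m e \<mu> p + ennreal B * pi_qkme q k m e \<mu> p
     = ennreal (B * (1 + real CARD('n))) * pi_qkme q k m e \<mu> p"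
  proof -
    have "ennreal (B * (1 + real CARD('n))) = ennreal (B * real CARD('n)) + ennreal B"
      using B' by (subst ennreal_plus[symmetric]) (auto simp: algebra_simps)
    then show ?thesis by (simp add: distrib_right)
  qed
  also have "\<dots> \<le> ennreal (B * (1 + real CARD('n))) * ennreal c"
    using p(2) by (intro mult_left_mono) auto
  also have "\<dots> = ennreal (B * (1 + real CARD('n)) * c)"
    using pos c by (simp add: ennreal_mult)
  finally show "(\<Sum>n. orlicz_norm e (telescoped (\<lambda>n. smconv \<mu> (K n) \<alpha>) n)) \<le> ennreal (B * (1 + real CARD('n)) * c)"
    by (simp add: add_left_mono)
qed


text \<open>The sum of the absolute increments is locally integrable and dominates every
  \<open>U n\<close>. This one majorant gives the limit, its norm, and convergence against every
  compactly supported continuous function.\<close>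

lemma orlicz_telescoped_limit:
  fixes U :: "nat \<Rightarrow> real^'n::finite \<Rightarrow> real"
  assumes E: "class_E e" and U [measurable]: "\<And>n. U n \<in> borel_measurable borel"
    and fin: "(\<Sum>n. orlicz_norm e (telescoped U n)) < top"
  shows "\<exists>g. locally_integrable g \<and> orlicz_norm e g \<le> (\<Sum>n. orlicz_norm e (telescoped U n)) \<and>
     (AE x in lborel. (\<lambda>n. U n x) \<longlonglongrightarrow> g x) \<and>
     (\<forall>f K. continuous_on UNIV f \<longrightarrow> compact K \<longrightarrow> (\<forall>x. x \<notin> K \<longrightarrow> f x = 0) \<longrightarrow>
        (\<lambda>n. LINT x|lborel. U n x * f x) \<longlonglongrightarrow> (LINT x|lborel. g x * f x))"
proof -
  define T where "T = telescoped U"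
  have T [measurable]: "T n \<in> borel_measurable lborel" for n
    by (cases n) (auto simp: T_def telescoped_def[abs_def])
  define S where "S x = (\<Sum>n. \<bar>T n x\<bar>)" for x
  define g where "g x = (\<Sum>n. T n x)" for x
  have [measurable]: "g \<in> borel_measurable borel" "S \<in> borel_measurable borel"
    using T unfolding g_def S_def by measurable
  note ser = orlicz_norm_suminf[OF E T, folded S_def[abs_def], unfolded T_def, OF fin, folded T_def]
  have Ssumm: "AE x in lborel. summable (\<lambda>n. \<bar>T n x\<bar>)" using ser(1) .
  have lim: "AE x in lborel. (\<lambda>n. U n x) \<longlonglongrightarrow> g x"
    using Ssumm
  proof eventually_elim
    fix x assume "summable (\<lambda>n. \<bar>T n x\<bar>)"
    then have "(\<lambda>N. \<Sum>n<N. T n x) \<longlonglongrightarrow> g x"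
      unfolding g_def by (rule summable_LIMSEQ[OF summable_rabs_cancel])
    then have "(\<lambda>N. \<Sum>n<Suc N. T n x) \<longlonglongrightarrow> g x" by (rule LIMSEQ_Suc)
    then show "(\<lambda>n. U n x) \<longlonglongrightarrow> g x" unfolding T_def sum_telescoped .
  qed
  have dom: "AE x in lborel. \<bar>U N x\<bar> \<le> S x" for N
    using Ssumm
  proof eventually_elim
    fix x assume *: "summable (\<lambda>n. \<bar>T n x\<bar>)"
    have "\<bar>U N x\<bar> = \<bar>\<Sum>n<Suc N. T n x\<bar>" unfolding T_def sum_telescoped ..
    also have "\<dots> \<le> (\<Sum>n<Suc N. \<bar>T n x\<bar>)" by (rule sum_abs)
    also have "\<dots> \<le> S x" unfolding S_def by (intro sum_le_suminf * ) auto
    finally show "\<bar>U N x\<bar> \<le> S x" .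
  qed
  have gS: "AE x in lborel. \<bar>g x\<bar> \<le> \<bar>S x\<bar>"
    using Ssumm
  proof eventually_elim
    fix x assume "summable (\<lambda>n. \<bar>T n x\<bar>)"
    then have "\<bar>g x\<bar> \<le> S x" unfolding S_def g_def by (rule summable_rabs)
    then show "\<bar>g x\<bar> \<le> \<bar>S x\<bar>" by simp
  qed
  have Sint: "set_integrable lborel K S" if "compact K" for K
    using ser(2) that by (simp add: locally_integrable_def S_def[abs_def])
  have "locally_integrable g"
    unfolding locally_integrable_def
  proof (intro conjI allI impI)
    fix K :: "(real^'n) set" assume K: "compact K"
    have [measurable]: "K \<in> sets borel" using K by (simp add: borel_closed compact_imp_closed)
    show "set_integrable lborel K g"
      unfolding set_integrable_def
    proof (rule Bochner_Integration.integrable_bound[OF Sint[OF K, unfolded set_integrable_def]])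
      show "AE x in lborel. norm (indicator K x *\<^sub>R g x) \<le> norm (indicator K x *\<^sub>R S x)"
        using gS by eventually_elim (auto simp: indicator_def)
    qed measurable
  qed measurable
  moreover have "orlicz_norm e g \<le> (\<Sum>n. orlicz_norm e (T n))"
    using ser(3) orlicz_norm_mono[OF E _ gS] by (simp add: S_def[abs_def])
  moreover have "(\<lambda>n. LINT x|lborel. U n x * f x) \<longlonglongrightarrow> (LINT x|lborel. g x * f x)"
    if f: "continuous_on UNIV f" and K: "compact K" "\<forall>x. x \<notin> K \<longrightarrow> f x = 0" for f K
  proof -
    obtain B where B: "\<And>x. \<bar>f x\<bar> \<le> B"
      using continuous_compact_support_integrable(2)[OF f K(1)] K(2) by blast
    have [measurable]: "f \<in> borel_measurable borel" by (rule borel_measurable_continuous_onI[OF f])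
    show ?thesis
    proof (rule integral_dominated_convergence[where w="\<lambda>x. B * (indicator K x *\<^sub>R S x)"])
      show "integrable lborel (\<lambda>x. B * (indicator K x *\<^sub>R S x))"
        using Sint[OF K(1)] by (intro integrable_mult_right) (simp add: set_integrable_def)
      show "AE x in lborel. (\<lambda>n. U n x * f x) \<longlonglongrightarrow> g x * f x"
        using lim by eventually_elim (intro tendsto_mult tendsto_const)
      show "AE x in lborel. norm (U n x * f x) \<le> B * (indicator K x *\<^sub>R S x)" for n
        using dom[of n]
      proof eventually_elim
        fix x assume *: "\<bar>U n x\<bar> \<le> S x"
        show "norm (U n x * f x) \<le> B * (indicator K x *\<^sub>R S x)"
        proof (cases "x \<in> K")
          case True
          then show ?thesis
            using mult_mono[OF * B[of x]] * by (simp add: abs_mult mult.commute)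
        next
          case False then show ?thesis using K(2) by simp
        qed
      qed
    qed measurable
  qed
  ultimately show ?thesis using lim unfolding T_def by blast
qed

section \<open>Approximate identities and the identification of the density\<close>

lemma nn_integral_conv_le:
  fixes D :: "('n::finite \<Rightarrow> nat) \<Rightarrow> real^'n \<Rightarrow> real"
  assumes M: "sets M = sets borel" "finite_measure M" and D: "D a \<in> borel_measurable borel" "integrable lborel (D a)"
    and C: "(LINT x|lborel. \<bar>D a x\<bar>) \<le> C"
    and int: "\<And>x. integrable M (\<lambda>y. D a (x - y))"
  shows "(\<integral>\<^sup>+x. ennreal \<bar>conv M (\<lambda>_. 1) D a x\<bar> \<partial>lborel) \<le> ennreal C * emeasure M (space M)"
proof -
  interpret M: finite_measure M by fact
  interpret P: pair_sigma_finite "lborel :: (real^'n) measure" M by unfold_locales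
  have [measurable_cong]: "sets M = sets borel" by fact
  have [measurable]: "D a \<in> borel_measurable borel" by fact
  have "(\<integral>\<^sup>+x. ennreal \<bar>conv M (\<lambda>_. 1) D a x\<bar> \<partial>lborel) \<le> (\<integral>\<^sup>+x. (\<integral>\<^sup>+y. ennreal \<bar>D a (x - y)\<bar> \<partial>M) \<partial>lborel)"
    unfolding conv_def using integral_norm_bound_ennreal[OF int] by (intro nn_integral_mono) simp
  also have "\<dots> = (\<integral>\<^sup>+y. (\<integral>\<^sup>+x. ennreal \<bar>D a (x - y)\<bar> \<partial>lborel) \<partial>M)"
    by (intro P.Fubini'[symmetric]) measurable
  also have "\<dots> = (\<integral>\<^sup>+y. (\<integral>\<^sup>+x. ennreal \<bar>D a x\<bar> \<partial>lborel) \<partial>M)"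
    by (simp add: nn_integral_lborel_translate[of "\<lambda>x. ennreal \<bar>D a x\<bar>"])
  also have "(\<integral>\<^sup>+x. ennreal \<bar>D a x\<bar> \<partial>lborel) = ennreal (LINT x|lborel. \<bar>D a x\<bar>)"
    using D by (intro nn_integral_eq_integral) auto
  also have "(\<integral>\<^sup>+y. ennreal (LINT x|lborel. \<bar>D a x\<bar>) \<partial>M) \<le> ennreal C * emeasure M (space M)"
    using C by (simp add: mult_right_mono ennreal_leI)
  finally show ?thesis .
qed

text \<open>By Fubini the kernel moves to \<open>f\<close>, whose averages \<open>m n y\<close>
  converge to \<open>f y\<close> by continuity and stay bounded by \<open>B * C\<close>, so
  dominated convergence applies under \<open>M\<close>. The kernel may change sign, hence its
  \<open>L^1\<close> bound \<open>C\<close> replaces its mass in the estimates.\<close>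

lemma conv_integral_tendsto:
  fixes K :: "nat \<Rightarrow> ('n::finite \<Rightarrow> nat) \<Rightarrow> real^'n \<Rightarrow> real"
  assumes M: "sets M = sets borel" "finite_measure M"
    and K: "\<And>n. dyadic_family n J A (K n)" and A: "0 \<le> A"
    and one: "\<And>n. (LINT x|lborel. K n (\<lambda>_. 0) x) = 1"
    and f: "continuous_on UNIV f" "integrable lborel f" "\<And>x. \<bar>f x\<bar> \<le> B"
  shows "(\<lambda>n. LINT x|lborel. f x * conv M (\<lambda>_. 1) (K n) (\<lambda>_. 0) x) \<longlonglongrightarrow> (\<integral>y. f y \<partial>M)"
proof -
  interpret M: finite_measure M by fact
  have [measurable_cong]: "sets M = sets borel" by fact
  have [measurable]: "f \<in> borel_measurable borel" by (rule borel_measurable_continuous_onI[OF f(1)])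
  define k where "k n = K n (\<lambda>_. 0)" for n
  have km [measurable]: "k n \<in> borel_measurable borel" for n
    unfolding k_def by (rule deriv_family_borel[OF dyadic_familyD[OF K]])
  define C where "C = A * 2 ^ CARD('n)"
  have C: "0 \<le> C" using A by (simp add: C_def)
  have kint: "integrable lborel (k n)" "(LINT x|lborel. \<bar>k n x\<bar>) \<le> C" for n
    using dyadic_family_integral_abs_le[OF K[of n], of "\<lambda>_. 0" 0] A by (auto simp: k_def C_def)
  have ksupp: "k n x = 0" if "x \<notin> dyadic_box n" for n x
    using K[of n] that by (simp add: k_def dyadic_family_def)
  have kam: "(\<lambda>x. \<bar>k n x\<bar>) \<in> borel_measurable borel" for n by measurable
  have kint': "integrable lborel (\<lambda>x. k n (x - y))" "(LINT x|lborel. k n (x - y)) = 1"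
      "(LINT x|lborel. \<bar>k n (x - y)\<bar>) \<le> C" for n y
    using integrable_lborel_translate[OF kint(1)] integral_lborel_translate[OF km] kint(2)
      integral_lborel_translate[OF kam] one by (auto simp: k_def)
  define m where "m n y = (LINT x|lborel. f x * k n (x - y))" for n y
  have small: "\<bar>LINT x|lborel. h x * k n (x - y)\<bar> \<le> b * C"
    if "0 \<le> b" "\<And>x. x - y \<in> dyadic_box n \<Longrightarrow> \<bar>h x\<bar> \<le> b" for h b n y
  proof -
    have "\<bar>LINT x|lborel. h x * k n (x - y)\<bar> \<le> (LINT x|lborel. \<bar>h x * k n (x - y)\<bar>)"
      by (rule integral_abs_bound)
    also have "\<dots> \<le> (LINT x|lborel. b * \<bar>k n (x - y)\<bar>)"
    proof (rule integral_mono')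
      show "\<bar>h x * k n (x - y)\<bar> \<le> b * \<bar>k n (x - y)\<bar>" for x
        using that(2)[of x] ksupp[of "x - y" n] unfolding abs_mult
        by (cases "x - y \<in> dyadic_box n") (auto intro: mult_right_mono)
    qed (use kint' that(1) in auto)
    also have "\<dots> \<le> b * C" using kint'(3) that(1) by (simp add: mult_left_mono)
    finally show ?thesis .
  qed
  have B: "0 \<le> B" using order_trans[OF abs_ge_zero f(3)] .
  have "(\<lambda>n. \<integral>y. m n y \<partial>M) \<longlonglongrightarrow> (\<integral>y. f y \<partial>M)"
  proof (rule integral_dominated_convergence[where w="\<lambda>_. B * C"])
    show "AE y in M. norm (m n y) \<le> B * C" for n
      unfolding m_def using small[OF B f(3)] by (intro AE_I2) simp
    show "AE y in M. (\<lambda>n. m n y) \<longlonglongrightarrow> f y"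
    proof (rule AE_I2, rule LIMSEQ_I)
      fix y and r :: real assume r: "0 < r"
      \<comment> \<open>Dividing by \<open>C + 1\<close> allows \<open>C = 0\<close> and keeps
        \<open>b * C\<close> strictly below \<open>r\<close>.\<close>
      define b where "b = r / (C + 1)"
      have b: "0 < b" using r C by (simp add: b_def)
      have "isCont f y" using f(1) by (simp add: continuous_on_eq_continuous_at)
      then obtain d where d: "0 < d" "\<And>x. dist x y < d \<Longrightarrow> dist (f x) (f y) < b"
        using b unfolding continuous_at_eps_delta by blast
      \<comment> \<open>The \<open>l^1\<close> norm on the box is at most \<open>CARD('n)\<close>
        times the half side, so the box fits into the ball of radius \<open>d\<close>.\<close>
      obtain n0 where n0: "(1/2) ^ n0 < d / real CARD('n)"
        using real_arch_pow_inv[of "d / real CARD('n)" "1/2"] d by auto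
      show "\<exists>n0. \<forall>n\<ge>n0. norm (m n y - f y) < r"
      proof (intro exI[of _ n0] allI impI)
        fix n assume n: "n0 \<le> n"
        have near: "\<bar>f x - f y\<bar> \<le> b" if "x - y \<in> dyadic_box n" for x
        proof -
          have "norm (x - y) \<le> (\<Sum>i\<in>UNIV. \<bar>(x - y) $ i\<bar>)" by (rule norm_le_l1_cart)
          also have "\<dots> \<le> (\<Sum>i\<in>(UNIV::'n set). (1/2) ^ n0)"
          proof (rule sum_mono)
            fix i
            have "\<bar>(x - y) $ i\<bar> \<le> (1/2) ^ n" using that by (simp add: mem_dyadic_box power_one_over)
            also have "\<dots> \<le> (1/2) ^ n0" using n by (intro power_decreasing) auto
            finally show "\<bar>(x - y) $ i\<bar> \<le> (1/2) ^ n0" .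
          qed
          also have "\<dots> < d" using n0 by (simp add: field_simps)
          finally show ?thesis using d(2)[of x] by (simp add: dist_norm)
        qed
        have "m n y - f y = (LINT x|lborel. f x * k n (x - y)) - (LINT x|lborel. f y * k n (x - y))"
          using kint' by (simp add: m_def)
        also have "\<dots> = (LINT x|lborel. (f x - f y) * k n (x - y))"
          unfolding left_diff_distrib
        proof (rule Bochner_Integration.integral_diff[symmetric])
          have "integrable lborel (\<lambda>x. k n (x - y) * f x)"
            using kint'(1) f(3) by (intro integrable_mult_bounded) auto
          then show "integrable lborel (\<lambda>x. f x * k n (x - y))" by (simp add: mult.commute)
        qed (use kint' in simp)
        finally have "\<bar>m n y - f y\<bar> \<le> b * C" using small[of b y n "\<lambda>x. f x - f y"] b near by simp
        also have "\<dots> < r" using r C by (simp add: b_def field_simps)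
        finally show "norm (m n y - f y) < r" by simp
      qed
    qed
    show "m n \<in> borel_measurable M" for n unfolding m_def by measurable
  qed (use M in auto)
  moreover have "(\<integral>y. m n y \<partial>M) = (LINT x|lborel. f x * conv M (\<lambda>_. 1) (K n) (\<lambda>_. 0) x)" for n
  proof -
    obtain B' where B': "\<And>x. \<bar>k n x\<bar> \<le> B'"
      using compact_support_bounded[OF dyadic_familyD[OF K] dyadic_family_compact_support[OF K], of n "\<lambda>_. 0"]
      unfolding k_def by blast
    have "(\<integral>y. 1 * (LINT x|lborel. f x * k n (x - y)) \<partial>M) = (LINT x|lborel. f x * (\<integral>y. 1 * k n (x - y) \<partial>M))"
      using f B' by (intro integral_conv_swap M M.sigma_finite_measure_axioms) auto
    then show ?thesis by (simp add: m_def conv_def k_def)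
  qed
  ultimately show ?thesis by simp
qed

text \<open>Indicators of open sets are limits of compactly supported continuous functions, which
  gives the identity on open sets. These are closed under intersection and generate the Borel sets,
  and Dynkin's argument does the rest, also for signed set functions.\<close>

lemma is_densityI:
  fixes \<mu> :: "'n::finite smeasure"
  assumes \<mu>: "finite_signed_measure \<mu>" and p: "integrable lborel p"
    and eq: "\<And>f K. continuous_on UNIV f \<Longrightarrow> compact K \<Longrightarrow> (\<And>x. x \<notin> K \<Longrightarrow> f x = 0) \<Longrightarrow>
      (LINT x|lborel. p x * f x) = sm_integral \<mu> f"
  shows "is_density \<mu> p"
  unfolding is_density_def
proof (intro conjI ballI p)
  note \<mu>D = finite_signed_measureD[OF \<mu>]
  interpret M1: finite_measure "fst \<mu>" by fact
  interpret M2: finite_measure "snd \<mu>" by fact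
  have [measurable_cong]: "sets (fst \<mu>) = sets borel" "sets (snd \<mu>) = sets borel" by fact+
  have space: "space (fst \<mu>) = UNIV" "space (snd \<mu>) = UNIV"
    using \<mu>D(1,2) by (auto dest: sets_eq_imp_space_eq)
  have pm [measurable]: "p \<in> borel_measurable borel" using borel_measurable_integrable[OF p] by simp
  have set_int: "set_integrable lborel A p" if "A \<in> sets borel" for A
    unfolding set_integrable_def using p that by (intro integrable_mult_indicator) auto
  have op: "sm_apply \<mu> U = (LINT x:U|lborel. p x)" if U: "open U" for U
  proof -
    \<comment> \<open>The ball truncates the support of the cut-off to a compact set. It also keeps
      \<open>V n\<close> nonempty, which matters because \<open>infdist\<close> to the empty set is
      0.\<close>
    define V where "V n = - (U \<inter> ball 0 (real n))" for n :: nat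
    have V: "closed (V n)" "V n \<noteq> {}" for n
    proof -
      show "closed (V n)" unfolding V_def using U by (intro closed_Compl open_Int) auto
      have "\<not> bounded (UNIV :: (real^'n) set)" by (rule not_bounded_UNIV)
      then have "U \<inter> ball 0 (real n) \<noteq> UNIV" using bounded_ball[of 0 "real n"] by (metis bounded_Int)
      then show "V n \<noteq> {}" unfolding V_def by blast
    qed
    define f where "f n x = min 1 (real n * infdist x (V n))" for n x
    have fc: "continuous_on UNIV (f n)" for n unfolding f_def by (intro continuous_intros)
    have [measurable]: "f n \<in> borel_measurable borel" for n by (rule borel_measurable_continuous_onI[OF fc])
    have U' [measurable]: "U \<in> sets borel" using U by simp
    have f1: "\<bar>f n x\<bar> \<le> 1" for n x by (simp add: f_def infdist_nonneg abs_le_iff min_def)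
    have f0: "f n x = 0" if "x \<notin> U \<or> norm x \<ge> real n" for n x
    proof -
      have "x \<in> V n" using that by (auto simp: V_def)
      then show ?thesis by (simp add: f_def)
    qed
    have flim: "(\<lambda>n. f n x) \<longlonglongrightarrow> indicator U x" for x
    proof (cases "x \<in> U")
      case False
      then show ?thesis by (simp add: f0)
    next
      case True
      then obtain s where s: "0 < s" "ball x s \<subseteq> U" using U by (meson openE)
      \<comment> \<open>Within distance \<open>s\<close> of \<open>x\<close> one stays in
        \<open>U\<close>, and within distance 1 in every ball of radius at least
        \<open>norm x + 1\<close>; so \<open>x\<close> has distance at least \<open>t\<close> from
        \<open>V n\<close> for large \<open>n\<close>.\<close>
      define t where "t = min s 1"
      have t: "0 < t" using s by (simp add: t_def)
      obtain n0 :: nat where n0: "norm x + 1 \<le> real n0" "1 / t \<le> real n0"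
        by (metis max.bounded_iff real_arch_simple)
      have "f n x = 1" if "n \<ge> n0" for n
      proof -
        have "t \<le> infdist x (V n)"
          unfolding infdist_notempty[OF V(2)]
        proof (rule cINF_greatest[OF V(2)])
          fix v assume v: "v \<in> V n"
          show "t \<le> dist x v"
          proof (rule ccontr)
            assume "\<not> t \<le> dist x v"
            then have d: "dist x v < s" "dist x v < 1" by (auto simp: t_def)
            then have "v \<in> U" using s by auto
            moreover have "norm v \<le> norm x + dist x v"
              by (metis dist_commute dist_norm norm_triangle_sub)
            then have "norm v < real n" using d n0 that by (simp add: le_trans) 
            ultimately show False using v by (simp add: V_def)
          qed
        qed
        then have "real n0 * t \<le> real n * infdist x (V n)" using that t by (intro mult_mono) auto
        moreover have "1 \<le> real n0 * t" using n0 t by (simp add: field_simps)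
        ultimately show ?thesis by (simp add: f_def)
      qed
      then have "eventually (\<lambda>n. f n x = indicator U x) sequentially"
        using True unfolding eventually_sequentially by (intro exI[of _ n0]) simp
      then show ?thesis by (rule tendsto_eventually)
    qed
    have "(\<lambda>n. \<integral>x. f n x \<partial>fst \<mu>) \<longlonglongrightarrow> (\<integral>x. indicator U x \<partial>fst \<mu>)"
      by (rule integral_dominated_convergence[where w="\<lambda>_. 1"]) (auto simp: flim f1)
    moreover have "(\<lambda>n. \<integral>x. f n x \<partial>snd \<mu>) \<longlonglongrightarrow> (\<integral>x. indicator U x \<partial>snd \<mu>)"
      by (rule integral_dominated_convergence[where w="\<lambda>_. 1"]) (auto simp: flim f1)
    ultimately have "(\<lambda>n. sm_integral \<mu> (f n)) \<longlonglongrightarrow> sm_apply \<mu> U"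
      unfolding sm_integral_def sm_apply_def using \<mu>D(1,2) U' space by (auto intro: tendsto_diff)
    moreover have "sm_integral \<mu> (f n) = (LINT x|lborel. p x * f n x)" for n
      by (rule eq[OF fc, of "cball 0 (real n)", symmetric]) (auto intro: f0)
    moreover have "(\<lambda>n. LINT x|lborel. p x * f n x) \<longlonglongrightarrow> (LINT x|lborel. p x * indicator U x)"
    proof (rule integral_dominated_convergence[where w="\<lambda>x. \<bar>p x\<bar>"])
      show "AE x in lborel. (\<lambda>n. p x * f n x) \<longlonglongrightarrow> p x * indicator U x"
        by (intro AE_I2 tendsto_mult tendsto_const flim)
      show "AE x in lborel. norm (p x * f n x) \<le> \<bar>p x\<bar>" for n
        using mult_left_mono[OF f1] by (intro AE_I2) (force simp: abs_mult)
    qed (use p in auto)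
    ultimately have "sm_apply \<mu> U = (LINT x|lborel. p x * indicator U x)"
      using LIMSEQ_unique by simp
    then show ?thesis by (simp add: set_lebesgue_integral_def mult.commute)
  qed
  fix X :: "(real^'n) set" assume "X \<in> sets borel"
  then have X: "X \<in> sigma_sets UNIV {S. open S}" by (simp add: borel_def)
  have "Int_stable {S :: (real^'n) set. open S}" by (auto simp: Int_stable_def)
  then show "sm_apply \<mu> X = (LINT x:X|lborel. p x)"
    using subset_UNIV[of "{S. open S}", folded Pow_UNIV] X
  proof (induction rule: sigma_sets_induct_disjoint)
    case (basic A)
    then show ?case by (simp add: op)
  next
    case empty
    then show ?case by (simp add: sm_apply_def set_lebesgue_integral_def)
  next
    case (compl A)
    then have A: "A \<in> sets borel" by (simp add: borel_def)
    have "measure (fst \<mu>) (UNIV - A) = measure (fst \<mu>) UNIV - measure (fst \<mu>) A"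
      "measure (snd \<mu>) (UNIV - A) = measure (snd \<mu>) UNIV - measure (snd \<mu>) A"
      using M1.finite_measure_compl[of A] M2.finite_measure_compl[of A] \<mu>D(1,2) A space by auto
    then have "sm_apply \<mu> (UNIV - A) = sm_apply \<mu> UNIV - sm_apply \<mu> A" by (simp add: sm_apply_def)
    also have "\<dots> = (LINT x:UNIV|lborel. p x) - (LINT x:A|lborel. p x)" using op[of UNIV] compl by simp
    also have "(LINT x:UNIV|lborel. p x) = (LINT x:(UNIV - A) \<union> A|lborel. p x)" by simp
    also have "\<dots> = (LINT x:(UNIV - A)|lborel. p x) + (LINT x:A|lborel. p x)"
      using A set_int by (intro set_integral_Un) auto
    finally show ?case by simp
  next
    case (union F)
    then have F: "F i \<in> sets borel" for i by (auto simp: borel_def)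
    have "(\<lambda>i. measure (fst \<mu>) (F i) - measure (snd \<mu>) (F i)) sums (measure (fst \<mu>) (\<Union>i. F i) - measure (snd \<mu>) (\<Union>i. F i))"
      using F union \<mu>D(1,2) by (intro sums_diff M1.finite_measure_UNION M2.finite_measure_UNION) auto
    then have "sm_apply \<mu> (\<Union>i. F i) = (\<Sum>i. (LINT x:F i|lborel. p x))"
      using union by (simp add: sm_apply_def sums_iff)
    also have "\<dots> = (LINT x:(\<Union>i. F i)|lborel. p x)"
      using F union set_int
      by (intro lebesgue_integral_countable_add[symmetric]) (auto simp: disjoint_family_on_def)
    finally show ?case .
  qed
qed

lemma is_density_abs_cont:
  assumes "is_density \<mu> p" shows "sm_abs_cont \<mu>"
  unfolding sm_abs_cont_def
proof (intro ballI impI)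
  fix A B :: "(real^'a) set" assume A: "A \<in> sets borel" "emeasure lborel A = 0" and B: "B \<in> sets borel" "B \<subseteq> A"
  have "AE x in lborel. x \<notin> A" using A by (intro AE_not_in) auto
  then have "AE x in lborel. indicator B x *\<^sub>R p x = 0"
    by eventually_elim (use B in \<open>auto simp: indicator_def\<close>)
  then have "(LINT x:B|lborel. p x) = 0"
    unfolding set_lebesgue_integral_def by (rule integral_eq_zero_AE)
  with assms B show "sm_apply \<mu> B = 0" by (simp add: is_density_def)
qed


theorem mainTheorem1:
  fixes q k m :: nat and e :: "real \<Rightarrow> real"
  assumes "m \<ge> 1" and "class_E e"
  shows "\<exists>C::real. \<forall>\<mu> :: 'n::finite smeasure. \<mu> \<in> S_qkme q k m e \<longrightarrow>
           sm_abs_cont \<mu> \<and>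
           (\<exists>p. is_density \<mu> p \<and> p \<in> W_space q e \<and>
                sobolev_norm q e p \<le> ennreal C * rho_qkme q k m e \<mu>)"
proof -
  note E = assms(2)
  \<comment> \<open>The order up to which kernels need uniform bounds: q derivatives of the density
    and k of the test function.\<close>
  define J where "J = q + k"
  have "2 * m \<ge> 1" using assms(1) by simp
  from dyadic_kernel_families[OF this, where 'n='n and J=J]
  obtain A and K :: "nat \<Rightarrow> ('n \<Rightarrow> nat) \<Rightarrow> real^'n \<Rightarrow> real" and \<Delta> \<Lambda> \<gamma> where
    A: "0 < A" and K': "\<forall>n. dyadic_family n J A (K n)" and one': "\<forall>n. (LINT x|lborel. K n (\<lambda>_. 0) x) = 1"
    and sum': "\<forall>n a x. K (Suc n) a x - K n a x = (\<Sum>t<CARD('n). \<Delta> n t a x)"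
    and \<Delta>\<Lambda>': "\<forall>n t. dyadic_family n J A (\<Delta> n t) \<and> dyadic_family n J A (\<Lambda> n t)"
    and eq': "\<forall>n t a x. \<Delta> n t a x = 1 / 2 ^ (n * (2 * m)) * \<Lambda> n t (\<lambda>i. a i + \<gamma> t i) x"
    and \<gamma>': "\<forall>t. mi_abs (\<gamma> t) = 2 * m"
    by - (elim exE conjE, rule that)
  note K = K'[rule_format] and one = one'[rule_format] and sum = sum'[rule_format]
    and \<Delta> = \<Delta>\<Lambda>'[rule_format, THEN conjunct1] and \<Lambda> = \<Delta>\<Lambda>'[rule_format, THEN conjunct2]
    and \<Delta>\<Lambda> = eq'[rule_format] and \<gamma> = \<gamma>'[rule_format]
  define B where "B = real (card (multi_indices k :: ('n \<Rightarrow> nat) set)) * A * 2 ^ CARD('n)"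
  define C where "C = B * (1 + real CARD('n))"
  \<comment> \<open>\<open>C\<close> bounds each derivative of the density; the Sobolev norm adds up
    one such bound per multi-index.\<close>
  define C' where "C' = real (card (multi_indices q :: ('n \<Rightarrow> nat) set)) * C"
  have C: "0 \<le> C" using A by (simp add: C_def B_def)
  show ?thesis
  proof (intro exI[of _ C'] allI impI)
    fix \<mu> :: "'n smeasure" assume "\<mu> \<in> S_qkme q k m e"
    then have \<mu>: "finite_signed_measure \<mu>" and \<rho>: "rho_qkme q k m e \<mu> < top"
      by (auto simp: S_qkme_def)
    define U where "U \<alpha> n = smconv \<mu> (K n) \<alpha>" for \<alpha> n
    have Ufam: "deriv_family (\<lambda>\<alpha>. U \<alpha> n)" for n
      unfolding U_def by (rule deriv_family_smconv[OF \<mu> K])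
    have Um: "U \<alpha> n \<in> borel_measurable borel" for \<alpha> n by (rule deriv_family_borel[OF Ufam])
    have ser: "(\<Sum>n. orlicz_norm e (telescoped (U \<alpha>) n)) \<le> ennreal C * rho_qkme q k m e \<mu>" if "mi_abs \<alpha> \<le> q" for \<alpha>
      unfolding U_def C_def
      by (rule suminf_orlicz_telescoped_le[OF E \<mu> A K \<Delta> \<Lambda> sum \<Delta>\<Lambda> \<gamma> that _ B_def]) (simp add: J_def)
    have fin: "ennreal C * rho_qkme q k m e \<mu> < top" using \<rho> by (simp add: ennreal_mult_less_top)
    \<comment> \<open>The properties of the limit are bundled into one predicate, so that a single
      choice provides the whole family \<open>g\<close>.\<close>
    define is_limit where "is_limit \<alpha> g \<longleftrightarrow>
       locally_integrable g \<and> orlicz_norm e g \<le> ennreal C * rho_qkme q k m e \<mu> \<and>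
       (AE x in lborel. (\<lambda>n. U \<alpha> n x) \<longlonglongrightarrow> g x) \<and>
       (\<forall>f K. continuous_on UNIV f \<longrightarrow> compact K \<longrightarrow> (\<forall>x. x \<notin> K \<longrightarrow> f x = 0) \<longrightarrow>
          (\<lambda>n. LINT x|lborel. U \<alpha> n x * f x) \<longlonglongrightarrow> (LINT x|lborel. g x * f x))" for \<alpha> g
    have "\<exists>g. is_limit \<alpha> g" if \<alpha>: "mi_abs \<alpha> \<le> q" for \<alpha>
    proof -
      obtain g where "locally_integrable g" and le: "orlicz_norm e g \<le> (\<Sum>n. orlicz_norm e (telescoped (U \<alpha>) n))"
        and "AE x in lborel. (\<lambda>n. U \<alpha> n x) \<longlonglongrightarrow> g x"
        and "\<forall>f K. continuous_on UNIV f \<longrightarrow> compact K \<longrightarrow> (\<forall>x. x \<notin> K \<longrightarrow> f x = 0) \<longrightarrow>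
          (\<lambda>n. LINT x|lborel. U \<alpha> n x * f x) \<longlonglongrightarrow> (LINT x|lborel. g x * f x)"
        using orlicz_telescoped_limit[OF E Um le_less_trans[OF ser[OF \<alpha>] fin]]
        by - (elim exE conjE, rule that)
      then have "is_limit \<alpha> g" unfolding is_limit_def
        using order_trans[OF le ser[OF \<alpha>]] by (intro conjI)
      then show ?thesis by blast
    qed
    then obtain g where lim: "\<And>\<alpha>. mi_abs \<alpha> \<le> q \<Longrightarrow> is_limit \<alpha> (g \<alpha>)" by metis
    have g: "locally_integrable (g \<alpha>)"
      "orlicz_norm e (g \<alpha>) \<le> ennreal C * rho_qkme q k m e \<mu>"
      "AE x in lborel. (\<lambda>n. U \<alpha> n x) \<longlonglongrightarrow> g \<alpha> x" if "mi_abs \<alpha> \<le> q" for \<alpha>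
      using lim[OF that] unfolding is_limit_def by blast+
    have g_tendsto: "(\<lambda>n. LINT x|lborel. U \<alpha> n x * f x) \<longlonglongrightarrow> (LINT x|lborel. g \<alpha> x * f x)"
      if "mi_abs \<alpha> \<le> q" "continuous_on UNIV f" "compact K" "\<And>x. x \<notin> K \<Longrightarrow> f x = 0" for \<alpha> f K
      using lim[OF that(1)] that(2-) unfolding is_limit_def by blast
    define p where "p = g (\<lambda>_. 0)"
    \<comment> \<open>For each \<open>n\<close> this is classical integration by parts for the
      smooth functions \<open>U \<alpha> n\<close>; both sides converge since test functions and
      their derivatives are continuous with compact support.\<close>
    have weak: "weak_deriv \<alpha> p (g \<alpha>)" if \<alpha>: "mi_abs \<alpha> \<le> q" for \<alpha>
      unfolding weak_deriv_def
    proof (intro conjI allI impI)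
      show "locally_integrable p" "locally_integrable (g \<alpha>)" using g(1) \<alpha> by (auto simp: p_def)
      fix \<phi> :: "real^'n \<Rightarrow> real" assume \<phi>: "test_function \<phi>"
      let ?K = "closure {x. \<phi> x \<noteq> 0}"
      have \<phi>': "smooth \<phi>" "compact ?K" using \<phi> by (auto simp: test_function_def)
      have "(\<lambda>n. LINT x|lborel. U (\<lambda>_. 0) n x * dmi \<alpha> \<phi> x) \<longlonglongrightarrow> (LINT x|lborel. p x * dmi \<alpha> \<phi> x)"
        unfolding p_def dmi_def
        by (rule g_tendsto[OF _ smooth_dlist_continuous[OF \<phi>'(1)] \<phi>'(2)])
          (auto intro: dlist_vanishes[OF _ outside_support])
      moreover have "(LINT x|lborel. U (\<lambda>_. 0) n x * dmi \<alpha> \<phi> x) = (-1) ^ mi_abs \<alpha> * (LINT x|lborel. U \<alpha> n x * \<phi> x)" for n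
        using deriv_family_integration_by_parts[OF Ufam \<phi>, of "\<lambda>_. 0" n \<alpha>] by simp
      moreover have "(\<lambda>n. (-1) ^ mi_abs \<alpha> * (LINT x|lborel. U \<alpha> n x * \<phi> x)) \<longlonglongrightarrow> (-1) ^ mi_abs \<alpha> * (LINT x|lborel. g \<alpha> x * \<phi> x)"
        using smooth_dlist_continuous[OF \<phi>'(1), of "[]"]
        by (intro tendsto_mult tendsto_const g_tendsto[OF \<alpha> _ \<phi>'(2)]) (auto intro: outside_support)
      ultimately show "(LINT x|lborel. p x * dmi \<alpha> \<phi> x) = (-1) ^ mi_abs \<alpha> * (LINT x|lborel. g \<alpha> x * \<phi> x)"
        by (simp only:) (rule LIMSEQ_unique)
    qed
    note \<mu>D = finite_signed_measureD[OF \<mu>]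
    have pm [measurable]: "p \<in> borel_measurable borel" using g(1)[of "\<lambda>_. 0"] by (simp add: p_def locally_integrable_def)
    \<comment> \<open>Bounds the \<open>L^1\<close> norms of all mollifications: total mass of \<mu>
      times the \<open>L^1\<close> bound of the kernels. Fatou's lemma hands it on to
      \<open>p\<close>, which so far is only locally integrable.\<close>
    define a where "a = ennreal (A * 2 ^ CARD('n)) * (emeasure (fst \<mu>) (space (fst \<mu>)) + emeasure (snd \<mu>) (space (snd \<mu>)))"
    have U_L1: "(\<integral>\<^sup>+x. ennreal \<bar>U (\<lambda>_. 0) n x\<bar> \<partial>lborel) \<le> a" for n
    proof -
      note Kd = dyadic_familyD[OF K[of n]] and Kc = dyadic_family_compact_support[OF K[of n]]
      have L: "(\<integral>\<^sup>+x. ennreal \<bar>conv M (\<lambda>_. 1) (K n) (\<lambda>_. 0) x\<bar> \<partial>lborel) \<le> ennreal (A * 2 ^ CARD('n)) * emeasure M (space M)"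
        if "sets M = sets borel" "finite_measure M" "integrable M (\<lambda>_. 1 :: real)" for M
      proof (rule nn_integral_conv_le[OF that(1,2)])
        show "K n (\<lambda>_. 0) \<in> borel_measurable borel" by (rule deriv_family_borel[OF Kd])
        show "integrable lborel (K n (\<lambda>_. 0))" "(LINT x|lborel. \<bar>K n (\<lambda>_. 0) x\<bar>) \<le> A * 2 ^ CARD('n)"
          using dyadic_family_integral_abs_le[OF K[of n], of "\<lambda>_. 0" 0] A by auto
        show "integrable M (\<lambda>y. K n (\<lambda>_. 0) (x - y))" for x
          using integrable_conv_integrand[OF Kd Kc that(1,3), of "\<lambda>_. 0" x] by simp
      qed
      have [measurable]: "conv (fst \<mu>) (\<lambda>_. 1) (K n) a \<in> borel_measurable borel" "conv (snd \<mu>) (\<lambda>_. 1) (K n) a \<in> borel_measurable borel" for a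
        by (rule deriv_family_borel[OF deriv_family_conv[OF Kd Kc]]; use \<mu>D in simp)+
      have "(\<integral>\<^sup>+x. ennreal \<bar>U (\<lambda>_. 0) n x\<bar> \<partial>lborel) \<le>
        (\<integral>\<^sup>+x. ennreal \<bar>conv (fst \<mu>) (\<lambda>_. 1) (K n) (\<lambda>_. 0) x\<bar> + ennreal \<bar>conv (snd \<mu>) (\<lambda>_. 1) (K n) (\<lambda>_. 0) x\<bar> \<partial>lborel)"
        by (intro nn_integral_mono) (simp add: U_def smconv_conv ennreal_plus[symmetric] ennreal_leI abs_triangle_ineq4 del: ennreal_plus)
      also have "\<dots> = (\<integral>\<^sup>+x. ennreal \<bar>conv (fst \<mu>) (\<lambda>_. 1) (K n) (\<lambda>_. 0) x\<bar> \<partial>lborel) + (\<integral>\<^sup>+x. ennreal \<bar>conv (snd \<mu>) (\<lambda>_. 1) (K n) (\<lambda>_. 0) x\<bar> \<partial>lborel)"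
        by (intro nn_integral_add) auto
      also have "\<dots> \<le> a"
        unfolding a_def distrib_left using L[OF \<mu>D(1,3,5)] L[OF \<mu>D(2,4,6)] by (rule add_mono)
      finally show ?thesis .
    qed
    have p_int: "integrable lborel p"
    proof (rule integrableI_bounded)
      have "(\<integral>\<^sup>+x. ennreal (norm (p x)) \<partial>lborel) = (\<integral>\<^sup>+x. liminf (\<lambda>n. ennreal \<bar>U (\<lambda>_. 0) n x\<bar>) \<partial>lborel)"
      proof (rule nn_integral_cong_AE)
        have "AE x in lborel. (\<lambda>n. U (\<lambda>_. 0) n x) \<longlonglongrightarrow> p x" using g(3)[of "\<lambda>_. 0"] by (simp add: p_def)
        then show "AE x in lborel. ennreal (norm (p x)) = liminf (\<lambda>n. ennreal \<bar>U (\<lambda>_. 0) n x\<bar>)"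
        proof eventually_elim
          fix x assume "(\<lambda>n. U (\<lambda>_. 0) n x) \<longlonglongrightarrow> p x"
          then have "(\<lambda>n. ennreal \<bar>U (\<lambda>_. 0) n x\<bar>) \<longlonglongrightarrow> ennreal (norm (p x))"
            by (auto intro: tendsto_ennrealI tendsto_rabs)
          then show "ennreal (norm (p x)) = liminf (\<lambda>n. ennreal \<bar>U (\<lambda>_. 0) n x\<bar>)"
            by (metis lim_imp_Liminf trivial_limit_sequentially)
        qed
      qed
      also have "\<dots> \<le> liminf (\<lambda>n. \<integral>\<^sup>+x. ennreal \<bar>U (\<lambda>_. 0) n x\<bar> \<partial>lborel)"
        using Um by (intro nn_integral_liminf) auto
      also have "\<dots> \<le> liminf (\<lambda>n. a)" by (intro Liminf_mono always_eventually allI U_L1)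
      also have "\<dots> = a" by (simp add: Liminf_const)
      also have "a < \<infinity>"
        using finite_measure.emeasure_finite[OF \<mu>D(3)] finite_measure.emeasure_finite[OF \<mu>D(4)]
        by (auto simp: a_def ennreal_mult_less_top less_top)
      finally show "(\<integral>\<^sup>+x. ennreal (norm (p x)) \<partial>lborel) < \<infinity>" .
    qed simp
    \<comment> \<open>Against a compactly supported continuous \<open>f\<close> the mollifications
      have two limits: the integral of \<open>f\<close> against \<mu>, from the approximate
      identity, and the one against \<open>p\<close>, from the domination. They must agree.\<close>
    have density: "is_density \<mu> p"
    proof (rule is_densityI[OF \<mu> p_int])
      fix f :: "real^'n \<Rightarrow> real" and S assume f: "continuous_on UNIV f" "compact S" "\<And>x. x \<notin> S \<Longrightarrow> f x = 0"
      obtain b where b: "\<And>x. \<bar>f x\<bar> \<le> b" using continuous_compact_support_integrable(2)[OF f] by blast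
      have f_int: "integrable lborel f" by (rule continuous_compact_support_integrable(1)[OF f])
      have lim: "(\<lambda>n. LINT x|lborel. f x * conv M (\<lambda>_. 1) (K n) (\<lambda>_. 0) x) \<longlonglongrightarrow> (\<integral>y. f y \<partial>M)"
        if "sets M = sets borel" "finite_measure M" for M
        using A by (intro conv_integral_tendsto[OF that K _ one f(1) f_int b]) simp
      have int: "integrable lborel (\<lambda>x. f x * conv M (\<lambda>_. 1) (K n) (\<lambda>_. 0) x)"
        if M: "sets M = sets borel" "integrable M (\<lambda>_. 1 :: real)" for M n
      proof -
        note Kd = dyadic_familyD[OF K[of n]] and Kc = dyadic_family_compact_support[OF K[of n]]
        obtain c where c: "\<And>x. \<bar>K n (\<lambda>_. 0) x\<bar> \<le> c" using compact_support_bounded[OF Kd Kc] by blast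
        show ?thesis
          using deriv_family_borel[OF deriv_family_conv[OF Kd Kc M]]
          by (intro integrable_mult_bounded[OF f_int _ abs_conv_le[OF Kd M c]]) simp
      qed
      have "(\<lambda>n. (LINT x|lborel. f x * conv (fst \<mu>) (\<lambda>_. 1) (K n) (\<lambda>_. 0) x) - (LINT x|lborel. f x * conv (snd \<mu>) (\<lambda>_. 1) (K n) (\<lambda>_. 0) x)) \<longlonglongrightarrow> sm_integral \<mu> f"
        unfolding sm_integral_def by (intro tendsto_diff lim \<mu>D)
      moreover have "(LINT x|lborel. f x * conv (fst \<mu>) (\<lambda>_. 1) (K n) (\<lambda>_. 0) x) - (LINT x|lborel. f x * conv (snd \<mu>) (\<lambda>_. 1) (K n) (\<lambda>_. 0) x)
        = (LINT x|lborel. U (\<lambda>_. 0) n x * f x)" for n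
        using int[OF \<mu>D(1,5)] int[OF \<mu>D(2,6)] by (simp add: U_def smconv_conv right_diff_distrib mult.commute)
      moreover have "(\<lambda>n. LINT x|lborel. U (\<lambda>_. 0) n x * f x) \<longlonglongrightarrow> (LINT x|lborel. p x * f x)"
        unfolding p_def by (rule g_tendsto[OF _ f]) simp
      ultimately show "(LINT x|lborel. p x * f x) = sm_integral \<mu> f"
        using LIMSEQ_unique by simp
    qed
    have "sobolev_norm q e p \<le> (\<Sum>\<alpha>\<in>(multi_indices q :: ('n \<Rightarrow> nat) set). ennreal C * rho_qkme q k m e \<mu>)"
      unfolding sobolev_norm_def
    proof (rule sum_mono)
      fix \<alpha> :: "'n \<Rightarrow> nat" assume "\<alpha> \<in> multi_indices q"
      then have \<alpha>: "mi_abs \<alpha> \<le> q" by (simp add: multi_indices_def)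
      \<comment> \<open>The weak derivative \<open>g \<alpha>\<close> competes in the infimum, with
        weight 1.\<close>
      have "weighted_deriv_norm e (\<lambda>_. 0) \<alpha> p \<le> orlicz_norm e (\<lambda>x. monom (\<lambda>_. 0) x * g \<alpha> x)"
        unfolding weighted_deriv_norm_def using weak[OF \<alpha>] by (intro Inf_lower imageI) simp
      also have "\<dots> = orlicz_norm e (g \<alpha>)" by (simp add: monom_def)
      also note g(2)[OF \<alpha>]
      finally show "weighted_deriv_norm e (\<lambda>_. 0) \<alpha> p \<le> ennreal C * rho_qkme q k m e \<mu>" .
    qed
    also have "\<dots> = ennreal C' * rho_qkme q k m e \<mu>"
      using C by (simp add: C'_def ennreal_mult ennreal_of_nat_eq_real_of_nat mult.assoc)
    finally have le: "sobolev_norm q e p \<le> ennreal C' * rho_qkme q k m e \<mu>" .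
    also have "\<dots> < top" using \<rho> by (simp add: ennreal_mult_less_top)
    finally have "p \<in> W_space q e" by (simp add: W_space_def)
    with density le is_density_abs_cont[OF density]
    show "sm_abs_cont \<mu> \<and> (\<exists>p. is_density \<mu> p \<and> p \<in> W_space q e \<and> sobolev_norm q e p \<le> ennreal C' * rho_qkme q k m e \<mu>)"
      by blast
  qed
qed

end
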